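(* Let $0<\alpha<1$, let $g:(0,\infty)\to[0,\infty)$ be a function with $0<\mathbb{E}[g(X_\alpha)]<\infty$, put $L_\alpha=1/\mathbb{E}[g(X_\alpha)]$, and let $h(t)=L_\alpha\mathbb{E}[g(S'_\alpha/t)]$, i.e. $$\gamma_\alpha(t)=L_\alpha\,\mathbb{E}[g(S'_\alpha/t)]\,f_\alpha(t),\qquad t>0.$$ Then the Poisson–Kingman model $\mathrm{PK}(\rho_\alpha,\gamma_\alpha)$ has the following properties, for $n=1,2,\ldots$: (i) $V_{n,1}=\dfrac1{\Gamma(n)}L_\alpha\,\mathbb{E}[g(X_\alpha\beta_{1,n-1})]$. (ii) For $k=1,2,\ldots,n$, $$V_{n,k}=\frac{\alpha^{k-1}\Gamma(k)}{\Gamma(n)}L_\alpha\,\mathbb{E}[g(X_{\alpha,k\alpha}\beta_{k\alpha,n-k\alpha})].$$ (iii) Equivalently, $$V_{n,k}=\frac{\alpha^{k-1}\Gamma(k)}{\Gamma(n)}L_\alpha\,\mathbb{E}\left[g\Big(\beta_{k,n-k}\sum_{j=1}^kX^{(j)}_\alpha D_j\Big)\right],$$ where $X^{(1)}_\alpha,\ldots,X_\alpha^{(k)}$ are i.i.d. copies of $X_\alpha$ and, independently, $(D_1,\ldots,D_k)$ is a $k$-variate Dirichlet$(1,\ldots,1)$ random vector, both independent of $\beta_{k,n-k}$.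
   Context: $S_\alpha,S_\alpha'$ are independent positive $\alpha$-stable variables with Laplace transform $e^{-\lambda^\alpha}$ and density $f_\alpha$. For $\theta>-\alpha$, $S_{\alpha,\theta}$ has density $\frac{\Gamma(\theta+1)}{\Gamma(\theta/\alpha+1)}t^{-\theta}f_\alpha(t)$. With $S_\alpha$ independent of $S_{\alpha,\theta}$, $X_{\alpha,\theta}=S_\alpha/S_{\alpha,\theta}$ and $X_\alpha=S_\alpha/S'_\alpha\overset{d}{=}X_{\alpha,0}$; the density of $X_\alpha$ is $\frac{\sin(\pi\alpha)}{\pi}\frac{y^{\alpha-1}}{y^{2\alpha}+2y^\alpha\cos(\pi\alpha)+1}$, $y>0$. $\beta_{a,b}$ is a beta$(a,b)$ variable, with the convention $\beta_{a,0}=1$. Random variables in the same product are independent. $V_{n,k}=\int_0^\infty\mathbb{G}^{(n,k)}_\alpha(t)\gamma_\alpha(t)dt$ with $\mathbb{G}_{\alpha}^{(n,k)}(t)=\frac{\alpha^{k}t^{-k\alpha}}{\Gamma(n-k\alpha)f_{\alpha}(t)}\int_{0}^{1}f_{\alpha}(tu)(1-u)^{n-k\alpha-1}du$; the EPPF of $\mathrm{PK}(\rho_\alpha,\gamma_\alpha)$ (the partition generated by the normalized ranked jumps of an $\alpha$-stable subordinator conditioned on total mass $t$, with $t$ mixed over $\gamma_\alpha$) is $V_{n,k}\prod_{j=1}^k\Gamma(n_j-\alpha)/\Gamma(1-\alpha)$. *)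

theory Defs
  imports "HOL-Probability.Probability"
begin

definition positive_stable :: "'a measure \<Rightarrow> real \<Rightarrow> ('a \<Rightarrow> real) \<Rightarrow> bool" where
  "positive_stable M \<alpha> S \<longleftrightarrow>
     S \<in> borel_measurable M \<and> (AE \<omega> in M. 0 < S \<omega>) \<and>
     (\<forall>l\<ge>0. (\<integral>\<omega>. exp (- l * S \<omega>) \<partial>M) = exp (- (l powr \<alpha>)))"

text \<open>
  Independence of two random variables with values in different types; the library constant
  \<^const>\<open>prob_space.indep_var\<close> asks for a common value type. Measurability is not included.
\<close>
definition indep_rv ::
  "'a measure \<Rightarrow> 'b measure \<Rightarrow> ('a \<Rightarrow> 'b) \<Rightarrow> 'c measure \<Rightarrow> ('a \<Rightarrow> 'c) \<Rightarrow> bool" where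
  "indep_rv M N X K Y \<longleftrightarrow>
     prob_space.indep_set M {X -` A \<inter> space M | A. A \<in> sets N} {Y -` A \<inter> space M | A. A \<in> sets K}"

text \<open>
  Here \<open>f\<close> stands for a density of the positive \<open>\<alpha>\<close>-stable law; this is the density of the
  polynomially tilted variable \<open>S\<^bsub>\<alpha>,\<theta>\<^esub>\<close>, for \<open>\<theta> > - \<alpha>\<close>.
\<close>
definition tilted_density :: "real \<Rightarrow> real \<Rightarrow> (real \<Rightarrow> real) \<Rightarrow> real \<Rightarrow> real" where
  "tilted_density \<alpha> \<theta> f t =
     (if 0 < t then Gamma (\<theta> + 1) / Gamma (\<theta> / \<alpha> + 1) * t powr (- \<theta>) * f t else 0)"

text \<open>The case \<open>b = 0\<close> is the convention \<open>\<beta>\<^bsub>a,0\<^esub> = 1\<close>.\<close>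
definition beta_law :: "real \<Rightarrow> real \<Rightarrow> real measure" where
  "beta_law a b =
     (if b = 0 then return borel 1
      else density lborel (\<lambda>x. ennreal
        (if 0 < x \<and> x < 1 then x powr (a - 1) * (1 - x) powr (b - 1) / Beta a b else 0)))"

text \<open>
  The Dirichlet law with parameters \<open>a 1, \<dots>, a k\<close> has its usual density with respect to Lebesgue
  measure in the first \<open>k - 1\<close> coordinates; the last coordinate is one minus their sum.
  For \<open>k = 1\<close> it is the point mass at \<open>1\<close>.
\<close>
definition dirichlet_law :: "nat \<Rightarrow> (nat \<Rightarrow> real) \<Rightarrow> (nat \<Rightarrow> real) measure" where
  "dirichlet_law k a =
     distr
       (density (PiM {1..<k} (\<lambda>_. lborel)) (\<lambda>x. ennreal
         (if (\<forall>i\<in>{1..<k}. 0 < x i) \<and> (\<Sum>i\<in>{1..<k}. x i) < 1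
          then Gamma (\<Sum>i\<in>{1..k}. a i) / (\<Prod>i\<in>{1..k}. Gamma (a i)) *
               (\<Prod>i\<in>{1..<k}. x i powr (a i - 1)) * (1 - (\<Sum>i\<in>{1..<k}. x i)) powr (a k - 1)
          else 0)))
       (PiM {1..k} (\<lambda>_. borel))
       (\<lambda>x. \<lambda>i\<in>{1..k}. if i = k then 1 - (\<Sum>j\<in>{1..<k}. x j) else x i)"

definition PK_G :: "real \<Rightarrow> (real \<Rightarrow> real) \<Rightarrow> nat \<Rightarrow> nat \<Rightarrow> real \<Rightarrow> real" where
  "PK_G \<alpha> f n k t =
     \<alpha> ^ k * t powr (- (real k * \<alpha>)) / (Gamma (real n - real k * \<alpha>) * f t) *
     (LBINT u:{0<..<1}. f (t * u) * (1 - u) powr (real n - real k * \<alpha> - 1))"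

text \<open>
  The weights of the exchangeable partition probability function
  \<open>V\<^bsub>n,k\<^esub> \<Prod>\<^sub>j \<Gamma>(n\<^sub>j - \<alpha>) / \<Gamma>(1 - \<alpha>)\<close> of the Poisson-Kingman model with stable density \<open>f\<close> and
  mixing density \<open>\<gamma>\<close> for the total mass.
\<close>
definition PK_V :: "real \<Rightarrow> (real \<Rightarrow> real) \<Rightarrow> (real \<Rightarrow> real) \<Rightarrow> nat \<Rightarrow> nat \<Rightarrow> real" where
  "PK_V \<alpha> f \<gamma> n k = (LBINT t:{0<..}. PK_G \<alpha> f n k t * \<gamma> t)"

text \<open>
  The integral defining \<open>V\<^bsub>n,k\<^esub>\<close> converges, so that \<open>PK_V\<close> is not the default value \<open>0\<close> that the
  Bochner integral gives to functions that are not integrable.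
\<close>
definition PK_V_converges :: "real \<Rightarrow> (real \<Rightarrow> real) \<Rightarrow> (real \<Rightarrow> real) \<Rightarrow> nat \<Rightarrow> nat \<Rightarrow> bool" where
  "PK_V_converges \<alpha> f \<gamma> n k \<longleftrightarrow> set_integrable lborel {0<..} (\<lambda>t. PK_G \<alpha> f n k t * \<gamma> t)"

end

theory Submission
  imports Defs
begin

text \<open>
  Integrating \<open>g(x / t)\<close> against \<open>G\<^bsub>n,k\<^esub>(t) f(t) f(x) dt dx\<close> gives \<open>V\<^bsub>n,k\<^esub> / L\<close>. So \<open>V\<^bsub>n,k\<^esub> / L\<close> is
  the integral of \<open>g\<close> against a finite measure, \<open>mix n k\<close>, which depends on neither \<open>g\<close> nor \<open>\<gamma>\<close>,
  and the three formulas say that \<open>mix n k\<close> is \<open>\<alpha>\<^bsup>k-1\<^esup> \<Gamma>(k) / \<Gamma>(n)\<close> times the law of the product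
  under the expectation (with \<open>k = 1\<close> in the first formula).

  For \<open>X\<^bsub>\<alpha>,k\<alpha>\<^esub> \<beta>\<^bsub>k\<alpha>,n-k\<alpha>\<^esub>\<close> this is the substitution \<open>s = t u\<close> in the double integral
  that defines the weight (\<open>mixing_subst\<close>, \<open>mix_tilted\<close>). For the other two products the laws are
  compared through the generalized Stieltjes transform \<open>Z \<mapsto> E (1 + l Z)\<^bsup>-n\<^esup>\<close>, which is the Laplace
  transform of \<open>Z\<close> times an independent gamma(\<open>n\<close>) variable and which determines the law
  (\<open>stieltjes_determines_measure\<close>). Gamma variables make it easy to compute. A gamma(\<open>a + b\<close>)
  variable times an independent beta(\<open>a,b\<close>) variable is gamma(\<open>a\<close>) (\<open>beta_law_stieltjes\<close>); a
  gamma(\<open>k\<close>) variable times an independent uniform Dirichlet vector is a vector of independent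
  exponential variables (\<open>dirichlet_stieltjes\<close>); and for \<open>mix n k\<close> itself the Laplace transform of
  the stable law reduces everything to the integral of \<open>y\<^bsup>k\<alpha>-1\<^esup> exp (- y\<^bsup>\<alpha>\<^esup>) exp (- (l y)\<^bsup>\<alpha>\<^esup>)\<close> over
  \<open>y\<close> (\<open>mixing_stieltjes\<close>). Up to a constant for \<open>mix n k\<close>, the result is always \<open>(1 + l\<^bsup>\<alpha>\<^esup>)\<^bsup>-k\<^esup>\<close>.

  Two facts about the stable density make this rigorous, and both come from the equation
  \<open>t f(t) = \<alpha> / \<Gamma>(1 - \<alpha>) \<integral>\<^sub>0\<^sup>t f(s) (t - s)\<^bsup>-\<alpha>\<^esup> ds\<close>, valid for almost every \<open>t\<close> (\<open>renewal\<close>). First,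
  \<open>f > 0\<close> almost everywhere on the half-line (\<open>f_pos\<close>), so that the division by \<open>f\<close> in \<open>G\<^bsub>n,k\<^esub>\<close> is
  harmless. Second, \<open>G\<^bsub>n,k\<^esub>\<close> is bounded (\<open>frac_avg_bound\<close>), as it has to be, since up to a constant it
  is the conditional probability of a partition given the total mass; hence all integrals converge as
  soon as \<open>E g(X\<^sub>\<alpha>)\<close> is finite.
\<close>

section \<open>Lebesgue measure on the positive half-line\<close>

text \<open>With a measure of its own for the half-line, dilations and shifts of the integration variable need
  no indicator functions.\<close>
definition lpos :: "real measure" where
  "lpos = density lborel (\<lambda>x. ennreal (indicator {0<..} x))"

lemma sets_lpos [simp, measurable_cong]: "sets lpos = sets borel"
  by (simp add: lpos_def)

lemma space_lpos [simp]: "space lpos = UNIV"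
  by (simp add: lpos_def)

lemma sigma_finite_lpos: "sigma_finite_measure lpos"
  unfolding lpos_def
  by (subst sigma_finite_measure.sigma_finite_iff_density_finite[OF sigma_finite_lborel]) auto

interpretation lpos: sigma_finite_measure lpos
  by (rule sigma_finite_lpos)

interpretation lpos_pair: pair_sigma_finite lpos lpos ..

lemma AE_lpos_pos: "AE x in lpos. 0 < x"
  unfolding lpos_def by (subst AE_density) (auto simp: indicator_def)

lemma nn_integral_lpos:
  assumes [measurable]: "\<phi> \<in> borel_measurable borel"
  shows "(\<integral>\<^sup>+x. \<phi> x \<partial>lpos) = (\<integral>\<^sup>+x. \<phi> x * indicator {0<..} x \<partial>lborel)"
  unfolding lpos_def
  by (subst nn_integral_density) (auto intro!: nn_integral_cong simp: mult.commute split: split_indicator)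

lemma nn_integral_lpos_cong:
  assumes "\<And>x. 0 < x \<Longrightarrow> \<phi> x = \<psi> x"
  shows "(\<integral>\<^sup>+x. \<phi> x \<partial>lpos) = (\<integral>\<^sup>+x. \<psi> x \<partial>lpos)"
  by (rule nn_integral_cong_AE) (use AE_lpos_pos assms in \<open>auto elim: eventually_mono\<close>)

lemma nn_integral_lpos_scale:
  assumes [measurable]: "\<phi> \<in> borel_measurable borel" and c: "0 < c"
  shows "(\<integral>\<^sup>+x. \<phi> x \<partial>lpos) = ennreal c * (\<integral>\<^sup>+x. \<phi> (c * x) \<partial>lpos)"
proof -
  have "(\<integral>\<^sup>+x. \<phi> x \<partial>lpos) = ennreal c * (\<integral>\<^sup>+x. \<phi> (c * x) * indicator {0<..} (c * x) \<partial>lborel)"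
    using nn_integral_real_affine[of "\<lambda>x. \<phi> x * indicator {0<..} x" c 0] c by (simp add: nn_integral_lpos)
  also have "(\<integral>\<^sup>+x. \<phi> (c * x) * indicator {0<..} (c * x) \<partial>lborel) = (\<integral>\<^sup>+x. \<phi> (c * x) \<partial>lpos)"
    using c by (subst nn_integral_lpos)
      (auto intro!: nn_integral_cong simp: zero_less_mult_iff split: split_indicator)
  finally show ?thesis .
qed

lemma nn_integral_lpos_shift:
  assumes [measurable]: "\<phi> \<in> borel_measurable borel" and a: "0 \<le> a"
  shows "(\<integral>\<^sup>+x. \<phi> x * indicator {a<..} x \<partial>lpos) = (\<integral>\<^sup>+x. \<phi> (a + x) \<partial>lpos)"
proof -
  have "(\<integral>\<^sup>+x. \<phi> x * indicator {a<..} x \<partial>lpos) = (\<integral>\<^sup>+x. \<phi> x * indicator {a<..} x \<partial>lborel)"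
    using a by (subst nn_integral_lpos) (auto intro!: nn_integral_cong split: split_indicator)
  also have "\<dots> = (\<integral>\<^sup>+x. \<phi> (a + x) * indicator {a<..} (a + x) \<partial>lborel)"
    using nn_integral_real_affine[of "\<lambda>x. \<phi> x * indicator {a<..} x" 1 a] by simp
  also have "\<dots> = (\<integral>\<^sup>+x. \<phi> (a + x) \<partial>lpos)"
    by (subst nn_integral_lpos) (auto intro!: nn_integral_cong split: split_indicator)
  finally show ?thesis .
qed

text \<open>Dilations preserve null sets. This lets an identity that holds almost everywhere be used at
  \<open>t * u\<close> for fixed \<open>t\<close> and almost every \<open>u\<close>.\<close>
lemma AE_lpos_scale:
  assumes "AE x in lpos. P x" and c: "0 < c" and [measurable]: "Measurable.pred borel P"
  shows "AE x in lpos. P (c * x)"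
proof -
  have "(\<integral>\<^sup>+x. indicator {x. \<not> P x} x \<partial>lpos) = ennreal c * (\<integral>\<^sup>+x. indicator {x. \<not> P x} (c * x) \<partial>lpos)"
    by (rule nn_integral_lpos_scale) (use c in auto)
  moreover have "(\<integral>\<^sup>+x. indicator {x. \<not> P x} x \<partial>lpos) = 0"
    by (subst nn_integral_0_iff_AE) (use assms(1) in \<open>auto elim: eventually_mono\<close>)
  ultimately have "(\<integral>\<^sup>+x. indicator {x. \<not> P x} (c * x) \<partial>lpos) = 0"
    using c by simp
  then show ?thesis
    by (subst (asm) nn_integral_0_iff_AE) (auto elim: eventually_mono simp: indicator_eq_0_iff)
qed

lemma nn_integral_lpos_Gamma:
  assumes a: "0 < a" and c: "0 < c"
  shows "(\<integral>\<^sup>+x. ennreal (x powr (a - 1) * exp (- c * x)) \<partial>lpos) = ennreal (Gamma a / c powr a)"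
proof -
  let ?G = "(\<integral>\<^sup>+x. ennreal (x powr (a - 1) * exp (- c * x)) \<partial>lpos)"
  have "ennreal (Gamma a) = (\<integral>\<^sup>+x. ennreal (indicator {0..} x * x powr (a - 1) / exp x) \<partial>lborel)"
    using a by (rule Gamma_conv_nn_integral_real)
  also have "\<dots> = (\<integral>\<^sup>+x. ennreal (x powr (a - 1) * exp (- x)) \<partial>lpos)"
    by (subst nn_integral_lpos)
      (auto intro!: nn_integral_cong simp: exp_minus field_simps split: split_indicator)
  also have "\<dots> = ennreal c * (\<integral>\<^sup>+x. ennreal ((c * x) powr (a - 1) * exp (- (c * x))) \<partial>lpos)"
    by (rule nn_integral_lpos_scale) (use c in auto)
  also have "(\<integral>\<^sup>+x. ennreal ((c * x) powr (a - 1) * exp (- (c * x))) \<partial>lpos) =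
      ennreal (c powr (a - 1)) * ?G"
    using c by (subst nn_integral_cmult[symmetric])
      (auto intro!: nn_integral_lpos_cong simp: powr_mult ennreal_mult'[symmetric] mult_ac)
  also have "ennreal c * (ennreal (c powr (a - 1)) * ?G) =
      ennreal (c powr a) * ?G"
    using c by (simp add: mult.assoc[symmetric] ennreal_mult'[symmetric] powr_mult_base)
  finally have eq: "ennreal (Gamma a) = \<dots>" .
  have "ennreal (Gamma a / c powr a) = ennreal (inverse (c powr a)) * ennreal (Gamma a)"
    using a c by (simp add: ennreal_mult[symmetric] divide_inverse mult.commute)
  also have "\<dots> = ennreal (inverse (c powr a) * c powr a) * ?G"
    unfolding eq using c by (subst ennreal_mult) (auto simp: mult.assoc)
  finally show ?thesis using c by simp
qed

lemma nn_integral_lpos_Beta: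
  assumes a: "0 < a" and b: "0 < b"
  shows "(\<integral>\<^sup>+u. ennreal (u powr (a - 1) * (1 - u) powr (b - 1)) * indicator {..<1} u \<partial>lpos) = ennreal (Beta a b)"
proof -
  have "((\<lambda>t. t powr (a - 1) * (1 - t) powr (b - 1)) has_integral Beta a b) {0<..<1}"
    using has_integral_Beta_real[OF a b] by (simp add: has_integral_Icc_iff_Ioo)
  from nn_integral_has_integral_lebesgue[OF _ this]
  have "(\<integral>\<^sup>+t. ennreal (indicator {0<..<1} t * (t powr (a - 1) * (1 - t) powr (b - 1))) \<partial>lborel) = ennreal (Beta a b)"
    by simp
  also have "(\<integral>\<^sup>+t. ennreal (indicator {0<..<1} t * (t powr (a - 1) * (1 - t) powr (b - 1))) \<partial>lborel) =
     (\<integral>\<^sup>+u. ennreal (u powr (a - 1) * (1 - u) powr (b - 1)) * indicator {..<1} u \<partial>lpos)"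
    by (subst nn_integral_lpos) (auto intro!: nn_integral_cong split: split_indicator)
  finally show ?thesis .
qed

lemma set_integrable_lpos:
  fixes \<phi> :: "real \<Rightarrow> real"
  assumes "\<phi> \<in> borel_measurable borel"
  shows "set_integrable lborel {0<..} \<phi> \<longleftrightarrow> integrable lpos \<phi>"
  using assms unfolding lpos_def set_integrable_def by (subst integrable_density) auto

lemma set_integral_lpos:
  fixes \<phi> :: "real \<Rightarrow> real"
  assumes "\<phi> \<in> borel_measurable borel"
  shows "(LBINT t:{0<..}. \<phi> t) = integral\<^sup>L lpos \<phi>"
  using assms unfolding lpos_def set_lebesgue_integral_def by (subst integral_density) auto

section \<open>Gamma and beta integrals\<close>

text \<open>The substitution rule for integrals is applied on the compact intervals \<open>[1/(m+1), m+2]\<close>, away from the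
  singularity of the derivative at \<open>0\<close>; both sides are increasing limits over these intervals.\<close>
lemma nn_integral_lpos_powr_subst:
  assumes [measurable]: "\<phi> \<in> borel_measurable borel" and \<alpha>: "0 < (\<alpha>::real)"
  shows "(\<integral>\<^sup>+y. \<phi> (y powr \<alpha>) * ennreal (\<alpha> * y powr (\<alpha> - 1)) \<partial>lpos) = (\<integral>\<^sup>+z. \<phi> z \<partial>lpos)"
proof -
  define lo up where "lo m = 1 / (real m + 1)" and "up m = real m + 2" for m :: nat
  define \<psi> where "\<psi> y = \<phi> (y powr \<alpha>) * ennreal (\<alpha> * y powr (\<alpha> - 1))" for y
  have [measurable]: "\<psi> \<in> borel_measurable borel" unfolding \<psi>_def by measurable
  have lo_up1: "0 < lo m" "lo m \<le> 1" "1 < up m" for m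
    by (auto simp: lo_def up_def field_simps)
  then have lo_up: "0 < lo m" "lo m < up m" "lo m \<le> 1" "1 \<le> up m" for m
    by (auto intro: le_less_trans less_imp_le)
  have lo_mono: "lo (Suc m) \<le> lo m" and up_mono: "up m \<le> up (Suc m)" for m
    by (auto simp: lo_def up_def field_simps)
  have ex: "\<exists>m. lo m \<le> x \<and> x \<le> up m" if "0 < x" for x
  proof -
    obtain m :: nat where m: "max x (1 / x) \<le> real m" using real_arch_simple by blast
    have "1 / x \<le> real m + 1" using m by simp
    then have "lo m \<le> x" using that by (simp add: lo_def field_simps)
    then show ?thesis using m by (auto simp: up_def intro!: exI[of _ m])
  qed
  define A where "A m = {lo m powr \<alpha> .. up m powr \<alpha>}" for m
  define B where "B m = {lo m .. up m}" for m
  have incA: "incseq A"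
  proof (rule incseq_SucI)
    fix m
    have "lo (Suc m) powr \<alpha> \<le> lo m powr \<alpha>" "up m powr \<alpha> \<le> up (Suc m) powr \<alpha>"
      using lo_mono[of m] up_mono[of m] lo_up1[of "Suc m"] lo_up1[of m] \<alpha> by (auto intro!: powr_mono2)
    then show "A m \<subseteq> A (Suc m)" by (auto simp: A_def)
  qed
  have incB: "incseq B"
    unfolding B_def using lo_mono up_mono by (intro incseq_SucI) (auto intro: order_trans)
  have "0 < x" if "x \<in> B m" for x m
    using that lo_up(1)[of m] by (auto simp: B_def)
  moreover have "\<exists>m. x \<in> B m" if "0 < x" for x
    using ex[OF that] by (auto simp: B_def)
  ultimately have UB: "(\<Union>m. B m) = {0<..}"
    by blast
  have "0 < x" if "x \<in> A m" for x m
  proof -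
    have "0 < lo m powr \<alpha>" using lo_up(1)[of m] by simp
    also have "\<dots> \<le> x" using that by (simp add: A_def)
    finally show ?thesis .
  qed
  moreover have "\<exists>m. x \<in> A m" if x: "0 < x" for x
  proof -
    obtain m where m: "lo m \<le> x powr (1 / \<alpha>)" "x powr (1 / \<alpha>) \<le> up m"
      using ex[of "x powr (1 / \<alpha>)"] x by auto
    have "(x powr (1 / \<alpha>)) powr \<alpha> = x" using x \<alpha> by (simp add: powr_powr)
    then have "lo m powr \<alpha> \<le> x" "x \<le> up m powr \<alpha>"
      using powr_mono2[OF less_imp_le[OF \<alpha>] less_imp_le[OF lo_up(1)] m(1)]
        powr_mono2[OF less_imp_le[OF \<alpha>] _ m(2)] by auto
    then show ?thesis by (auto simp: A_def)
  qed
  ultimately have UA: "(\<Union>m. A m) = {0<..}"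
    by blast
  have "emeasure (density lborel \<psi>) (B m) = emeasure (density lborel \<phi>) (A m)" for m
  proof -
    have "emeasure (density lborel \<phi>) (A m) = (\<integral>\<^sup>+x. \<phi> x * indicator {lo m powr \<alpha>..up m powr \<alpha>} x \<partial>lborel)"
      by (simp add: emeasure_density A_def)
    also have "\<dots> = (\<integral>\<^sup>+x. \<phi> (x powr \<alpha>) * ennreal (\<alpha> * x powr (\<alpha> - 1)) * indicator {lo m..up m} x \<partial>lborel)"
      using lo_up[of m] \<alpha>
      by (intro nn_integral_substitution_aux)
        (auto intro!: derivative_eq_intros continuous_intros)
    also have "\<dots> = emeasure (density lborel \<psi>) (B m)"
      by (simp add: emeasure_density B_def \<psi>_def)
    finally show ?thesis by simp
  qed
  then have "(SUP m. emeasure (density lborel \<psi>) (B m)) = (SUP m. emeasure (density lborel \<phi>) (A m))"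
    by simp
  then have "emeasure (density lborel \<psi>) {0<..} = emeasure (density lborel \<phi>) {0<..}"
  proof -
    have "range A \<subseteq> sets (density lborel \<phi>)" "range B \<subseteq> sets (density lborel \<psi>)"
      by (auto simp: A_def B_def)
    note SUP_emeasure_incseq[OF this(1) incA] SUP_emeasure_incseq[OF this(2) incB]
    then show ?thesis
      using \<open>(SUP m. emeasure (density lborel \<psi>) (B m)) = (SUP m. emeasure (density lborel \<phi>) (A m))\<close>
      unfolding UA UB by metis
  qed
  then show ?thesis
    by (simp add: emeasure_density nn_integral_lpos flip: \<psi>_def)
qed

lemma nn_integral_lpos_Gamma_powr:
  assumes \<alpha>: "0 < \<alpha>" and a: "0 < a" and c: "0 < c"
  shows "(\<integral>\<^sup>+y. ennreal (y powr (a * \<alpha> - 1) * exp (- c * y powr \<alpha>)) \<partial>lpos) = ennreal (Gamma a / (\<alpha> * c powr a))"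
proof -
  have "(\<integral>\<^sup>+y. ennreal (y powr (a * \<alpha> - 1) * exp (- c * y powr \<alpha>)) \<partial>lpos) =
      (\<integral>\<^sup>+y. ennreal (1 / \<alpha> * ((y powr \<alpha>) powr (a - 1) * exp (- c * y powr \<alpha>))) * ennreal (\<alpha> * y powr (\<alpha> - 1)) \<partial>lpos)"
  proof (rule nn_integral_lpos_cong)
    fix y :: real assume y: "0 < y"
    have "y powr (a * \<alpha> - 1) = (y powr \<alpha>) powr (a - 1) * y powr (\<alpha> - 1)"
      using y by (simp add: powr_powr powr_add[symmetric] algebra_simps)
    then show "ennreal (y powr (a * \<alpha> - 1) * exp (- c * y powr \<alpha>)) =
        ennreal (1 / \<alpha> * ((y powr \<alpha>) powr (a - 1) * exp (- c * y powr \<alpha>))) * ennreal (\<alpha> * y powr (\<alpha> - 1))"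
      using \<alpha> by (subst ennreal_mult[symmetric]) auto
  qed
  also have "\<dots> = (\<integral>\<^sup>+z. ennreal (1 / \<alpha> * (z powr (a - 1) * exp (- c * z))) \<partial>lpos)"
    using \<alpha> by (intro nn_integral_lpos_powr_subst) auto
  also have "\<dots> = ennreal (1 / \<alpha>) * (\<integral>\<^sup>+z. ennreal (z powr (a - 1) * exp (- c * z)) \<partial>lpos)"
    using \<alpha> by (subst nn_integral_cmult[symmetric]) (auto simp: ennreal_mult'[symmetric])
  also have "(\<integral>\<^sup>+z. ennreal (z powr (a - 1) * exp (- c * z)) \<partial>lpos) = ennreal (Gamma a / c powr a)"
    by (rule nn_integral_lpos_Gamma[OF a c])
  also have "ennreal (1 / \<alpha>) * ennreal (Gamma a / c powr a) = ennreal (Gamma a / (\<alpha> * c powr a))"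
    using \<alpha> a by (subst ennreal_mult[symmetric]) auto
  finally show ?thesis .
qed

text \<open>The beta integral moved from \<open>(0, 1)\<close> to \<open>(v, 1)\<close> by an affine map. It is the inner integral when
  two fractional integrals are composed.\<close>
lemma nn_integral_lpos_Beta_tail:
  assumes a: "0 < a" and b: "0 < b" and v: "0 \<le> v"
  shows "(\<integral>\<^sup>+u. ennreal ((u - v) powr (a - 1) * (1 - u) powr (b - 1)) * indicator {v<..<1} u \<partial>lpos) =
    ennreal (Beta a b * (1 - v) powr (a + b - 1)) * indicator {..<1} v"
proof (cases "v < 1")
  case True
  have "(\<integral>\<^sup>+u. ennreal ((u - v) powr (a - 1) * (1 - u) powr (b - 1)) * indicator {v<..<1} u \<partial>lpos) =
     (\<integral>\<^sup>+u. (ennreal ((u - v) powr (a - 1) * (1 - u) powr (b - 1)) * indicator {..<1} u) * indicator {v<..} u \<partial>lpos)"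
    by (auto intro!: nn_integral_cong split: split_indicator)
  also have "\<dots> = (\<integral>\<^sup>+r. ennreal (((v + r) - v) powr (a - 1) * (1 - (v + r)) powr (b - 1)) * indicator {..<1} (v + r) \<partial>lpos)"
    using v by (intro nn_integral_lpos_shift) auto
  also have "\<dots> = ennreal (1 - v) * (\<integral>\<^sup>+w. ennreal (((v + (1 - v) * w) - v) powr (a - 1) * (1 - (v + (1 - v) * w)) powr (b - 1)) * indicator {..<1} (v + (1 - v) * w) \<partial>lpos)"
    using True by (intro nn_integral_lpos_scale) auto
  also have "(\<integral>\<^sup>+w. ennreal (((v + (1 - v) * w) - v) powr (a - 1) * (1 - (v + (1 - v) * w)) powr (b - 1)) * indicator {..<1} (v + (1 - v) * w) \<partial>lpos) =
      (\<integral>\<^sup>+w. ennreal ((1 - v) powr (a + b - 2)) * (ennreal (w powr (a - 1) * (1 - w) powr (b - 1)) * indicator {..<1} w) \<partial>lpos)"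
  proof (rule nn_integral_lpos_cong)
    fix w :: real assume w: "0 < w"
    have "v + (1 - v) * w < 1 \<longleftrightarrow> (1 - v) * w < (1 - v) * 1" by auto
    also have "\<dots> \<longleftrightarrow> w < 1" using True by (subst mult_less_cancel_left_pos) auto
    finally have iff: "v + (1 - v) * w < 1 \<longleftrightarrow> w < 1" .
    show "ennreal (((v + (1 - v) * w) - v) powr (a - 1) * (1 - (v + (1 - v) * w)) powr (b - 1)) * indicator {..<1} (v + (1 - v) * w) =
      ennreal ((1 - v) powr (a + b - 2)) * (ennreal (w powr (a - 1) * (1 - w) powr (b - 1)) * indicator {..<1} w)"
    proof (cases "w < 1")
      case w1: True
      have "1 - (v + (1 - v) * w) = (1 - v) * (1 - w)" by (simp add: algebra_simps)
      then have "((v + (1 - v) * w) - v) powr (a - 1) * (1 - (v + (1 - v) * w)) powr (b - 1) =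
          (1 - v) powr (a + b - 2) * (w powr (a - 1) * (1 - w) powr (b - 1))"
        using True w w1 by (simp add: powr_mult powr_add[symmetric] mult_ac)
      then show ?thesis using iff w1 by (simp add: ennreal_mult'[symmetric])
    qed (use iff in auto)
  qed
  also have "\<dots> = ennreal ((1 - v) powr (a + b - 2)) * ennreal (Beta a b)"
    using a b by (subst nn_integral_cmult) (auto simp: nn_integral_lpos_Beta)
  also have "ennreal (1 - v) * (ennreal ((1 - v) powr (a + b - 2)) * ennreal (Beta a b)) =
      ennreal ((1 - v) * (1 - v) powr (a + b - 2) * Beta a b)"
    using True by (simp add: ennreal_mult' mult.assoc)
  also have "(1 - v) * (1 - v) powr (a + b - 2) * Beta a b = Beta a b * (1 - v) powr (a + b - 1)"
    using True by (simp add: powr_mult_base)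
  finally show ?thesis using True by simp
next
  case False
  then show ?thesis by (auto simp: indicator_def)
qed

text \<open>The Laplace transform at \<open>z\<close> of a gamma(\<open>a + b\<close>) variable \<open>w\<close> times an independent
  beta(\<open>a, b\<close>) variable \<open>u\<close>: the product \<open>x = w u\<close> is gamma(\<open>a\<close>). The proof writes the power of
  \<open>1 + z u\<close> as an integral over \<open>w\<close> and substitutes \<open>x\<close> for \<open>u\<close>.\<close>
lemma nn_integral_Beta_Stieltjes:
  assumes a: "0 < a" and b: "0 < b" and z: "0 \<le> z"
  shows "(\<integral>\<^sup>+u. ennreal (u powr (a - 1) * (1 - u) powr (b - 1) * (1 + z * u) powr (- (a + b))) * indicator {..<1} u \<partial>lpos) =
    ennreal (Beta a b * (1 + z) powr (- a))"
proof -
  let ?C = "\<lambda>w u. (ennreal ((w * u) powr (a - 1) * exp (- z * (w * u)) * ((w - w * u) powr (b - 1) * exp (- w))) * indicator {w * u<..} w)"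
  let ?B = "\<lambda>x w. ennreal (x powr (a - 1) * exp (- z * x) * ((w - x) powr (b - 1) * exp (- w))) * indicator {x<..} w"
  let ?A = "\<lambda>u w. ennreal (u powr (a - 1) * (1 - u) powr (b - 1) * (w powr (a + b - 1) * exp (- (1 + z * u) * w))) * indicator {..<1} u"
  have G: "Gamma (a + b) > 0" using a b by simp
  have "ennreal (Gamma (a + b)) * (\<integral>\<^sup>+u. ennreal (u powr (a - 1) * (1 - u) powr (b - 1) * (1 + z * u) powr (- (a + b))) * indicator {..<1} u \<partial>lpos)
     = (\<integral>\<^sup>+u. ennreal (u powr (a - 1) * (1 - u) powr (b - 1)) * indicator {..<1} u * ennreal (Gamma (a + b) / (1 + z * u) powr (a + b)) \<partial>lpos)"
    using G by (subst nn_integral_cmult[symmetric])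
      (auto intro!: nn_integral_cong simp: powr_minus_divide ennreal_mult'[symmetric] mult_ac
         simp del: minus_add_distrib split: split_indicator)
  also have "\<dots> = (\<integral>\<^sup>+u. ennreal (u powr (a - 1) * (1 - u) powr (b - 1)) * indicator {..<1} u * (\<integral>\<^sup>+w. ennreal (w powr (a + b - 1) * exp (- (1 + z * u) * w)) \<partial>lpos) \<partial>lpos)"
    using a b z by (intro nn_integral_lpos_cong, subst nn_integral_lpos_Gamma) (auto intro: add_pos_nonneg)
  also have "\<dots> = (\<integral>\<^sup>+u. \<integral>\<^sup>+w. ?A u w \<partial>lpos \<partial>lpos)"
    by (subst nn_integral_cmult[symmetric])
      (auto intro!: nn_integral_cong simp: ennreal_mult'[symmetric] split: split_indicator)
  also have "\<dots> = (\<integral>\<^sup>+w. \<integral>\<^sup>+u. ?A u w \<partial>lpos \<partial>lpos)"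
    by (rule lpos_pair.Fubini') measurable
  also have "\<dots> = (\<integral>\<^sup>+w. \<integral>\<^sup>+x. ?B x w \<partial>lpos \<partial>lpos)"
  proof (rule nn_integral_lpos_cong)
    fix w :: real assume w: "0 < w"
    have "(\<integral>\<^sup>+x. ?B x w \<partial>lpos)
      = ennreal w * (\<integral>\<^sup>+u. ennreal ((w * u) powr (a - 1) * exp (- z * (w * u)) * ((w - w * u) powr (b - 1) * exp (- w))) * indicator {w * u<..} w \<partial>lpos)"
      using w by (intro nn_integral_lpos_scale) (auto simp: indicator_def)
    also have "\<dots> = (\<integral>\<^sup>+u. ennreal w * ?C w u \<partial>lpos)"
      by (rule nn_integral_cmult[symmetric]) (auto simp: indicator_def)
    also have "\<dots> = (\<integral>\<^sup>+u. ?A u w \<partial>lpos)"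
    proof (rule nn_integral_lpos_cong)
      fix u :: real assume u: "0 < u"
      show "ennreal w * ?C w u =
        (?A u w)"
      proof (cases "u < 1")
        case True
        have 1: "(w - w * u) powr (b - 1) = w powr (b - 1) * (1 - u) powr (b - 1)"
          using w True by (subst powr_mult[symmetric]) (auto simp: algebra_simps)
        have 2: "w powr (a + b - 1) = w * (w powr (a - 1) * w powr (b - 1))"
          using w by (simp add: powr_add[symmetric] powr_mult_base add.commute)
        have 3: "exp (- (1 + z * u) * w) = exp (- z * (w * u)) * exp (- w)"
          by (simp add: exp_add[symmetric] algebra_simps)
        have "w * ((w * u) powr (a - 1) * exp (- z * (w * u)) * ((w - w * u) powr (b - 1) * exp (- w))) =
           u powr (a - 1) * (1 - u) powr (b - 1) * (w powr (a + b - 1) * exp (- (1 + z * u) * w))"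
          unfolding 1 2 3 using w u by (simp add: powr_mult mult_ac)
        then show ?thesis using w True u by (simp add: ennreal_mult'[symmetric])
      next
        case False
        then have "\<not> w * u < w" using w by simp
        then show ?thesis using False by simp
      qed
    qed
    finally show "(\<integral>\<^sup>+u. ?A u w \<partial>lpos) =
      (\<integral>\<^sup>+x. ?B x w \<partial>lpos)" by simp
  qed
  also have "\<dots> = (\<integral>\<^sup>+x. \<integral>\<^sup>+w. ?B x w \<partial>lpos \<partial>lpos)"
    by (rule lpos_pair.Fubini') (auto simp: indicator_def)
  also have "\<dots> = (\<integral>\<^sup>+x. ennreal (Gamma b) * ennreal (x powr (a - 1) * exp (- (1 + z) * x)) \<partial>lpos)"
  proof (rule nn_integral_lpos_cong)
    fix x :: real assume x: "0 < x"
    have "(\<integral>\<^sup>+w. ?B x w \<partial>lpos)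
      = (\<integral>\<^sup>+r. ennreal (x powr (a - 1) * exp (- z * x) * (((x + r) - x) powr (b - 1) * exp (- (x + r)))) \<partial>lpos)"
      using x by (intro nn_integral_lpos_shift) auto
    also have "\<dots> = (\<integral>\<^sup>+r. ennreal (x powr (a - 1) * exp (- (1 + z) * x)) * ennreal (r powr (b - 1) * exp (- 1 * r)) \<partial>lpos)"
    proof (rule nn_integral_cong)
      fix r
      have "exp (- z * x) * exp (- (x + r)) = exp (- (1 + z) * x) * exp (- 1 * r)"
        by (simp add: exp_add[symmetric] algebra_simps)
      then have "x powr (a - 1) * exp (- z * x) * (((x + r) - x) powr (b - 1) * exp (- (x + r))) =
          (x powr (a - 1) * exp (- (1 + z) * x)) * (r powr (b - 1) * exp (- 1 * r))"
        by (simp add: mult_ac)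
      then show "ennreal (x powr (a - 1) * exp (- z * x) * (((x + r) - x) powr (b - 1) * exp (- (x + r)))) =
          ennreal (x powr (a - 1) * exp (- (1 + z) * x)) * ennreal (r powr (b - 1) * exp (- 1 * r))"
        by (subst ennreal_mult[symmetric]) auto
    qed
    also have "\<dots> = ennreal (x powr (a - 1) * exp (- (1 + z) * x)) * ennreal (Gamma b / 1 powr b)"
      using b by (subst nn_integral_cmult) (auto simp: nn_integral_lpos_Gamma[OF b, of 1, simplified])
    finally show "(\<integral>\<^sup>+w. ?B x w \<partial>lpos) =
      ennreal (Gamma b) * ennreal (x powr (a - 1) * exp (- (1 + z) * x))" by (simp add: mult.commute)
  qed
  also have "\<dots> = ennreal (Gamma b) * ennreal (Gamma a / (1 + z) powr a)"
    using a z by (subst nn_integral_cmult, simp, subst nn_integral_lpos_Gamma) auto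
  also have "\<dots> = ennreal (Gamma (a + b)) * ennreal (Beta a b * (1 + z) powr (- a))"
  proof -
    have "Gamma b * (Gamma a / (1 + z) powr a) = Gamma (a + b) * (Beta a b * (1 + z) powr (- a))"
      using G by (simp add: Beta_def powr_minus_divide)
    then show ?thesis
      using b G by (simp only: ennreal_mult'[symmetric] Gamma_real_pos less_imp_le)
  qed
  finally show ?thesis
    using G by (subst (asm) ennreal_mult_cancel_left) auto
qed

lemma nn_integral_lpos_exp:
  assumes "0 < c"
  shows "(\<integral>\<^sup>+r. ennreal (exp (- c * r)) \<partial>lpos) = ennreal (1 / c)"
proof -
  have "(\<integral>\<^sup>+r. ennreal (exp (- c * r)) \<partial>lpos) = (\<integral>\<^sup>+r. ennreal (r powr (1 - 1) * exp (- c * r)) \<partial>lpos)"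
    by (rule nn_integral_lpos_cong) simp
  also have "\<dots> = ennreal (1 / c)"
    using assms by (subst nn_integral_lpos_Gamma) auto
  finally show ?thesis .
qed

lemma nn_integral_lpos_exp_tail:
  assumes c: "0 < c" and v: "0 \<le> v"
  shows "(\<integral>\<^sup>+s. X * (ennreal (exp (- c * (s - v))) * indicator {v<..} s) \<partial>lpos) = X * ennreal (1 / c)"
proof -
  have "(\<integral>\<^sup>+s. ennreal (exp (- c * (s - v))) * indicator {v<..} s \<partial>lpos) =
    (\<integral>\<^sup>+r. ennreal (exp (- c * ((v + r) - v))) \<partial>lpos)"
    by (rule nn_integral_lpos_shift[OF _ v]) simp
  also have "\<dots> = ennreal (1 / c)"
    using nn_integral_lpos_exp[OF c] by simp
  finally show ?thesis by (subst nn_integral_cmult) auto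
qed

section \<open>Uniqueness of Laplace and Stieltjes transforms\<close>

text \<open>Polynomials are uniformly dense in the continuous functions on \<open>[0, 1]\<close>, so the integrals of all
  continuous functions agree; piecewise linear functions then approximate the indicators of
  half-lines.\<close>
lemma moments_determine_measure:
  fixes M N :: "real measure"
  assumes "finite_measure M" "finite_measure N"
    and sets [simp, measurable_cong]: "sets M = sets borel" "sets N = sets borel"
    and M01: "AE x in M. x \<in> {0..1}" and N01: "AE x in N. x \<in> {0..1}"
    and mom: "\<And>i::nat. (\<integral>x. x ^ i \<partial>M) = (\<integral>x. x ^ i \<partial>N)"
  shows "M = N"
proof -
  interpret M: finite_measure M by fact
  interpret N: finite_measure N by fact
  have intM: "integrable M h" and intN: "integrable N h" if "continuous_on UNIV h" for h :: "real \<Rightarrow> real"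
  proof -
    have [measurable]: "h \<in> borel_measurable borel"
      using that by (rule borel_measurable_continuous_onI)
    have "bounded (h ` {0..1})"
      by (intro compact_imp_bounded compact_continuous_image continuous_on_subset[OF that]) auto
    then obtain b where b: "\<forall>y\<in>h ` {0..1}. norm y \<le> b"
      unfolding bounded_iff by blast
    show "integrable M h"
      by (rule M.integrable_const_bound[where B = b]) (use M01 b in \<open>auto elim: eventually_mono\<close>)
    show "integrable N h"
      by (rule N.integrable_const_bound[where B = b]) (use N01 b in \<open>auto elim: eventually_mono\<close>)
  qed
  have cont_eq: "(\<integral>x. h x \<partial>M) = (\<integral>x. h x \<partial>N)" if h: "continuous_on UNIV h" for h :: "real \<Rightarrow> real"
  proof -
    define C where "C = measure M UNIV + measure N UNIV"
    have C0: "0 \<le> C" by (simp add: C_def)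
    have bound: "\<bar>(\<integral>x. h x \<partial>M) - (\<integral>x. h x \<partial>N)\<bar> \<le> e * C" if e: "0 < e" for e
    proof -
      obtain p where p: "real_polynomial_function p" "\<And>x. x \<in> {0..1} \<Longrightarrow> \<bar>h x - p x\<bar> < e"
        using Stone_Weierstrass_real_polynomial_function[OF compact_Icc continuous_on_subset[OF h] e, of 0 1] by auto
      obtain a n where pa: "p = (\<lambda>x. \<Sum>i\<le>n. a i * x ^ i)"
        using p(1) real_polynomial_function_iff_sum by auto
      have pc: "continuous_on UNIV p" unfolding pa by (intro continuous_intros)
      have pe: "(\<integral>x. p x \<partial>M) = (\<integral>x. p x \<partial>N)"
        unfolding pa
        by (subst (1 2) Bochner_Integration.integral_sum)
          (auto intro!: intM intN continuous_intros simp: mom)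
      have approx: "\<bar>(\<integral>x. h x \<partial>K) - (\<integral>x. p x \<partial>K)\<bar> \<le> e * measure K UNIV"
        if K: "finite_measure K" "sets K = sets borel" "AE x in K. x \<in> {0..1}"
          and int: "integrable K h" "integrable K p" for K :: "real measure"
      proof -
        interpret K: finite_measure K by fact
        have "\<bar>(\<integral>x. h x \<partial>K) - (\<integral>x. p x \<partial>K)\<bar> = \<bar>\<integral>x. h x - p x \<partial>K\<bar>"
          using int by simp
        also have "\<dots> \<le> (\<integral>x. \<bar>h x - p x\<bar> \<partial>K)" by (rule integral_abs_bound)
        also have "\<dots> \<le> (\<integral>x. e \<partial>K)"
        proof (rule integral_mono_AE)
          show "integrable K (\<lambda>x. \<bar>h x - p x\<bar>)" using int by auto
          show "AE x in K. \<bar>h x - p x\<bar> \<le> e"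
            using K(3) by eventually_elim (use p(2) less_imp_le in blast)
        qed simp
        finally show ?thesis by (simp add: mult.commute sets_eq_imp_space_eq[OF K(2)])
      qed
      note 1 = approx[OF assms(1) sets(1) M01 intM[OF h] intM[OF pc]]
        and 2 = approx[OF assms(2) sets(2) N01 intN[OF h] intN[OF pc]]
      show ?thesis using 1 2 pe unfolding C_def distrib_left by linarith
    qed
    have le: "\<bar>(\<integral>x. h x \<partial>M) - (\<integral>x. h x \<partial>N)\<bar> \<le> 0 + d" if d: "0 < d" for d
    proof -
      have "d / (C + 1) * C \<le> d" using C0 d by (simp add: field_simps)
      then show ?thesis using bound[of "d / (C + 1)"] C0 d by auto
    qed
    have "\<bar>(\<integral>x. h x \<partial>M) - (\<integral>x. h x \<partial>N)\<bar> \<le> 0"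
      by (rule field_le_epsilon, rule le)
    then show ?thesis by simp
  qed
  have step: "measure M {a<..} = measure N {a<..}" for a
  proof -
    \<comment> \<open>continuous functions that increase to the indicator of the open half-line above a\<close>
    define h where "h m x = max 0 (min 1 (real m * (x - a)))" for m and x :: real
    have hc: "continuous_on UNIV (h m)" for m unfolding h_def by (intro continuous_intros)
    then have [measurable]: "h m \<in> borel_measurable borel" for m
      by (rule borel_measurable_continuous_onI)
    have lim: "(\<lambda>m. h m x) \<longlonglongrightarrow> indicator {a<..} x" for x
    proof (cases "a < x")
      case True
      have "\<forall>\<^sub>F m in sequentially. h m x = 1"
        using eventually_ge_at_top[of "nat \<lceil>1 / (x - a)\<rceil>"]
      proof eventually_elim
        case (elim m)
        then have "1 / (x - a) \<le> real m" by linarith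
        then have "1 \<le> real m * (x - a)" using True by (simp add: field_simps)
        then show ?case by (simp add: h_def)
      qed
      then show ?thesis using True by (simp add: tendsto_eventually)
    next
      case False
      then have "real m * (x - a) \<le> 0" for m by (simp add: mult_le_0_iff)
      then have "h m x = 0" for m by (smt (verit) h_def)
      then show ?thesis using False by simp
    qed
    have "(\<lambda>m. \<integral>x. h m x \<partial>M) \<longlonglongrightarrow> (\<integral>x. indicator {a<..} x \<partial>M)"
      by (rule integral_dominated_convergence[where w = "\<lambda>_. 1"]) (use lim in \<open>auto simp: h_def\<close>)
    moreover have "(\<lambda>m. \<integral>x. h m x \<partial>N) \<longlonglongrightarrow> (\<integral>x. indicator {a<..} x \<partial>N)"
      by (rule integral_dominated_convergence[where w = "\<lambda>_. 1"]) (use lim in \<open>auto simp: h_def\<close>)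
    ultimately have "(\<integral>x. indicator {a<..} x \<partial>M) = ((\<integral>x. indicator {a<..} x \<partial>N) :: real)"
      using cont_eq[OF hc] by (metis (no_types, lifting) LIMSEQ_unique ext)
    then show ?thesis by (simp add: sets_eq_imp_space_eq[OF sets(1)] sets_eq_imp_space_eq[OF sets(2)])
  qed
  show ?thesis
    by (rule measure_eqI_lessThan)
      (auto simp: step M.emeasure_eq_measure N.emeasure_eq_measure)
qed

text \<open>After tilting by \<open>exp (- c x)\<close>, which makes the measures finite, the values of the Laplace
  transform at the multiples of \<open>c\<close> are the moments of the image under \<open>x \<mapsto> exp (- c x)\<close>. A
  discrete set of arguments is allowed so that the lemma can be applied to transforms that are
  known to agree only almost everywhere.\<close>
lemma laplace_determines_measure:
  fixes M N :: "real measure" and c :: real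
  assumes sets [simp, measurable_cong]: "sets M = sets borel" "sets N = sets borel"
    and M0: "AE x in M. 0 \<le> x" and N0: "AE x in N. 0 \<le> x" and c: "0 < c"
    and eq: "\<And>j::nat. 1 \<le> j \<Longrightarrow>
      (\<integral>\<^sup>+x. ennreal (exp (- (real j * c * x))) \<partial>M) = (\<integral>\<^sup>+x. ennreal (exp (- (real j * c * x))) \<partial>N)"
    and fin: "(\<integral>\<^sup>+x. ennreal (exp (- (c * x))) \<partial>M) < \<infinity>"
  shows "M = N"
proof -
  define P where "P K = distr (density K (\<lambda>x. ennreal (exp (- (c * x))))) borel (\<lambda>x. exp (- (c * x)))"
    for K :: "real measure"
  have sets_P [simp, measurable_cong]: "sets (P K) = sets borel" for K by (simp add: P_def)
  have nn_P: "(\<integral>\<^sup>+y. \<phi> y \<partial>P K) = (\<integral>\<^sup>+x. ennreal (exp (- (c * x))) * \<phi> (exp (- (c * x))) \<partial>K)"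
    if [measurable_cong]: "sets K = sets borel" and [measurable]: "\<phi> \<in> borel_measurable borel" for \<phi> K
    unfolding P_def by (simp add: nn_integral_distr nn_integral_density)
  have fin_P: "finite_measure (P K)"
    if K: "sets K = sets borel" and "(\<integral>\<^sup>+x. ennreal (exp (- (c * x))) \<partial>K) < \<infinity>" for K
  proof
    have "emeasure (P K) (space (P K)) = (\<integral>\<^sup>+y. 1 \<partial>P K)" by simp
    also have "\<dots> = (\<integral>\<^sup>+x. ennreal (exp (- (c * x))) \<partial>K)"
      using K by (subst nn_P) auto
    finally show "emeasure (P K) (space (P K)) \<noteq> \<infinity>" using that by simp
  qed
  have AE_P: "AE y in P K. y \<in> {0..1}"
    if [measurable_cong]: "sets K = sets borel" and K0: "AE x in K. 0 \<le> x" for K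
    unfolding P_def using c K0
    by (subst AE_distr_iff; (subst AE_density)?) (auto elim!: eventually_mono)
  have mom_P: "(\<integral>y. y ^ i \<partial>P K) = enn2real (\<integral>\<^sup>+x. ennreal (exp (- (real (Suc i) * c * x))) \<partial>K)"
    if K: "sets K = sets borel" and K0: "AE x in K. 0 \<le> x" for K i
  proof -
    have "(\<integral>y. y ^ i \<partial>P K) = enn2real (\<integral>\<^sup>+y. ennreal (y ^ i) \<partial>P K)"
      using AE_P[OF K K0] by (intro integral_eq_nn_integral) (auto elim!: eventually_mono)
    also have "(\<integral>\<^sup>+y. ennreal (y ^ i) \<partial>P K) = (\<integral>\<^sup>+x. ennreal (exp (- (real (Suc i) * c * x))) \<partial>K)"
      using K by (subst nn_P)
        (auto intro!: nn_integral_cong simp: ennreal_mult'[symmetric] exp_of_nat_mult[symmetric]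
           exp_add[symmetric] algebra_simps)
    finally show ?thesis .
  qed
  have eq1: "(\<integral>\<^sup>+x. ennreal (exp (- (c * x))) \<partial>M) = (\<integral>\<^sup>+x. ennreal (exp (- (c * x))) \<partial>N)"
    using eq[of 1] by simp
  have P_eq: "P M = P N"
  proof (rule moments_determine_measure)
    show "finite_measure (P M)" "finite_measure (P N)"
      using fin eq1 by (auto intro!: fin_P)
    show "AE y in P M. y \<in> {0..1}" "AE y in P N. y \<in> {0..1}"
      using AE_P[OF sets(1) M0] AE_P[OF sets(2) N0] by auto
    show "(\<integral>y. y ^ i \<partial>P M) = (\<integral>y. y ^ i \<partial>P N)" for i
      using M0 N0 eq[of "Suc i"] by (simp only: mom_P sets)
  qed auto
  \<comment> \<open>the map \<open>y \<mapsto> - ln y / c\<close> and the density \<open>1 / y\<close> undo the push-forward and the tilting\<close>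
  have inv: "emeasure K A = (\<integral>\<^sup>+y. ennreal (1 / y) * indicator A (- ln y / c) \<partial>P K)"
    if K: "sets K = sets borel" and [measurable]: "A \<in> sets borel" for K A
  proof -
    have "(\<integral>\<^sup>+y. ennreal (1 / y) * indicator A (- ln y / c) \<partial>P K) =
        (\<integral>\<^sup>+x. ennreal (exp (- (c * x))) * (ennreal (1 / exp (- (c * x))) * indicator A x) \<partial>K)"
      using K c by (subst nn_P) auto
    also have "\<dots> = (\<integral>\<^sup>+x. indicator A x \<partial>K)"
      by (intro nn_integral_cong) (simp add: mult.assoc[symmetric] ennreal_mult'[symmetric] del: exp_minus)
    finally show ?thesis using K by simp
  qed
  show ?thesis
    by (rule measure_eqI) (auto simp: inv P_eq)
qed

lemma AE_lpos_happens:
  assumes "AE x in lpos. P x"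
  shows "\<exists>x>0. P x"
proof (rule ccontr)
  assume "\<not> (\<exists>x>0. P x)"
  then have "AE x in lpos. False"
    using assms AE_lpos_pos by (auto elim: eventually_elim2)
  then have "emeasure lpos UNIV = 0"
    using ae_filter_eq_bot_iff[of lpos] by (simp add: trivial_limit_def)
  moreover have "emeasure lpos UNIV = emeasure lborel {0::real<..}"
    unfolding lpos_def by (subst emeasure_density) (auto simp: ennreal_indicator)
  moreover have "emeasure lborel {0::real<..<1} \<le> emeasure lborel {0::real<..}"
    by (intro emeasure_mono) auto
  ultimately show False by simp
qed

text \<open>Writing \<open>(m + x)\<^bsup>-p\<^esup>\<close> as a gamma integral over \<open>y\<close> shows that, with \<open>m = 1/l\<close> and up to a constant,
  the Stieltjes transform of \<open>M\<close> is the Laplace transform of the density \<open>y\<^bsup>p-1\<^esup> \<phi> M y\<close>, where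
  \<open>\<phi> M\<close> is the Laplace transform of \<open>M\<close>. Uniqueness for Laplace transforms is therefore used twice,
  first for the densities and then for the measures.\<close>
lemma stieltjes_determines_measure:
  fixes M N :: "real measure" and p :: real
  assumes sf: "sigma_finite_measure M" "sigma_finite_measure N"
    and sets [simp, measurable_cong]: "sets M = sets borel" "sets N = sets borel"
    and M0: "AE x in M. 0 \<le> x" and N0: "AE x in N. 0 \<le> x" and p: "0 < p"
    and eq: "\<And>l. 0 < l \<Longrightarrow>
      (\<integral>\<^sup>+x. ennreal ((1 + l * x) powr (- p)) \<partial>M) = (\<integral>\<^sup>+x. ennreal ((1 + l * x) powr (- p)) \<partial>N)"
    and fin: "\<And>l. 0 < l \<Longrightarrow> (\<integral>\<^sup>+x. ennreal ((1 + l * x) powr (- p)) \<partial>M) < \<infinity>"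
  shows "M = N"
proof -
  define \<phi> where "\<phi> K y = (\<integral>\<^sup>+x. ennreal (exp (- (y * x))) \<partial>K)" for K :: "real measure" and y :: real
  have meas: "\<phi> K \<in> borel_measurable borel" if [measurable_cong]: "sets K = sets borel"
    and "sigma_finite_measure K" for K
  proof -
    interpret sigma_finite_measure K by fact
    show ?thesis unfolding \<phi>_def by measurable
  qed
  note [measurable] = meas[OF sets(1) sf(1)] meas[OF sets(2) sf(2)]
  define D where "D K = density lpos (\<lambda>y. ennreal (y powr (p - 1)) * \<phi> K y)" for K
  have sets_D [simp, measurable_cong]: "sets (D K) = sets borel" for K by (simp add: D_def)
  have lap: "(\<integral>\<^sup>+y. ennreal (exp (- (m * y))) \<partial>D K) =
      ennreal (Gamma p / m powr p) * (\<integral>\<^sup>+x. ennreal ((1 + (1 / m) * x) powr (- p)) \<partial>K)"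
    if K [measurable_cong]: "sets K = sets borel" "sigma_finite_measure K" and K0: "AE x in K. 0 \<le> x"
      and m: "0 < m" for K m
  proof -
    interpret K: sigma_finite_measure K by fact
    interpret pair_sigma_finite K lpos ..
    note [measurable] = meas[OF K]
    have "(\<integral>\<^sup>+y. ennreal (exp (- (m * y))) \<partial>D K) =
        (\<integral>\<^sup>+y. \<integral>\<^sup>+x. ennreal (y powr (p - 1) * exp (- (m + x) * y)) \<partial>K \<partial>lpos)"
      unfolding D_def \<phi>_def
      by (subst nn_integral_density)
        (auto intro!: nn_integral_cong simp: nn_integral_cmult[symmetric] nn_integral_multc[symmetric]
           ennreal_mult'[symmetric] exp_add[symmetric] algebra_simps)
    also have "\<dots> = (\<integral>\<^sup>+x. \<integral>\<^sup>+y. ennreal (y powr (p - 1) * exp (- (m + x) * y)) \<partial>lpos \<partial>K)"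
      by (rule Fubini') measurable
    also have "\<dots> = (\<integral>\<^sup>+x. ennreal (Gamma p / m powr p) * ennreal ((1 + (1 / m) * x) powr (- p)) \<partial>K)"
    proof (rule nn_integral_cong_AE, use K0 in eventually_elim)
      fix x :: real assume x: "0 \<le> x"
      have "(\<integral>\<^sup>+y. ennreal (y powr (p - 1) * exp (- (m + x) * y)) \<partial>lpos) = ennreal (Gamma p / (m + x) powr p)"
        using x m by (intro nn_integral_lpos_Gamma p) auto
      also have "(m + x) powr p = m powr p * (1 + (1 / m) * x) powr p"
        using x m by (subst powr_mult[symmetric]) (auto simp: distrib_left)
      also have "ennreal (Gamma p / (m powr p * (1 + (1 / m) * x) powr p)) =
          ennreal (Gamma p / m powr p) * ennreal ((1 + (1 / m) * x) powr (- p))"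
        using p by (subst ennreal_mult[symmetric]) (auto simp: powr_minus field_simps)
      finally show "(\<integral>\<^sup>+y. ennreal (y powr (p - 1) * exp (- (m + x) * y)) \<partial>lpos) =
          ennreal (Gamma p / m powr p) * ennreal ((1 + (1 / m) * x) powr (- p))" .
    qed
    also have "\<dots> = ennreal (Gamma p / m powr p) * (\<integral>\<^sup>+x. ennreal ((1 + (1 / m) * x) powr (- p)) \<partial>K)"
      by (rule nn_integral_cmult) measurable
    finally show ?thesis .
  qed
  have lap_eq: "(\<integral>\<^sup>+y. ennreal (exp (- (m * y))) \<partial>D M) = (\<integral>\<^sup>+y. ennreal (exp (- (m * y))) \<partial>D N)"
    and lap_fin: "(\<integral>\<^sup>+y. ennreal (exp (- (m * y))) \<partial>D M) < \<infinity>" if "0 < m" for m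
    using that eq[of "1 / m"] fin[of "1 / m"] M0 N0 sf
    by (simp_all add: lap ennreal_mult_less_top)
  have D_pos: "AE y in D K. 0 \<le> y" if "sets K = sets borel" "sigma_finite_measure K" for K
    using meas[OF that] AE_lpos_pos unfolding D_def by (subst AE_density) (auto elim!: eventually_mono)
  have "D M = D N"
    by (rule laplace_determines_measure[where c = 1])
      (use lap_eq lap_fin[of 1] in \<open>auto intro!: D_pos sf\<close>)
  then have 1: "AE y in lpos. ennreal (y powr (p - 1)) * \<phi> M y = ennreal (y powr (p - 1)) * \<phi> N y"
    unfolding D_def by (intro lpos.density_unique) measurable
  have "(\<integral>\<^sup>+y. ennreal (y powr (p - 1)) * \<phi> M y * ennreal (exp (- (1 * y))) \<partial>lpos) \<noteq> \<infinity>"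
    using lap_fin[of 1, OF zero_less_one] unfolding D_def by (subst (asm) nn_integral_density) auto
  then have 2: "AE y in lpos. ennreal (y powr (p - 1)) * \<phi> M y * ennreal (exp (- (1 * y))) \<noteq> \<infinity>"
    by (intro nn_integral_noteq_infinite) measurable
  have good: "AE y in lpos. \<phi> M y = \<phi> N y \<and> \<phi> M y \<noteq> \<infinity>"
    using 1 2 AE_lpos_pos
    by eventually_elim (auto simp: ennreal_mult_cancel_left ennreal_mult_eq_top_iff)
  \<comment> \<open>almost every y is good together with all its multiples\<close>
  have "AE y in lpos. \<forall>j::nat. \<phi> M (real (Suc j) * y) = \<phi> N (real (Suc j) * y) \<and> \<phi> M (real (Suc j) * y) \<noteq> \<infinity>"
    unfolding AE_all_countable by (intro allI AE_lpos_scale[OF good]) auto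
  then obtain c where c: "0 < c"
    "\<And>j::nat. \<phi> M (real (Suc j) * c) = \<phi> N (real (Suc j) * c) \<and> \<phi> M (real (Suc j) * c) \<noteq> \<infinity>"
    using AE_lpos_happens by blast
  show ?thesis
  proof (rule laplace_determines_measure[OF sets M0 N0 c(1)])
    fix j :: nat assume "1 \<le> j"
    then obtain i where "j = Suc i" by (cases j) auto
    then show "(\<integral>\<^sup>+x. ennreal (exp (- (real j * c * x))) \<partial>M) = (\<integral>\<^sup>+x. ennreal (exp (- (real j * c * x))) \<partial>N)"
      using c(2)[of i] by (simp add: \<phi>_def)
  next
    show "(\<integral>\<^sup>+x. ennreal (exp (- (c * x))) \<partial>M) < \<infinity>"
      using c(2)[of 0] by (auto simp: \<phi>_def less_top)
  qed
qed

section \<open>Beta and Dirichlet laws\<close>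

lemma nn_integral_beta_law:
  assumes [measurable]: "\<phi> \<in> borel_measurable borel" and b: "b \<noteq> 0"
  shows "(\<integral>\<^sup>+u. \<phi> u \<partial>beta_law a b) =
    (\<integral>\<^sup>+u. ennreal (u powr (a - 1) * (1 - u) powr (b - 1) / Beta a b) * indicator {..<1} u * \<phi> u \<partial>lpos)"
proof -
  have "(\<integral>\<^sup>+u. \<phi> u \<partial>beta_law a b) = (\<integral>\<^sup>+x. ennreal (if 0 < x \<and> x < 1 then x powr (a - 1) * (1 - x) powr (b - 1) / Beta a b else 0) * \<phi> x \<partial>lborel)"
    using b by (simp add: beta_law_def nn_integral_density)
  also have "\<dots> = (\<integral>\<^sup>+u. ennreal (u powr (a - 1) * (1 - u) powr (b - 1) / Beta a b) * indicator {..<1} u * \<phi> u \<partial>lpos)"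
    by (subst nn_integral_lpos) (auto intro!: nn_integral_cong split: split_indicator)
  finally show ?thesis .
qed

lemma sets_beta_law [simp, measurable_cong]: "sets (beta_law a b) = sets borel"
  by (simp add: beta_law_def)

lemma AE_beta_law_nonneg: "AE u in beta_law a b. 0 \<le> u"
proof (cases "b = 0")
  case True
  have "AE u in return borel (1::real). 0 \<le> u"
    by (subst AE_return) auto
  then show ?thesis unfolding beta_law_def using True by simp
next
  case False
  then show ?thesis unfolding beta_law_def by (simp add: AE_density)
qed

text \<open>In terms of gamma variables: gamma(\<open>a + b\<close>) times beta(\<open>a, b\<close>) is gamma(\<open>a\<close>), including the
  degenerate case \<open>b = 0\<close>.\<close>
lemma beta_law_stieltjes:
  assumes a: "0 < a" and b: "0 \<le> b" and z: "0 \<le> z"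
  shows "(\<integral>\<^sup>+u. ennreal ((1 + z * u) powr (- (a + b))) \<partial>beta_law a b) = ennreal ((1 + z) powr (- a))"
proof (cases "b = 0")
  case True
  then show ?thesis by (simp add: beta_law_def nn_integral_return)
next
  case False
  with b have b: "0 < b" by simp
  have B: "0 < Beta a b" using a b by (simp add: Beta_def)
  have "(\<integral>\<^sup>+u. ennreal ((1 + z * u) powr (- (a + b))) \<partial>beta_law a b) =
    (\<integral>\<^sup>+u. ennreal (1 / Beta a b) * (ennreal (u powr (a - 1) * (1 - u) powr (b - 1) * (1 + z * u) powr (- (a + b))) * indicator {..<1} u) \<partial>lpos)"
    using B b by (subst nn_integral_beta_law)
      (auto intro!: nn_integral_cong simp: ennreal_mult'[symmetric] simp del: minus_add_distrib split: split_indicator)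
  also have "\<dots> = ennreal (1 / Beta a b) * ennreal (Beta a b * (1 + z) powr (- a))"
    using a b z by (subst nn_integral_cmult, simp, subst nn_integral_Beta_Stieltjes) auto
  also have "\<dots> = ennreal ((1 + z) powr (- a))"
    using B by (subst ennreal_mult'[symmetric]) auto
  finally show ?thesis .
qed

lemma nn_integral_PiM_scale:
  fixes \<phi> :: "('i \<Rightarrow> real) \<Rightarrow> ennreal"
  assumes "finite I" and c: "0 < c" and "\<phi> \<in> borel_measurable (PiM I (\<lambda>_. lborel))"
  shows "(\<integral>\<^sup>+x. \<phi> x \<partial>PiM I (\<lambda>_. lborel)) =
    ennreal (c ^ card I) * (\<integral>\<^sup>+x. \<phi> (\<lambda>i\<in>I. c * x i) \<partial>PiM I (\<lambda>_. lborel))"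
  using assms(1,3)
proof (induction I arbitrary: \<phi> rule: finite_induct)
  case empty
  show ?case by (simp add: PiM_empty nn_integral_count_space_finite restrict_def)
next
  case (insert i I)
  interpret product_sigma_finite "\<lambda>_::'i. lborel :: real measure" by standard
  note [measurable] = insert.prems
  have upd: "(\<lambda>(x, y). \<phi> (x(i := y))) \<in> borel_measurable (PiM I (\<lambda>_. lborel) \<Otimes>\<^sub>M lborel)"
    using measurable_compose[OF measurable_add_dim insert.prems] by (simp add: case_prod_beta')
  have upd_c: "(\<lambda>(x, y). \<phi> (x(i := c * y))) \<in> borel_measurable (PiM I (\<lambda>_. lborel) \<Otimes>\<^sub>M lborel)"
  proof -
    have "(\<lambda>p. (fst p, c * snd p)) \<in> PiM I (\<lambda>_. lborel) \<Otimes>\<^sub>M lborel \<rightarrow>\<^sub>M PiM I (\<lambda>_. lborel) \<Otimes>\<^sub>M lborel"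
      by measurable
    from measurable_compose[OF this upd] show ?thesis by (simp add: case_prod_beta')
  qed
  have "(\<integral>\<^sup>+x. \<phi> x \<partial>PiM (insert i I) (\<lambda>_. lborel)) =
      (\<integral>\<^sup>+x. \<integral>\<^sup>+y. \<phi> (x(i := y)) \<partial>lborel \<partial>PiM I (\<lambda>_. lborel))"
    using insert by (intro product_nn_integral_insert) auto
  also have "\<dots> = (\<integral>\<^sup>+x. ennreal c * (\<integral>\<^sup>+y. \<phi> (x(i := c * y)) \<partial>lborel) \<partial>PiM I (\<lambda>_. lborel))"
  proof (intro nn_integral_cong)
    fix x assume "x \<in> space (PiM I (\<lambda>_. lborel :: real measure))"
    from measurable_compose[OF measurable_Pair1'[OF this] upd]
    have "(\<lambda>y. \<phi> (x(i := y))) \<in> borel_measurable borel" by simp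
    then show "(\<integral>\<^sup>+y. \<phi> (x(i := y)) \<partial>lborel) = ennreal c * (\<integral>\<^sup>+y. \<phi> (x(i := c * y)) \<partial>lborel)"
      using nn_integral_real_affine[of "\<lambda>y. \<phi> (x(i := y))" c 0] c by simp
  qed
  also have "\<dots> = ennreal c * (\<integral>\<^sup>+x. \<integral>\<^sup>+y. \<phi> (x(i := c * y)) \<partial>lborel \<partial>PiM I (\<lambda>_. lborel))"
    using lborel.borel_measurable_nn_integral_fst[OF upd_c] by (intro nn_integral_cmult) (simp only: case_prod_conv)
  also have "(\<integral>\<^sup>+x. \<integral>\<^sup>+y. \<phi> (x(i := c * y)) \<partial>lborel \<partial>PiM I (\<lambda>_. lborel)) =
      ennreal (c ^ card I) * (\<integral>\<^sup>+x. \<integral>\<^sup>+y. \<phi> ((\<lambda>j\<in>I. c * x j)(i := c * y)) \<partial>lborel \<partial>PiM I (\<lambda>_. lborel))"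
    using lborel.borel_measurable_nn_integral_fst[OF upd_c] by (intro insert.IH) (simp only: case_prod_conv)
  also have "(\<integral>\<^sup>+x. \<integral>\<^sup>+y. \<phi> ((\<lambda>j\<in>I. c * x j)(i := c * y)) \<partial>lborel \<partial>PiM I (\<lambda>_. lborel)) =
      (\<integral>\<^sup>+x. \<integral>\<^sup>+y. \<phi> (\<lambda>j\<in>insert i I. c * (x(i := y)) j) \<partial>lborel \<partial>PiM I (\<lambda>_. lborel))"
    using insert.hyps by (intro nn_integral_cong arg_cong[of _ _ \<phi>]) (auto simp: fun_eq_iff)
  also have "\<dots> = (\<integral>\<^sup>+x. \<phi> (\<lambda>j\<in>insert i I. c * x j) \<partial>PiM (insert i I) (\<lambda>_. lborel))"
    using insert.hyps by (intro product_nn_integral_insert[symmetric]) auto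
  finally have eq: "(\<integral>\<^sup>+x. \<phi> x \<partial>PiM (insert i I) (\<lambda>_. lborel)) = ennreal c * (ennreal (c ^ card I) *
      (\<integral>\<^sup>+x. \<phi> (\<lambda>j\<in>insert i I. c * x j) \<partial>PiM (insert i I) (\<lambda>_. lborel)))" .
  have "ennreal (c ^ card (insert i I)) = ennreal c * ennreal (c ^ card I)"
    using insert.hyps c by (simp add: ennreal_mult)
  then show ?case unfolding eq by (simp only: mult.assoc)
qed

lemma measurable_dirichlet_map:
  fixes k :: nat
  shows "(\<lambda>x. \<lambda>i\<in>{1..k}. if i = k then 1 - (\<Sum>j\<in>{1..<k}. x j) else x i)
    \<in> PiM {1..<k} (\<lambda>_. lborel :: real measure) \<rightarrow>\<^sub>M PiM {1..k} (\<lambda>_. borel :: real measure)"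
proof (rule measurable_restrict)
  fix i assume i: "i \<in> {1..k}"
  have comp [measurable]: "(\<lambda>x. x i) \<in> borel_measurable (PiM {1..<k} (\<lambda>_. lborel :: real measure))" if "i \<in> {1..<k}" for i
    using measurable_component_singleton[OF that, of "\<lambda>_. lborel"] by simp
  show "(\<lambda>x. if i = k then 1 - (\<Sum>j\<in>{1..<k}. x j) else x i)
      \<in> PiM {1..<k} (\<lambda>_. lborel :: real measure) \<rightarrow>\<^sub>M (borel :: real measure)"
  proof (cases "i = k")
    case True
    have "(\<lambda>x. 1 - (\<Sum>j\<in>{1..<k}. x j)) \<in> borel_measurable (PiM {1..<k} (\<lambda>_. lborel :: real measure))" by measurable
    then show ?thesis using True by simp
  next
    case False
    then have "i \<in> {1..<k}" using i by auto
    from comp[OF this] show ?thesis using False by simp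
  qed
qed

lemma AE_dirichlet_law_nonneg:
  assumes k: "1 \<le> k"
  shows "AE d in dirichlet_law k a. \<forall>j\<in>{1..k}. 0 \<le> d j"
proof -
  let ?P = "PiM {1..<k} (\<lambda>_. lborel :: real measure)"
  have comp [measurable]: "(\<lambda>x. x i) \<in> borel_measurable ?P" if "i \<in> {1..<k}" for i
    using measurable_component_singleton[OF that, of "\<lambda>_. lborel"] by simp
  have dens: "(\<lambda>x. ennreal
         (if (\<forall>i\<in>{1..<k}. 0 < x i) \<and> (\<Sum>i\<in>{1..<k}. x i) < 1
          then Gamma (\<Sum>i\<in>{1..k}. a i) / (\<Prod>i\<in>{1..k}. Gamma (a i)) *
               (\<Prod>i\<in>{1..<k}. x i powr (a i - 1)) * (1 - (\<Sum>i\<in>{1..<k}. x i)) powr (a k - 1)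
          else 0)) \<in> borel_measurable ?P"
    by measurable
  have set: "{d \<in> space (PiM {1..k} (\<lambda>_. borel)). \<forall>j\<in>{1..k}. (0::real) \<le> d j} \<in> sets (PiM {1..k} (\<lambda>_. borel))"
    by measurable
  show ?thesis
    unfolding dirichlet_law_def
    by (subst AE_distr_iff; (subst AE_density[OF dens])?) (use measurable_dirichlet_map[of k] set in \<open>auto simp: less_imp_le\<close>)
qed

text \<open>A gamma(\<open>k\<close>) variable \<open>s\<close> times a uniform Dirichlet vector \<open>x\<close> is a vector \<open>w\<close> of independent
  exponential variables. Since the coordinates of \<open>x\<close> sum to one, \<open>1 + \<Sum>z\<^sub>j x\<^sub>j\<close> is \<open>Q = \<Sum>(1 + z\<^sub>j) x\<^sub>j\<close>;
  its power \<open>-k\<close> is a gamma integral over \<open>s\<close>. The substitution \<open>w = s x\<close> maps simplex times half-line to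
  the positive orthant, where the integrand is a product.\<close>
lemma dirichlet_stieltjes:
  fixes z :: "nat \<Rightarrow> real"
  assumes k: "1 \<le> k" and z: "\<And>j. j \<in> {1..k} \<Longrightarrow> 0 \<le> z j"
  shows "(\<integral>\<^sup>+d. ennreal ((1 + (\<Sum>j=1..k. z j * d j)) powr (- real k)) \<partial>dirichlet_law k (\<lambda>_. 1)) =
    (\<Prod>j=1..k. ennreal (1 / (1 + z j)))"
proof -
  define I where "I = {1..<k}"
  define P where "P = PiM I (\<lambda>_. lborel :: real measure)"
  have I: "finite I" "k \<notin> I" "{1..k} = insert k I" "card I = k - 1"
    using k by (auto simp: I_def)
  interpret product_sigma_finite "\<lambda>_::nat. lborel :: real measure" by standard
  interpret P: sigma_finite_measure P unfolding P_def by (rule sigma_finite) (rule I)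
  interpret pair_sigma_finite P lpos ..
  have comp [measurable]: "(\<lambda>x. x i) \<in> borel_measurable P" if "i \<in> I" for i
    unfolding P_def using measurable_component_singleton[OF that, of "\<lambda>_. lborel"] by simp
  have comp1 [measurable]: "(\<lambda>p. fst p i) \<in> borel_measurable (P \<Otimes>\<^sub>M lpos)" if "i \<in> I" for i
    by (rule measurable_compose[OF measurable_fst comp[OF that]])
  have comp2 [measurable]: "(\<lambda>p. snd p i) \<in> borel_measurable (lpos \<Otimes>\<^sub>M P)" if "i \<in> I" for i
    by (rule measurable_compose[OF measurable_snd comp[OF that]])
  define y where "y j = 1 + z j" for j
  have y: "0 < y j" if "j \<in> {1..k}" for j using z[OF that] by (simp add: y_def)
  have yI: "0 < y j" if "j \<in> I" for j
    by (rule y) (use that in \<open>auto simp: I_def\<close>)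
  have yk: "0 < y k" using k by (intro y) auto
  define pos where "pos x = (\<Prod>i\<in>I. indicator {0<..} (x i) :: real)" for x :: "nat \<Rightarrow> real"
  have pos_if: "pos x = (if \<forall>i\<in>I. 0 < x i then 1 else 0)" for x
    using I(1) by (auto simp: pos_def indicator_def)
  define s1 where "s1 x = (\<Sum>i\<in>I. x i)" for x :: "nat \<Rightarrow> real"
  define sy where "sy x = (\<Sum>i\<in>I. y i * x i)" for x :: "nat \<Rightarrow> real"
  have [measurable]: "s1 \<in> borel_measurable P" "sy \<in> borel_measurable P" "pos \<in> borel_measurable P"
    unfolding s1_def sy_def pos_def by measurable
  define Q where "Q x = sy x + y k * (1 - s1 x)" for x
  let ?S = "\<lambda>x. (\<Sum>j=1..k. z j * (\<lambda>i\<in>{1..k}. if i = k then 1 - (\<Sum>j\<in>{1..<k}. x j) else x i) j)"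
  let ?B = "\<lambda>w s. ennreal (pos w * exp (- sy w)) * (ennreal (exp (- y k * (s - s1 w))) * indicator {s1 w<..} s)"
  let ?A = "\<lambda>x s. ennreal (pos x * indicator {s1 x<..} (1::real) * (s powr (real k - 1) * exp (- Q x * s)))"
  have [measurable]: "Q \<in> borel_measurable P" unfolding Q_def by measurable
  have Q: "0 < Q x" if "\<forall>i\<in>I. 0 < x i" "s1 x < 1" for x
    unfolding Q_def sy_def using that yk yI
    by (intro add_nonneg_pos sum_nonneg mult_nonneg_nonneg) (auto intro: less_imp_le)
  have meas_int: "(\<lambda>d. ennreal ((1 + (\<Sum>j=1..k. z j * d j)) powr (- real k))) \<in> borel_measurable (PiM {1..k} (\<lambda>_. borel :: real measure))"
    by measurable
  have dens: "(if (\<forall>i\<in>{1..<k}. 0 < x i) \<and> (\<Sum>i\<in>{1..<k}. x i) < 1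
      then Gamma (\<Sum>i\<in>{1..k}. 1) / (\<Prod>i\<in>{1..k}. Gamma 1) * (\<Prod>i\<in>{1..<k}. x i powr (1 - 1)) * (1 - (\<Sum>i\<in>{1..<k}. x i)) powr (1 - 1)
      else 0) = Gamma (real k) * (pos x * indicator {s1 x<..} (1::real))" for x :: "nat \<Rightarrow> real"
    by (auto simp: pos_if s1_def I_def Gamma_1 intro!: prod.neutral)
  have meas_dens: "(\<lambda>x. ennreal (Gamma (real k) * (pos x * indicator {s1 x<..} (1::real)))) \<in> borel_measurable P"
    by (simp add: indicator_def)
  have "(\<integral>\<^sup>+d. ennreal ((1 + (\<Sum>j=1..k. z j * d j)) powr (- real k)) \<partial>dirichlet_law k (\<lambda>_. 1)) =
     (\<integral>\<^sup>+x. ennreal (Gamma (real k) * (pos x * indicator {s1 x<..} (1::real))) *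
        ennreal ((1 + (?S x)) powr (- real k)) \<partial>P)"
  proof -
    define T where "T x = (\<lambda>i\<in>{1..k}. if i = k then 1 - (\<Sum>j\<in>{1..<k}. x j) else x i)" for x :: "nat \<Rightarrow> real"
    define g where "g d = ennreal ((1 + (\<Sum>j=1..k. z j * d j)) powr (- real k))" for d
    have law: "dirichlet_law k (\<lambda>_. 1) =
        distr (density P (\<lambda>x. ennreal (Gamma (real k) * (pos x * indicator {s1 x<..} (1::real))))) (PiM {1..k} (\<lambda>_. borel)) T"
      unfolding dirichlet_law_def dens P_def I_def T_def[abs_def] by (rule refl)
    have T: "T \<in> P \<rightarrow>\<^sub>M PiM {1..k} (\<lambda>_. borel)"
      using measurable_dirichlet_map[of k] unfolding T_def[abs_def] P_def I_def .
    have g: "g \<in> borel_measurable (PiM {1..k} (\<lambda>_. borel))"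
      using meas_int unfolding g_def[abs_def] .
    have "(\<integral>\<^sup>+d. g d \<partial>dirichlet_law k (\<lambda>_. 1)) =
      (\<integral>\<^sup>+x. ennreal (Gamma (real k) * (pos x * indicator {s1 x<..} (1::real))) * g (T x) \<partial>P)"
      unfolding law using T g meas_dens measurable_compose[OF T g]
      by (subst nn_integral_distr) (auto intro!: nn_integral_density)
    then show ?thesis unfolding T_def g_def .
  qed
  also have "\<dots> = (\<integral>\<^sup>+x. \<integral>\<^sup>+s. ?A x s \<partial>lpos \<partial>P)"
  proof (rule nn_integral_cong)
    fix x
    have "1 + (?S x) =
       1 + (\<Sum>j\<in>I. z j * x j) + z k * (1 - s1 x)"
      unfolding I(3) using I(1,2) k by (subst sum.insert) (auto simp: I_def s1_def intro!: sum.cong)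
    also have "\<dots> = Q x"
      by (simp add: Q_def sy_def y_def s1_def distrib_right sum.distrib)
    finally have eq: "1 + (?S x) = Q x" .
    show "ennreal (Gamma (real k) * (pos x * indicator {s1 x<..} (1::real))) *
        ennreal ((1 + (?S x)) powr (- real k)) =
      (\<integral>\<^sup>+s. ?A x s \<partial>lpos)"
    proof (cases "(\<forall>i\<in>I. 0 < x i) \<and> s1 x < 1")
      case True
      then have "(\<integral>\<^sup>+s. ennreal (s powr (real k - 1) * exp (- Q x * s)) \<partial>lpos) = ennreal (Gamma (real k) / Q x powr real k)"
        using k by (intro nn_integral_lpos_Gamma Q) auto
      then show ?thesis using True k unfolding eq
        by (simp add: pos_if powr_minus_divide ennreal_mult[symmetric] Gamma_real_nonneg)
    qed (auto simp: pos_if)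
  qed
  also have "\<dots> = (\<integral>\<^sup>+s. \<integral>\<^sup>+x. ?A x s \<partial>P \<partial>lpos)"
    by (rule Fubini'[symmetric]) (simp add: indicator_def)
  also have "\<dots> = (\<integral>\<^sup>+s. \<integral>\<^sup>+w. ?B w s \<partial>P \<partial>lpos)"
  proof (rule nn_integral_lpos_cong)
    fix s :: real assume s: "0 < s"
    have "(\<integral>\<^sup>+w. ?B w s \<partial>P) =
      ennreal (s ^ card I) * (\<integral>\<^sup>+x. ennreal (pos (\<lambda>i\<in>I. s * x i) * exp (- sy (\<lambda>i\<in>I. s * x i))) *
         (ennreal (exp (- y k * (s - s1 (\<lambda>i\<in>I. s * x i)))) * indicator {s1 (\<lambda>i\<in>I. s * x i)<..} s) \<partial>P)"
      unfolding P_def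
      by (rule nn_integral_PiM_scale[OF I(1) s]) (simp add: indicator_def flip: P_def)
    also have "(\<lambda>x. ennreal (pos (\<lambda>i\<in>I. s * x i) * exp (- sy (\<lambda>i\<in>I. s * x i))) *
         (ennreal (exp (- y k * (s - s1 (\<lambda>i\<in>I. s * x i)))) * indicator {s1 (\<lambda>i\<in>I. s * x i)<..} s)) =
      (\<lambda>x. ennreal (pos x * indicator {s1 x<..} (1::real) * exp (- Q x * s)))"
    proof
      fix x
      have 1: "pos (\<lambda>i\<in>I. s * x i) = pos x"
        using s by (simp add: pos_if zero_less_mult_iff)
      have 2: "s1 (\<lambda>i\<in>I. s * x i) = s * s1 x"
        by (simp add: s1_def sum_distrib_left)
      have 3: "sy (\<lambda>i\<in>I. s * x i) = s * sy x"
        by (simp add: sy_def sum_distrib_left mult_ac)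
      have 4: "s * s1 x < s \<longleftrightarrow> s1 x < 1" using s by simp
      have 5: "exp (- (s * sy x)) * exp (- y k * (s - s * s1 x)) = exp (- Q x * s)"
        by (simp add: Q_def exp_add[symmetric] algebra_simps)
      show "ennreal (pos (\<lambda>i\<in>I. s * x i) * exp (- sy (\<lambda>i\<in>I. s * x i))) *
         (ennreal (exp (- y k * (s - s1 (\<lambda>i\<in>I. s * x i)))) * indicator {s1 (\<lambda>i\<in>I. s * x i)<..} s) =
        ennreal (pos x * indicator {s1 x<..} (1::real) * exp (- Q x * s))"
        unfolding 1 2 3 using 4 5 by (auto simp: pos_if indicator_def ennreal_mult[symmetric])
    qed
    also have "ennreal (s ^ card I) * (\<integral>\<^sup>+x. ennreal (pos x * indicator {s1 x<..} (1::real) * exp (- Q x * s)) \<partial>P) =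
      (\<integral>\<^sup>+x. ennreal (s ^ card I) * ennreal (pos x * indicator {s1 x<..} (1::real) * exp (- Q x * s)) \<partial>P)"
      by (rule nn_integral_cmult[symmetric]) (simp add: indicator_def)
    also have "\<dots> = (\<integral>\<^sup>+x. ?A x s \<partial>P)"
    proof (rule nn_integral_cong)
      fix x
      have "s powr (real k - 1) = s ^ card I"
        using s k I(4) powr_realpow[OF s, of "k - 1"] by simp
      then show "ennreal (s ^ card I) * ennreal (pos x * indicator {s1 x<..} (1::real) * exp (- Q x * s)) =
        (?A x s)"
        using s by (simp add: ennreal_mult'[symmetric] mult_ac)
    qed
    finally show "(\<integral>\<^sup>+x. ?A x s \<partial>P) =
      (\<integral>\<^sup>+w. ?B w s \<partial>P)" by simp
  qed
  also have "\<dots> = (\<integral>\<^sup>+w. \<integral>\<^sup>+s. ?B w s \<partial>lpos \<partial>P)"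
    by (rule Fubini') (simp add: indicator_def)
  also have "\<dots> = (\<integral>\<^sup>+w. (\<Prod>i\<in>I. ennreal (indicator {0<..} (w i) * exp (- y i * w i))) * ennreal (1 / y k) \<partial>P)"
  proof (rule nn_integral_cong)
    fix w
    have prod: "(\<Prod>i\<in>I. ennreal (indicator {0<..} (w i) * exp (- y i * w i))) = ennreal (pos w * exp (- sy w))"
      using I(1) by (simp add: prod_ennreal pos_def sy_def prod.distrib exp_sum sum_negf[symmetric])
    show "(\<integral>\<^sup>+s. ?B w s \<partial>lpos) =
      (\<Prod>i\<in>I. ennreal (indicator {0<..} (w i) * exp (- y i * w i))) * ennreal (1 / y k)"
    proof (cases "\<forall>i\<in>I. 0 < w i")
      case True
      then have s1: "0 \<le> s1 w" unfolding s1_def by (intro sum_nonneg) (simp add: less_imp_le)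
      show ?thesis unfolding prod by (rule nn_integral_lpos_exp_tail[OF yk s1])
    next
      case False
      then have "pos w = 0" by (simp add: pos_if)
      then show ?thesis unfolding prod by simp
    qed
  qed
  also have "\<dots> = (\<Prod>i\<in>I. \<integral>\<^sup>+w. ennreal (indicator {0<..} w * exp (- y i * w)) \<partial>lborel) * ennreal (1 / y k)"
    unfolding P_def using I(1)
    by (subst nn_integral_multc, simp add: flip: P_def, subst product_nn_integral_prod) auto
  also have "(\<Prod>i\<in>I. \<integral>\<^sup>+w. ennreal (indicator {0<..} w * exp (- y i * w)) \<partial>lborel) = (\<Prod>i\<in>I. ennreal (1 / y i))"
  proof (rule prod.cong[OF refl])
    fix i assume "i \<in> I"
    then have yi: "0 < y i" by (intro y) (auto simp: I_def)
    have "(\<integral>\<^sup>+w. ennreal (indicator {0<..} w * exp (- y i * w)) \<partial>lborel) = (\<integral>\<^sup>+w. ennreal (exp (- y i * w)) \<partial>lpos)"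
      by (subst nn_integral_lpos) (auto intro!: nn_integral_cong split: split_indicator)
    also have "\<dots> = ennreal (1 / y i)"
      by (rule nn_integral_lpos_exp[OF yi])
    finally show "(\<integral>\<^sup>+w. ennreal (indicator {0<..} w * exp (- y i * w)) \<partial>lborel) = ennreal (1 / y i)" .
  qed
  also have "(\<Prod>i\<in>I. ennreal (1 / y i)) * ennreal (1 / y k) = (\<Prod>j=1..k. ennreal (1 / (1 + z j)))"
    unfolding I(3) using I(1,2) by (simp add: y_def mult.commute)
  finally show ?thesis .
qed

section \<open>The stable density\<close>

lemma ennreal_mult3:
  "0 \<le> a \<Longrightarrow> 0 \<le> b \<Longrightarrow> ennreal (a * b * c) * X = ennreal a * (ennreal b * (ennreal c * X))"
  by (simp add: ennreal_mult' mult.assoc)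

text \<open>A density is determined only up to null sets, so that the identities for \<open>f\<close> below hold almost
  everywhere.\<close>
locale stable_density =
  fixes \<alpha> :: real and f :: "real \<Rightarrow> real"
  assumes \<alpha>_pos: "0 < \<alpha>" and \<alpha>_less: "\<alpha> < 1"
    and f_meas [measurable]: "f \<in> borel_measurable borel"
    and f_nonneg [simp]: "0 \<le> f t"
    and laplace: "0 \<le> l \<Longrightarrow> (\<integral>\<^sup>+s. ennreal (f s * exp (- (l * s))) \<partial>lpos) = ennreal (exp (- (l powr \<alpha>)))"
begin

text \<open>Differentiation of the Laplace transform under the integral sign. The difference quotients are
  dominated by \<open>f s / l\<close>, because \<open>s exp (- l s) \<le> 1 / l\<close>.\<close>
lemma laplace_deriv:
  assumes l: "0 < l"
  shows "(\<integral>\<^sup>+s. ennreal (s * f s * exp (- (l * s))) \<partial>lpos) = ennreal (\<alpha> * l powr (\<alpha> - 1) * exp (- (l powr \<alpha>)))"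
proof -
  define F where "F l = exp (- (l powr \<alpha>))" for l
  have has: "has_bochner_integral lpos (\<lambda>s. f s * exp (- (l * s))) (F l)" if "0 \<le> l" for l
    using laplace[OF that] by (intro has_bochner_integral_nn_integral) (auto simp: F_def)
  define h where "h m = 1 / (real m + 1)" for m :: nat
  have h: "0 < h m" for m by (simp add: h_def)
  have h_lim: "filterlim h (at 0) sequentially"
    unfolding h_def using h
    by (intro filterlim_atI) (auto intro!: always_eventually real_tendsto_divide_at_top filterlim_tendsto_add_at_top
        filterlim_real_sequentially tendsto_const simp: h_def add.commute intro: filterlim_at_top_mono)
  have quot: "(\<lambda>m. (G (a + h m) - G a) / h m) \<longlonglongrightarrow> D" if "(G has_real_derivative D) (at a)" for G a D
    using that unfolding DERIV_def by (rule filterlim_compose[OF _ h_lim])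
  define q where "q m s = (f s * exp (- (l * s)) - f s * exp (- ((l + h m) * s))) / h m" for m s
  have q_meas [measurable]: "q m \<in> borel_measurable borel" for m unfolding q_def by measurable
  have q_eq: "q m s = f s * exp (- (l * s)) * ((1 - exp (- (h m * s))) / h m)" for m s
    by (simp add: q_def right_diff_distrib diff_divide_distrib exp_add[symmetric] algebra_simps)
  have q_int: "(\<integral>s. q m s \<partial>lpos) = - ((F (l + h m) - F l) / h m)" for m
    using has[of l] has[of "l + h m"] l h[of m] unfolding q_def
    by (auto simp: has_bochner_integral_iff field_simps)
  have F': "(F has_real_derivative - (\<alpha> * l powr (\<alpha> - 1) * exp (- (l powr \<alpha>)))) (at l)"
    unfolding F_def using l by (auto intro!: derivative_eq_intros)
  have q_int_lim: "(\<lambda>m. \<integral>s. q m s \<partial>lpos) \<longlonglongrightarrow> \<alpha> * l powr (\<alpha> - 1) * exp (- (l powr \<alpha>))"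
    using tendsto_minus[OF quot[OF F']] by (simp add: q_int)
  have q_lim: "(\<lambda>m. q m s) \<longlonglongrightarrow> s * f s * exp (- (l * s))" for s
  proof -
    have "((\<lambda>x. - exp (- (x * s))) has_real_derivative s) (at 0)"
      by (auto intro!: derivative_eq_intros)
    from quot[OF this] have "(\<lambda>m. (1 - exp (- (h m * s))) / h m) \<longlonglongrightarrow> s" by simp
    from tendsto_mult_left[OF this, of "f s * exp (- (l * s))"] show ?thesis
      by (simp add: q_eq mult_ac)
  qed
  have q_bound: "\<bar>q m s\<bar> \<le> f s / l" if s: "0 < s" for m s
  proof -
    have 1: "0 \<le> (1 - exp (- (h m * s))) / h m" using s h[of m] by simp
    have "1 - exp (- (h m * s)) \<le> h m * s" using exp_ge_add_one_self[of "- (h m * s)"] by linarith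
    then have 2: "(1 - exp (- (h m * s))) / h m \<le> s" using h[of m] by (simp add: field_simps)
    have "l * s \<le> exp (l * s)" using exp_ge_add_one_self[of "l * s"] by linarith
    then have "exp (- (l * s)) * s \<le> 1 / l" using l by (simp add: exp_minus field_simps)
    then have 3: "exp (- (l * s)) * ((1 - exp (- (h m * s))) / h m) \<le> 1 / l"
      using mult_left_mono[OF 2, of "exp (- (l * s))"] by simp
    have "\<bar>q m s\<bar> = f s * (exp (- (l * s)) * ((1 - exp (- (h m * s))) / h m))"
    proof -
      have "0 \<le> q m s"
        unfolding q_eq using 1 by (intro mult_nonneg_nonneg) auto
      then have "\<bar>q m s\<bar> = q m s" by simp
      then show ?thesis by (simp only: q_eq mult.assoc)
    qed
    also have "\<dots> \<le> f s * (1 / l)" by (intro mult_left_mono 3) auto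
    finally show ?thesis by simp
  qed
  have w: "integrable lpos (\<lambda>s. f s / l)"
    using has[of 0] by (simp add: has_bochner_integral_iff)
  have dom: "AE s in lpos. norm (q m s) \<le> f s / l" for m
    using AE_lpos_pos by eventually_elim (use q_bound in auto)
  have "integrable lpos (\<lambda>s. s * f s * exp (- (l * s)))"
    by (rule integrable_dominated_convergence[OF _ _ w, of _ q]) (use q_lim dom in auto)
  moreover have "(\<lambda>m. \<integral>s. q m s \<partial>lpos) \<longlonglongrightarrow> (\<integral>s. s * f s * exp (- (l * s)) \<partial>lpos)"
    by (rule integral_dominated_convergence[OF _ _ w]) (use q_lim dom in auto)
  then have "(\<integral>s. s * f s * exp (- (l * s)) \<partial>lpos) = \<alpha> * l powr (\<alpha> - 1) * exp (- (l powr \<alpha>))"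
    using q_int_lim LIMSEQ_unique by blast
  moreover have "AE s in lpos. 0 \<le> s * f s * exp (- (l * s))"
    using AE_lpos_pos by eventually_elim simp
  ultimately show ?thesis by (simp add: nn_integral_eq_integral)
qed

text \<open>Up to a constant, the convolution of \<open>f\<close> with the tail of the stable Levy measure.\<close>
definition levy_conv where
  "levy_conv t = (\<integral>\<^sup>+s. ennreal (f s * (t - s) powr (- \<alpha>)) * indicator {s<..} t \<partial>lpos)"

lemma levy_conv_measurable [measurable]: "levy_conv \<in> borel_measurable borel"
  unfolding levy_conv_def by (auto simp: indicator_def)

lemma laplace_levy_conv:
  assumes l: "0 < l"
  shows "(\<integral>\<^sup>+t. levy_conv t * ennreal (exp (- (l * t))) \<partial>lpos) = ennreal (Gamma (1 - \<alpha>) * l powr (\<alpha> - 1) * exp (- (l powr \<alpha>)))"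
proof -
  have "(\<integral>\<^sup>+t. levy_conv t * ennreal (exp (- (l * t))) \<partial>lpos) =
     (\<integral>\<^sup>+t. \<integral>\<^sup>+s. ennreal (f s * (t - s) powr (- \<alpha>) * exp (- (l * t))) * indicator {s<..} t \<partial>lpos \<partial>lpos)"
    unfolding levy_conv_def
    by (subst nn_integral_multc[symmetric])
      (auto intro!: nn_integral_cong simp: ennreal_mult''[symmetric] indicator_def)
  also have "\<dots> = (\<integral>\<^sup>+s. \<integral>\<^sup>+t. ennreal (f s * (t - s) powr (- \<alpha>) * exp (- (l * t))) * indicator {s<..} t \<partial>lpos \<partial>lpos)"
    by (rule lpos_pair.Fubini') (auto simp: indicator_def)
  also have "\<dots> = (\<integral>\<^sup>+s. ennreal (Gamma (1 - \<alpha>) / l powr (1 - \<alpha>)) * ennreal (f s * exp (- (l * s))) \<partial>lpos)"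
  proof (rule nn_integral_lpos_cong)
    fix s :: real assume s: "0 < s"
    have "(\<integral>\<^sup>+t. ennreal (f s * (t - s) powr (- \<alpha>) * exp (- (l * t))) * indicator {s<..} t \<partial>lpos)
      = (\<integral>\<^sup>+r. ennreal (f s * ((s + r) - s) powr (- \<alpha>) * exp (- (l * (s + r)))) \<partial>lpos)"
      using s by (intro nn_integral_lpos_shift) auto
    also have "\<dots> = (\<integral>\<^sup>+r. ennreal (f s * exp (- (l * s))) * ennreal (r powr ((1 - \<alpha>) - 1) * exp (- l * r)) \<partial>lpos)"
    proof (rule nn_integral_cong)
      fix r
      have "exp (- (l * (s + r))) = exp (- (l * s)) * exp (- l * r)"
        by (simp add: exp_add[symmetric] algebra_simps)
      then show "ennreal (f s * ((s + r) - s) powr (- \<alpha>) * exp (- (l * (s + r)))) =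
          ennreal (f s * exp (- (l * s))) * ennreal (r powr ((1 - \<alpha>) - 1) * exp (- l * r))"
        by (subst ennreal_mult[symmetric]) (auto simp: mult_ac)
    qed
    also have "\<dots> = ennreal (f s * exp (- (l * s))) * ennreal (Gamma (1 - \<alpha>) / l powr (1 - \<alpha>))"
      using l \<alpha>_less by (subst nn_integral_cmult, simp, subst nn_integral_lpos_Gamma) auto
    finally show "(\<integral>\<^sup>+t. ennreal (f s * (t - s) powr (- \<alpha>) * exp (- (l * t))) * indicator {s<..} t \<partial>lpos) =
       ennreal (Gamma (1 - \<alpha>) / l powr (1 - \<alpha>)) * ennreal (f s * exp (- (l * s)))" by (simp add: mult.commute)
  qed
  also have "\<dots> = ennreal (Gamma (1 - \<alpha>) / l powr (1 - \<alpha>)) * ennreal (exp (- (l powr \<alpha>)))"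
    using l by (subst nn_integral_cmult) (auto simp: laplace)
  also have "\<dots> = ennreal (Gamma (1 - \<alpha>) / l powr (1 - \<alpha>) * exp (- (l powr \<alpha>)))"
    by (rule ennreal_mult''[symmetric]) simp
  also have "Gamma (1 - \<alpha>) / l powr (1 - \<alpha>) = Gamma (1 - \<alpha>) * l powr (\<alpha> - 1)"
    using powr_minus_divide[of l "1 - \<alpha>"] by simp
  finally show ?thesis .
qed

lemma Gamma_1\<alpha>: "0 < Gamma (1 - \<alpha>)"
  using \<alpha>_less by simp

text \<open>Both sides have the Laplace transform \<open>\<alpha> l\<^bsup>\<alpha>-1\<^esup> exp (- l\<^bsup>\<alpha>\<^esup>)\<close>: on the left as minus the derivative
  of that of \<open>f\<close>, on the right as the product of the transforms of \<open>f\<close> and of a power function.\<close>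
lemma renewal:
  "AE t in lpos. ennreal (t * f t) = ennreal (\<alpha> / Gamma (1 - \<alpha>)) * levy_conv t"
proof -
  define M where "M = density lpos (\<lambda>t. ennreal (t * f t))"
  define N where "N = density lpos (\<lambda>t. ennreal (\<alpha> / Gamma (1 - \<alpha>)) * levy_conv t)"
  have M: "(\<integral>\<^sup>+t. ennreal (exp (- (l * t))) \<partial>M) = ennreal (\<alpha> * l powr (\<alpha> - 1) * exp (- (l powr \<alpha>)))"
    if "0 < l" for l
    unfolding M_def using laplace_deriv[OF that]
    by (subst nn_integral_density) (auto simp: ennreal_mult''[symmetric] mult_ac)
  have N: "(\<integral>\<^sup>+t. ennreal (exp (- (l * t))) \<partial>N) = ennreal (\<alpha> * l powr (\<alpha> - 1) * exp (- (l powr \<alpha>)))"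
    if l: "0 < l" for l
  proof -
    have "(\<integral>\<^sup>+t. ennreal (exp (- (l * t))) \<partial>N) = (\<integral>\<^sup>+t. ennreal (\<alpha> / Gamma (1 - \<alpha>)) * (levy_conv t * ennreal (exp (- (l * t)))) \<partial>lpos)"
      unfolding N_def by (subst nn_integral_density) (auto simp: mult_ac)
    also have "\<dots> = ennreal (\<alpha> / Gamma (1 - \<alpha>)) * ennreal (Gamma (1 - \<alpha>) * l powr (\<alpha> - 1) * exp (- (l powr \<alpha>)))"
      by (subst nn_integral_cmult) (auto simp: laplace_levy_conv l)
    also have "\<dots> = ennreal (\<alpha> * l powr (\<alpha> - 1) * exp (- (l powr \<alpha>)))"
      using Gamma_1\<alpha> \<alpha>_pos by (subst ennreal_mult[symmetric]) auto
    finally show ?thesis .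
  qed
  have "M = N"
  proof (rule laplace_determines_measure[where c = 1])
    show "AE x in M. 0 \<le> x" "AE x in N. 0 \<le> x"
      unfolding M_def N_def using AE_lpos_pos
      by (subst AE_density; auto elim!: eventually_mono)+
  qed (auto simp: M N M[of 1, simplified] M_def[THEN arg_cong[where f = sets]] N_def[THEN arg_cong[where f = sets]])
  then show ?thesis
    unfolding M_def N_def by (intro lpos.density_unique) measurable
qed

text \<open>The fractional integral of \<open>f\<close> of order \<open>p\<close> at \<open>t\<close>, without its factor \<open>t\<^bsup>p\<^esup> / \<Gamma>(p)\<close>.\<close>
definition frac_avg where
  "frac_avg p t = (\<integral>\<^sup>+u. ennreal (f (t * u) * (1 - u) powr (p - 1)) * indicator {..<1} u \<partial>lpos)"

lemma frac_avg_measurable [measurable]: "frac_avg p \<in> borel_measurable borel"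
  unfolding frac_avg_def by measurable

lemma frac_avg_antimono:
  assumes "p \<le> q"
  shows "frac_avg q t \<le> frac_avg p t"
  unfolding frac_avg_def
proof (rule nn_integral_mono_AE, use AE_lpos_pos in eventually_elim)
  fix u :: real assume "0 < u"
  then show "ennreal (f (t * u) * (1 - u) powr (q - 1)) * indicator {..<1} u \<le>
      ennreal (f (t * u) * (1 - u) powr (p - 1)) * indicator {..<1} u"
    using assms by (auto intro!: ennreal_leI mult_left_mono powr_mono' split: split_indicator)
qed

lemma levy_conv_scale:
  assumes t: "0 < t" "0 < u"
  shows "levy_conv (t * u) = ennreal (t powr (1 - \<alpha>)) * (\<integral>\<^sup>+v. ennreal (f (t * v) * (u - v) powr (- \<alpha>)) * indicator {v<..} u \<partial>lpos)"
proof -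
  have "levy_conv (t * u) = ennreal t * (\<integral>\<^sup>+v. ennreal (f (t * v) * (t * u - t * v) powr (- \<alpha>)) * indicator {t * v<..} (t * u) \<partial>lpos)"
    unfolding levy_conv_def using t by (intro nn_integral_lpos_scale) (auto simp: indicator_def)
  also have "(\<integral>\<^sup>+v. ennreal (f (t * v) * (t * u - t * v) powr (- \<alpha>)) * indicator {t * v<..} (t * u) \<partial>lpos) =
     (\<integral>\<^sup>+v. ennreal (t powr (- \<alpha>)) * (ennreal (f (t * v) * (u - v) powr (- \<alpha>)) * indicator {v<..} u) \<partial>lpos)"
  proof (rule nn_integral_cong)
    fix v
    have "t * u - t * v = t * (u - v)" by (simp add: algebra_simps)
    then have "(t * u - t * v) powr (- \<alpha>) = t powr (- \<alpha>) * (u - v) powr (- \<alpha>)" if "v < u"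
      using t that by (simp add: powr_mult)
    then show "ennreal (f (t * v) * (t * u - t * v) powr (- \<alpha>)) * indicator {t * v<..} (t * u) =
      ennreal (t powr (- \<alpha>)) * (ennreal (f (t * v) * (u - v) powr (- \<alpha>)) * indicator {v<..} u)"
      using t by (auto simp: ennreal_mult'[symmetric] mult_ac split: split_indicator)
  qed
  also have "\<dots> = ennreal (t powr (- \<alpha>)) * (\<integral>\<^sup>+v. ennreal (f (t * v) * (u - v) powr (- \<alpha>)) * indicator {v<..} u \<partial>lpos)"
    by (rule nn_integral_cmult) (auto simp: indicator_def)
  also have "ennreal t * (ennreal (t powr (- \<alpha>)) * X) = ennreal (t powr (1 - \<alpha>)) * X" for X
    using t by (simp add: mult.assoc[symmetric] ennreal_mult'[symmetric] powr_mult_base)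
  finally show ?thesis .
qed

text \<open>The case \<open>n = k = 1\<close> of the model: \<open>G\<^bsub>1,1\<^esub> = 1\<close>.\<close>
lemma renewal_frac_avg:
  "AE t in lpos. ennreal (f t) = ennreal (\<alpha> / Gamma (1 - \<alpha>) * t powr (- \<alpha>)) * frac_avg (1 - \<alpha>) t"
  using renewal AE_lpos_pos
proof eventually_elim
  fix t assume eq: "ennreal (t * f t) = ennreal (\<alpha> / Gamma (1 - \<alpha>)) * levy_conv t" and t: "0 < t"
  have "levy_conv t = ennreal (t powr (1 - \<alpha>)) * frac_avg (1 - \<alpha>) t"
    using levy_conv_scale[OF t zero_less_one] by (simp add: frac_avg_def indicator_def)
  then have *: "ennreal (t * f t) = ennreal (\<alpha> / Gamma (1 - \<alpha>)) * (ennreal (t powr (1 - \<alpha>)) * frac_avg (1 - \<alpha>) t)"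
    using eq by simp
  have "ennreal (f t) = ennreal (1 / t) * ennreal (t * f t)"
    using t by (subst ennreal_mult[symmetric]) auto
  also have "\<dots> = ennreal (1 / t * (\<alpha> / Gamma (1 - \<alpha>)) * t powr (1 - \<alpha>)) * frac_avg (1 - \<alpha>) t"
    unfolding * using t \<alpha>_pos Gamma_1\<alpha> by (subst ennreal_mult3) auto
  also have "1 / t * (\<alpha> / Gamma (1 - \<alpha>)) * t powr (1 - \<alpha>) = \<alpha> / Gamma (1 - \<alpha>) * t powr (- \<alpha>)"
    using t by (simp add: powr_diff powr_minus_divide)
  finally show "ennreal (f t) = ennreal (\<alpha> / Gamma (1 - \<alpha>) * t powr (- \<alpha>)) * frac_avg (1 - \<alpha>) t" .
qed

text \<open>A law on \<open>[t, \<infinity>)\<close> has a Laplace transform of at most \<open>exp (- l t)\<close>, whereas \<open>exp (- l\<^bsup>\<alpha>\<^esup>)\<close> decays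
  more slowly.\<close>
lemma not_AE_zero:
  assumes t: "0 < t"
  shows "\<not> (AE s in lpos. s < t \<longrightarrow> f s = 0)"
proof
  assume AE0: "AE s in lpos. s < t \<longrightarrow> f s = 0"
  have le: "exp (- (l powr \<alpha>)) \<le> exp (- (l * t))" if l: "0 < l" for l
  proof -
    have "ennreal (exp (- (l powr \<alpha>))) = (\<integral>\<^sup>+s. ennreal (f s * exp (- (l * s))) \<partial>lpos)"
      using l by (simp add: laplace)
    also have "\<dots> \<le> (\<integral>\<^sup>+s. ennreal (exp (- (l * t))) * ennreal (f s * exp (- (0 * s))) \<partial>lpos)"
    proof (rule nn_integral_mono_AE, use AE0 in eventually_elim)
      fix s assume s: "s < t \<longrightarrow> f s = 0"
      have "f s * exp (- (l * s)) \<le> exp (- (l * t)) * f s"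
        using s l by (cases "s < t") (auto simp: mult.commute intro!: mult_left_mono)
      then show "ennreal (f s * exp (- (l * s))) \<le> ennreal (exp (- (l * t))) * ennreal (f s * exp (- (0 * s)))"
        by (simp add: ennreal_mult'[symmetric] ennreal_leI)
    qed
    also have "\<dots> = ennreal (exp (- (l * t))) * ennreal (exp (- (0 powr \<alpha>)))"
      by (subst nn_integral_cmult) (auto simp: laplace[of 0, simplified])
    finally show ?thesis by simp
  qed
  \<comment> \<open>chosen so that \<open>l t = 2 l\<^bsup>\<alpha>\<^esup>\<close>\<close>
  define l where "l = (2 / t) powr (1 / (1 - \<alpha>))"
  have l: "0 < l" using t by (simp add: l_def)
  have "l powr (1 - \<alpha>) = 2 / t"
    using t \<alpha>_less by (simp add: l_def powr_powr)
  then have "(l powr (1 - \<alpha>) * l powr \<alpha>) * t = 2 * l powr \<alpha>"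
    using t by simp
  moreover have "l powr (1 - \<alpha>) * l powr \<alpha> = l"
    using l by (simp add: powr_add[symmetric])
  ultimately have "l * t = 2 * l powr \<alpha>" by simp
  moreover have "0 < l powr \<alpha>" using l by simp
  ultimately show False using le[OF l] by simp
qed

text \<open>A zero of \<open>f\<close> at \<open>t\<close> would, by the equation for \<open>t f(t)\<close>, force \<open>f\<close> to vanish almost everywhere
  below \<open>t\<close>.\<close>
lemma f_pos: "AE t in lpos. 0 < f t"
  using renewal AE_lpos_pos
proof eventually_elim
  fix t assume eq: "ennreal (t * f t) = ennreal (\<alpha> / Gamma (1 - \<alpha>)) * levy_conv t" and t: "0 < t"
  have "levy_conv t \<noteq> 0"
  proof
    assume "levy_conv t = 0"
    then have "AE s in lpos. ennreal (f s * (t - s) powr (- \<alpha>)) * indicator {s<..} t = 0"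
      unfolding levy_conv_def by (subst (asm) nn_integral_0_iff_AE) (auto simp: indicator_def)
    then have "AE s in lpos. s < t \<longrightarrow> f s = 0"
      by eventually_elim (auto simp: mult_le_0_iff not_le dest: antisym[OF _ f_nonneg])
    then show False using not_AE_zero[OF t] by simp
  qed
  then have "ennreal (t * f t) \<noteq> 0"
    unfolding eq using \<alpha>_pos Gamma_1\<alpha> by simp
  then show "0 < f t" using t by (cases "f t = 0") (auto simp: less_le)
qed

text \<open>The equation for \<open>t f(t)\<close> turns the factor \<open>u f(t u)\<close> into a fractional integral of order \<open>1 - \<alpha>\<close>,
  and composing fractional integrals adds their orders.\<close>
lemma frac_avg_size_biased:
  assumes t: "0 < t" and p: "0 < p"
  shows "(\<integral>\<^sup>+u. ennreal (f (t * u) * u * (1 - u) powr (p - 1)) * indicator {..<1} u \<partial>lpos) =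
    ennreal (\<alpha> / Gamma (1 - \<alpha>) * t powr (- \<alpha>) * Beta (1 - \<alpha>) p) * frac_avg (p + 1 - \<alpha>) t"
proof -
  let ?m = "\<lambda>v. (ennreal (f (t * v) * (1 - v) powr ((p + 1 - \<alpha>) - 1)) * indicator {..<1} v)"
  let ?k = "\<lambda>u v. ennreal (f (t * v) * ((u - v) powr (- \<alpha>) * (1 - u) powr (p - 1))) * indicator {v<..<1} u"
  define c where "c = \<alpha> / Gamma (1 - \<alpha>) * t powr (- \<alpha>)"
  have c: "0 < c" using \<alpha>_pos Gamma_1\<alpha> t by (simp add: c_def)
  have sc: "AE u in lpos. ennreal (t * u * f (t * u)) = ennreal (\<alpha> / Gamma (1 - \<alpha>)) * levy_conv (t * u)"
    by (rule AE_lpos_scale[OF renewal t]) measurable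
  have "(\<integral>\<^sup>+u. ennreal (f (t * u) * u * (1 - u) powr (p - 1)) * indicator {..<1} u \<partial>lpos) =
     (\<integral>\<^sup>+u. ennreal c * (\<integral>\<^sup>+v. ?k u v \<partial>lpos) \<partial>lpos)"
  proof (rule nn_integral_cong_AE, use sc AE_lpos_pos in eventually_elim)
    fix u assume eq: "ennreal (t * u * f (t * u)) = ennreal (\<alpha> / Gamma (1 - \<alpha>)) * levy_conv (t * u)" and u: "0 < u"
    define Q where "Q = (\<integral>\<^sup>+v. ennreal (f (t * v) * (u - v) powr (- \<alpha>)) * indicator {v<..} u \<partial>lpos)"
    have "ennreal (f (t * u) * u) = ennreal (1 / t) * ennreal (t * u * f (t * u))"
      using t u by (subst ennreal_mult[symmetric]) auto
    also have "\<dots> = ennreal (1 / t * (\<alpha> / Gamma (1 - \<alpha>)) * t powr (1 - \<alpha>)) * Q"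
      unfolding eq levy_conv_scale[OF t u] Q_def[symmetric] using t \<alpha>_pos Gamma_1\<alpha> by (subst ennreal_mult3) auto
    also have "1 / t * (\<alpha> / Gamma (1 - \<alpha>)) * t powr (1 - \<alpha>) = c"
      using t by (simp add: c_def powr_diff powr_minus_divide)
    finally have eq': "ennreal (f (t * u) * u) = ennreal c * Q" .
    have "ennreal (f (t * u) * u * (1 - u) powr (p - 1)) * indicator {..<1} u =
       ennreal c * (Q * (ennreal ((1 - u) powr (p - 1)) * indicator {..<1} u))"
    proof -
      have "ennreal (f (t * u) * u * (1 - u) powr (p - 1)) = ennreal (f (t * u) * u) * ennreal ((1 - u) powr (p - 1))"
        by (rule ennreal_mult'') simp
      then show ?thesis by (simp only: eq' mult.assoc)
    qed
    also have "Q * (ennreal ((1 - u) powr (p - 1)) * indicator {..<1} u) =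
       (\<integral>\<^sup>+v. ?k u v \<partial>lpos)"
      unfolding Q_def
      by (subst nn_integral_multc[symmetric])
        (auto intro!: nn_integral_cong simp: indicator_def ennreal_mult''[symmetric] mult.assoc)
    finally show "ennreal (f (t * u) * u * (1 - u) powr (p - 1)) * indicator {..<1} u =
      ennreal c * (\<integral>\<^sup>+v. ?k u v \<partial>lpos)" .
  qed
  also have "\<dots> = ennreal c * (\<integral>\<^sup>+u. \<integral>\<^sup>+v. ?k u v \<partial>lpos \<partial>lpos)"
    by (rule nn_integral_cmult) (auto simp: indicator_def)
  also have "(\<integral>\<^sup>+u. \<integral>\<^sup>+v. ?k u v \<partial>lpos \<partial>lpos) =
      (\<integral>\<^sup>+v. \<integral>\<^sup>+u. ?k u v \<partial>lpos \<partial>lpos)"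
    by (rule lpos_pair.Fubini') (auto simp: indicator_def)
  also have "\<dots> = (\<integral>\<^sup>+v. ennreal (Beta (1 - \<alpha>) p) * ?m v \<partial>lpos)"
  proof (rule nn_integral_lpos_cong)
    fix v :: real assume v: "0 < v"
    have "(\<integral>\<^sup>+u. ?k u v \<partial>lpos) =
      (\<integral>\<^sup>+u. ennreal (f (t * v)) * (ennreal ((u - v) powr ((1 - \<alpha>) - 1) * (1 - u) powr (p - 1)) * indicator {v<..<1} u) \<partial>lpos)"
      by (auto intro!: nn_integral_cong simp: ennreal_mult' mult.assoc)
    also have "\<dots> = ennreal (f (t * v)) * (ennreal (Beta (1 - \<alpha>) p * (1 - v) powr (1 - \<alpha> + p - 1)) * indicator {..<1} v)"
      using \<alpha>_less p v by (subst nn_integral_cmult, simp, subst nn_integral_lpos_Beta_tail) auto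
    also have "\<dots> = ennreal (Beta (1 - \<alpha>) p) * ?m v"
      by (simp add: ennreal_mult'' ennreal_mult' mult_ac add.commute diff_add_eq)
    finally show "(\<integral>\<^sup>+u. ?k u v \<partial>lpos) =
      ennreal (Beta (1 - \<alpha>) p) * ?m v" .
  qed
  also have "\<dots> = ennreal (Beta (1 - \<alpha>) p) * frac_avg (p + 1 - \<alpha>) t"
    unfolding frac_avg_def by (rule nn_integral_cmult) measurable
  also have "ennreal c * (ennreal (Beta (1 - \<alpha>) p) * frac_avg (p + 1 - \<alpha>) t) = ennreal (c * Beta (1 - \<alpha>) p) * frac_avg (p + 1 - \<alpha>) t"
    using c by (subst ennreal_mult') (auto simp: mult.assoc)
  finally show ?thesis unfolding c_def .
qed

text \<open>Boundedness of \<open>G\<^bsub>k,k\<^esub>\<close>, by induction on \<open>k\<close>. The orders that occur are \<open>k - k \<alpha>\<close>; the previous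
  lemma reaches the next one, and replacing the factor \<open>u\<close> by \<open>1\<close> there gives the inequality.\<close>
lemma frac_avg_bound_diag:
  assumes "1 \<le> (k::nat)"
  shows "\<exists>C\<ge>0. AE t in lpos. ennreal (t powr (- (real k * \<alpha>))) * frac_avg (real k - real k * \<alpha>) t \<le> ennreal (C * f t)"
  using assms
proof (induction k rule: dec_induct)
  case base
  have "AE t in lpos. ennreal (t powr (- (real 1 * \<alpha>))) * frac_avg (real 1 - real 1 * \<alpha>) t \<le> ennreal (Gamma (1 - \<alpha>) / \<alpha> * f t)"
    using renewal_frac_avg
  proof eventually_elim
    fix t assume eq: "ennreal (f t) = ennreal (\<alpha> / Gamma (1 - \<alpha>) * t powr (- \<alpha>)) * frac_avg (1 - \<alpha>) t"
    have "ennreal (Gamma (1 - \<alpha>) / \<alpha> * f t) =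
        ennreal (Gamma (1 - \<alpha>) / \<alpha>) * (ennreal (\<alpha> / Gamma (1 - \<alpha>) * t powr (- \<alpha>)) * frac_avg (1 - \<alpha>) t)"
      by (subst eq[symmetric], rule ennreal_mult'') simp
    also have "\<dots> = ennreal (Gamma (1 - \<alpha>) / \<alpha> * (\<alpha> / Gamma (1 - \<alpha>) * t powr (- \<alpha>))) * frac_avg (1 - \<alpha>) t"
      using \<alpha>_pos Gamma_1\<alpha> by (subst ennreal_mult) (auto simp: mult.assoc)
    also have "Gamma (1 - \<alpha>) / \<alpha> * (\<alpha> / Gamma (1 - \<alpha>) * t powr (- \<alpha>)) = t powr (- \<alpha>)"
      using \<alpha>_pos Gamma_1\<alpha> by simp
    finally show "ennreal (t powr (- (real 1 * \<alpha>))) * frac_avg (real 1 - real 1 * \<alpha>) t \<le> ennreal (Gamma (1 - \<alpha>) / \<alpha> * f t)"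
      by simp
  qed
  then show ?case using \<alpha>_pos Gamma_1\<alpha> by (intro exI[of _ "Gamma (1 - \<alpha>) / \<alpha>"]) auto
next
  case (step k)
  then obtain C where C: "0 \<le> C"
    "AE t in lpos. ennreal (t powr (- (real k * \<alpha>))) * frac_avg (real k - real k * \<alpha>) t \<le> ennreal (C * f t)" by blast
  define p where "p = real k - real k * \<alpha>"
  have p: "0 < p" using \<alpha>_less step.hyps by (simp add: p_def)
  define d where "d = \<alpha> / Gamma (1 - \<alpha>) * Beta (1 - \<alpha>) p"
  have "0 < Beta (1 - \<alpha>) p" using p \<alpha>_less by (simp add: Beta_def)
  then have d: "0 < d" using \<alpha>_pos Gamma_1\<alpha> by (simp add: d_def)
  have "AE t in lpos. ennreal (t powr (- (real (Suc k) * \<alpha>))) * frac_avg (real (Suc k) - real (Suc k) * \<alpha>) t \<le> ennreal (C / d * f t)"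
    using C(2) AE_lpos_pos
  proof eventually_elim
    fix t assume le: "ennreal (t powr (- (real k * \<alpha>))) * frac_avg (real k - real k * \<alpha>) t \<le> ennreal (C * f t)" and t: "0 < t"
    have "ennreal (\<alpha> / Gamma (1 - \<alpha>) * t powr (- \<alpha>) * Beta (1 - \<alpha>) p) * frac_avg (p + 1 - \<alpha>) t \<le> frac_avg p t"
      unfolding frac_avg_size_biased[OF t p, symmetric] unfolding frac_avg_def
    proof (rule nn_integral_mono_AE, use AE_lpos_pos in eventually_elim)
      fix u :: real assume "0 < u"
      then show "ennreal (f (t * u) * u * (1 - u) powr (p - 1)) * indicator {..<1} u \<le>
          ennreal (f (t * u) * (1 - u) powr (p - 1)) * indicator {..<1} u"
        by (auto intro!: ennreal_leI mult_right_mono mult_left_le split: split_indicator)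
    qed
    then have "ennreal (d * t powr (- \<alpha>)) * frac_avg (p + 1 - \<alpha>) t \<le> frac_avg p t"
      by (simp add: d_def mult_ac)
    then have "ennreal (1 / d * t powr (- (real k * \<alpha>))) * (ennreal (d * t powr (- \<alpha>)) * frac_avg (p + 1 - \<alpha>) t) \<le>
      ennreal (1 / d * t powr (- (real k * \<alpha>))) * frac_avg p t"
      by (rule mult_left_mono) simp
    also have "ennreal (1 / d * t powr (- (real k * \<alpha>))) * (ennreal (d * t powr (- \<alpha>)) * frac_avg (p + 1 - \<alpha>) t) =
      ennreal (1 / d * t powr (- (real k * \<alpha>)) * (d * t powr (- \<alpha>))) * frac_avg (p + 1 - \<alpha>) t"
      using d by (subst ennreal_mult) (auto simp: mult.assoc)
    also have "1 / d * t powr (- (real k * \<alpha>)) * (d * t powr (- \<alpha>)) = t powr (- (real (Suc k) * \<alpha>))"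
      using d by (simp add: powr_add[symmetric] algebra_simps)
    also have "p + 1 - \<alpha> = real (Suc k) - real (Suc k) * \<alpha>" by (simp add: p_def algebra_simps)
    also have "ennreal (1 / d * t powr (- (real k * \<alpha>))) * frac_avg p t = ennreal (1 / d) * (ennreal (t powr (- (real k * \<alpha>))) * frac_avg p t)"
      by (subst ennreal_mult'') (auto simp: mult.assoc)
    also have "\<dots> \<le> ennreal (1 / d) * ennreal (C * f t)"
      using le unfolding p_def by (rule mult_left_mono) simp
    also have "\<dots> = ennreal (C / d * f t)"
      using d C(1) by (subst ennreal_mult[symmetric]) auto
    finally show "ennreal (t powr (- (real (Suc k) * \<alpha>))) * frac_avg (real (Suc k) - real (Suc k) * \<alpha>) t \<le> ennreal (C / d * f t)" .
  qed
  then show ?case using C(1) d by (intro exI[of _ "C / d"]) auto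
qed

lemma frac_avg_bound:
  assumes "1 \<le> (k::nat)" "k \<le> n"
  shows "\<exists>C\<ge>0. AE t in lpos. ennreal (t powr (- (real k * \<alpha>))) * frac_avg (real n - real k * \<alpha>) t \<le> ennreal (C * f t)"
proof -
  obtain C where C: "0 \<le> C"
    "AE t in lpos. ennreal (t powr (- (real k * \<alpha>))) * frac_avg (real k - real k * \<alpha>) t \<le> ennreal (C * f t)"
    using frac_avg_bound_diag[OF assms(1)] by blast
  have "frac_avg (real n - real k * \<alpha>) t \<le> frac_avg (real k - real k * \<alpha>) t" for t
    using assms by (intro frac_avg_antimono) auto
  then have "AE t in lpos. ennreal (t powr (- (real k * \<alpha>))) * frac_avg (real n - real k * \<alpha>) t \<le> ennreal (C * f t)"
    by (intro eventually_mono[OF C(2)]) (meson mult_left_mono order_trans zero_le)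
  then show ?thesis using C(1) by blast
qed

section \<open>The law behind the weights\<close>

text \<open>The substitution \<open>s = t u\<close>. On the right stand, up to constants, the densities of a beta
  variable \<open>u\<close> and of the tilted stable variable \<open>s\<close>.\<close>
lemma mixing_subst:
  assumes [measurable]: "\<phi> \<in> borel_measurable borel"
  shows "(\<integral>\<^sup>+t. ennreal (t powr (- a)) * frac_avg b t * \<phi> t \<partial>lpos) =
    (\<integral>\<^sup>+u. ennreal (u powr (a - 1) * (1 - u) powr (b - 1)) * indicator {..<1} u *
       (\<integral>\<^sup>+s. ennreal (s powr (- a) * f s) * \<phi> (s / u) \<partial>lpos) \<partial>lpos)"
proof -
  let ?k = "\<lambda>t u. ennreal (t powr (- a) * f (t * u)) * \<phi> t * (ennreal ((1 - u) powr (b - 1)) * indicator {..<1} u)"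
  let ?E = "\<lambda>u. (\<integral>\<^sup>+s. ennreal (s powr (- a) * f s) * \<phi> (s / u) \<partial>lpos)"
  have "(\<integral>\<^sup>+t. ennreal (t powr (- a)) * frac_avg b t * \<phi> t \<partial>lpos) =
     (\<integral>\<^sup>+t. \<integral>\<^sup>+u. ?k t u \<partial>lpos \<partial>lpos)"
  proof (rule nn_integral_cong)
    fix t
    have "ennreal (t powr (- a)) * frac_avg b t * \<phi> t = (ennreal (t powr (- a)) * \<phi> t) * frac_avg b t" by (simp add: mult_ac)
    also have "\<dots> = (\<integral>\<^sup>+u. (ennreal (t powr (- a)) * \<phi> t) * (ennreal (f (t * u) * (1 - u) powr (b - 1)) * indicator {..<1} u) \<partial>lpos)"
      unfolding frac_avg_def by (rule nn_integral_cmult[symmetric]) measurable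
    also have "\<dots> = (\<integral>\<^sup>+u. ?k t u \<partial>lpos)"
      by (intro nn_integral_cong) (simp add: ennreal_mult mult_ac)
    finally show "ennreal (t powr (- a)) * frac_avg b t * \<phi> t = \<dots>" .
  qed
  also have "\<dots> = (\<integral>\<^sup>+u. \<integral>\<^sup>+t. ?k t u \<partial>lpos \<partial>lpos)"
    by (rule lpos_pair.Fubini') measurable
  also have "\<dots> = (\<integral>\<^sup>+u. ennreal (u powr (a - 1) * (1 - u) powr (b - 1)) * indicator {..<1} u *
       (?E u) \<partial>lpos)"
  proof (rule nn_integral_lpos_cong)
    fix u :: real assume u: "0 < u"
    have "(\<integral>\<^sup>+t. ?k t u \<partial>lpos) =
      (\<integral>\<^sup>+t. ennreal (t powr (- a) * f (t * u)) * \<phi> t \<partial>lpos) * (ennreal ((1 - u) powr (b - 1)) * indicator {..<1} u)"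
      by (rule nn_integral_multc) measurable
    also have "(\<integral>\<^sup>+t. ennreal (t powr (- a) * f (t * u)) * \<phi> t \<partial>lpos) =
      ennreal (1 / u) * (\<integral>\<^sup>+s. ennreal ((1 / u * s) powr (- a) * f (1 / u * s * u)) * \<phi> (1 / u * s) \<partial>lpos)"
      using u by (intro nn_integral_lpos_scale) auto
    also have "(\<integral>\<^sup>+s. ennreal ((1 / u * s) powr (- a) * f (1 / u * s * u)) * \<phi> (1 / u * s) \<partial>lpos) =
      (\<integral>\<^sup>+s. ennreal (u powr a) * (ennreal (s powr (- a) * f s) * \<phi> (s / u)) \<partial>lpos)"
    proof (rule nn_integral_lpos_cong)
      fix s :: real assume s: "0 < s"
      have "(1 / u * s) powr (- a) = u powr a * s powr (- a)"
        using u s by (simp add: powr_divide powr_minus field_simps)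
      then show "ennreal ((1 / u * s) powr (- a) * f (1 / u * s * u)) * \<phi> (1 / u * s) =
         ennreal (u powr a) * (ennreal (s powr (- a) * f s) * \<phi> (s / u))"
        using u by (simp add: ennreal_mult mult_ac)
    qed
    also have "\<dots> = ennreal (u powr a) * ?E u"
      by (rule nn_integral_cmult) measurable
    also have "ennreal (1 / u) * (ennreal (u powr a) * X) = ennreal (u powr (a - 1)) * X" for X
      using u by (simp add: mult.assoc[symmetric] ennreal_mult'[symmetric] powr_diff)
    finally show "(\<integral>\<^sup>+t. ?k t u \<partial>lpos) =
      ennreal (u powr (a - 1) * (1 - u) powr (b - 1)) * indicator {..<1} u * ?E u"
      by (simp add: ennreal_mult mult_ac)
  qed
  finally show ?thesis .
qed

text \<open>After \<open>s = t u\<close> the integral over \<open>u\<close> leaves \<open>(1 + l x / s)\<^bsup>-a\<^esup>\<close> with \<open>a = \<kappa> \<alpha>\<close>, which combines with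
  the tilting factor \<open>s\<^bsup>-a\<^esup>\<close> to \<open>(s + l x)\<^bsup>-a\<^esup>\<close>. As a gamma integral over \<open>y\<close> this separates \<open>s\<close> from
  \<open>x\<close>, and the integrals over \<open>s\<close> and \<open>x\<close> are the Laplace transform of \<open>f\<close> at \<open>y\<close> and at \<open>l y\<close>.\<close>
lemma mixing_stieltjes:
  assumes \<kappa>: "0 < \<kappa>" and p: "\<kappa> * \<alpha> < p" and l: "0 \<le> l"
  shows "(\<integral>\<^sup>+t. ennreal (t powr (- (\<kappa> * \<alpha>))) * frac_avg (p - \<kappa> * \<alpha>) t *
       (\<integral>\<^sup>+x. ennreal (f x * (1 + l * (x / t)) powr (- p)) \<partial>lpos) \<partial>lpos) =
    ennreal (Gamma (p - \<kappa> * \<alpha>) * Gamma \<kappa> / (\<alpha> * Gamma p) * (1 + l powr \<alpha>) powr (- \<kappa>))"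
proof -
  define a b where "a = \<kappa> * \<alpha>" and "b = p - \<kappa> * \<alpha>"
  have a: "0 < a" and b: "0 < b" and ab: "a + b = p"
    using \<kappa> p \<alpha>_pos by (auto simp: a_def b_def)
  have B: "0 < Beta a b" using a b by (simp add: Beta_def)
  let ?q = "\<lambda>s x y. (f s * f x * (y powr (a - 1) * exp (- (s + l * x) * y)))"
  let ?E = "\<lambda>s u. (\<integral>\<^sup>+x. ennreal (f x * (1 + l * (x / (s / u))) powr (- p)) \<partial>lpos)"
  define W where "W u s x = ennreal (s powr (- a) * f s * f x) *
      (ennreal (u powr (a - 1) * (1 - u) powr (b - 1) * (1 + (l * x / s) * u) powr (- (a + b))) * indicator {..<1} u)" for u s x
  have W_meas [measurable]: "(\<lambda>x. W (g1 x) (g2 x) (g3 x)) \<in> borel_measurable N"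
    if [measurable]: "g1 \<in> borel_measurable N" "g2 \<in> borel_measurable N" "g3 \<in> borel_measurable N"
    for g1 g2 g3 :: "'c \<Rightarrow> real" and N :: "'c measure"
    unfolding W_def by measurable
  have "(\<integral>\<^sup>+t. ennreal (t powr (- a)) * frac_avg b t * (\<integral>\<^sup>+x. ennreal (f x * (1 + l * (x / t)) powr (- p)) \<partial>lpos) \<partial>lpos) =
    (\<integral>\<^sup>+u. ennreal (u powr (a - 1) * (1 - u) powr (b - 1)) * indicator {..<1} u *
       (\<integral>\<^sup>+s. ennreal (s powr (- a) * f s) * ?E s u \<partial>lpos) \<partial>lpos)"
    by (rule mixing_subst) measurable
  also have "\<dots> = (\<integral>\<^sup>+u. \<integral>\<^sup>+s. \<integral>\<^sup>+x. W u s x \<partial>lpos \<partial>lpos \<partial>lpos)"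
  proof (rule nn_integral_cong)
    fix u
    have *: "ennreal (u powr (a - 1) * (1 - u) powr (b - 1)) * indicator {..<1} u *
          (ennreal (s powr (- a) * f s) * ?E s u) =
        (\<integral>\<^sup>+x. W u s x \<partial>lpos)" for s
    proof -
      have "ennreal (u powr (a - 1) * (1 - u) powr (b - 1)) * indicator {..<1} u *
          (ennreal (s powr (- a) * f s) * ?E s u) =
        (\<integral>\<^sup>+x. ennreal (u powr (a - 1) * (1 - u) powr (b - 1)) * indicator {..<1} u *
          (ennreal (s powr (- a) * f s) * ennreal (f x * (1 + l * (x / (s / u))) powr (- p))) \<partial>lpos)"
        by (simp add: nn_integral_cmult)
      also have "\<dots> = (\<integral>\<^sup>+x. W u s x \<partial>lpos)"
        unfolding W_def ab
        by (intro nn_integral_cong) (simp add: ennreal_mult mult_ac)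
      finally show ?thesis .
    qed
    show "ennreal (u powr (a - 1) * (1 - u) powr (b - 1)) * indicator {..<1} u *
       (\<integral>\<^sup>+s. ennreal (s powr (- a) * f s) * ?E s u \<partial>lpos) =
       (\<integral>\<^sup>+s. \<integral>\<^sup>+x. W u s x \<partial>lpos \<partial>lpos)"
      unfolding *[symmetric] by (rule nn_integral_cmult[symmetric]) measurable
  qed
  also have "\<dots> = (\<integral>\<^sup>+s. \<integral>\<^sup>+u. \<integral>\<^sup>+x. W u s x \<partial>lpos \<partial>lpos \<partial>lpos)"
    by (rule lpos_pair.Fubini') measurable
  also have "\<dots> = (\<integral>\<^sup>+s. \<integral>\<^sup>+x. \<integral>\<^sup>+u. W u s x \<partial>lpos \<partial>lpos \<partial>lpos)"
    by (intro nn_integral_cong lpos_pair.Fubini') measurable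
  also have "\<dots> = (\<integral>\<^sup>+s. \<integral>\<^sup>+x. \<integral>\<^sup>+y. ennreal (Beta a b / Gamma a) *
      ennreal (?q s x y) \<partial>lpos \<partial>lpos \<partial>lpos)"
  proof (rule nn_integral_lpos_cong, rule nn_integral_lpos_cong)
    fix s x :: real assume s: "0 < s" and x: "0 < x"
    have sx: "0 < s + l * x" using s l x by (simp add: add_pos_nonneg)
    have z: "0 \<le> l * x / s" using l s x by simp
    have "(\<integral>\<^sup>+u. W u s x \<partial>lpos) = ennreal (s powr (- a) * f s * f x) * ennreal (Beta a b * (1 + l * x / s) powr (- a))"
      unfolding W_def using nn_integral_Beta_Stieltjes[OF a b z]
      by (subst nn_integral_cmult) auto
    also have "\<dots> = ennreal (s powr (- a) * f s * f x * (Beta a b * (1 + l * x / s) powr (- a)))"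
      using B by (subst ennreal_mult) auto
    also have "s powr (- a) * f s * f x * (Beta a b * (1 + l * x / s) powr (- a)) =
       Beta a b / Gamma a * (f s * f x) * (Gamma a / (s + l * x) powr a)"
    proof -
      have "s * (1 + l * x / s) = s + l * x" using s by (simp add: field_simps)
      then have "s powr (- a) * (1 + l * x / s) powr (- a) = (s + l * x) powr (- a)"
        using s z by (subst powr_mult[symmetric]) auto
      then have "s powr (- a) * f s * f x * (Beta a b * (1 + l * x / s) powr (- a)) = Beta a b * (f s * f x) * (s + l * x) powr (- a)"
        by (metis (no_types, opaque_lifting) mult.assoc mult.commute)
      then show ?thesis using Gamma_real_pos[OF a] by (simp add: powr_minus_divide)
    qed
    also have "ennreal (Beta a b / Gamma a * (f s * f x) * (Gamma a / (s + l * x) powr a)) =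
       ennreal (Beta a b / Gamma a) * (ennreal (f s * f x) * ennreal (Gamma a / (s + l * x) powr a))"
      using B a ennreal_mult3[of "Beta a b / Gamma a" "f s * f x" "Gamma a / (s + l * x) powr a" 1] by simp
    also have "\<dots> = ennreal (Beta a b / Gamma a) *
        (ennreal (f s * f x) * (\<integral>\<^sup>+y. ennreal (y powr (a - 1) * exp (- (s + l * x) * y)) \<partial>lpos))"
      by (simp only: nn_integral_lpos_Gamma[OF a sx])
    also have "\<dots> = (\<integral>\<^sup>+y. ennreal (Beta a b / Gamma a) *
        (ennreal (f s * f x) * ennreal (y powr (a - 1) * exp (- (s + l * x) * y))) \<partial>lpos)"
      by (simp add: nn_integral_cmult)
    also have "\<dots> = (\<integral>\<^sup>+y. ennreal (Beta a b / Gamma a) *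
        ennreal (?q s x y) \<partial>lpos)"
      by (simp add: ennreal_mult')
    finally show "(\<integral>\<^sup>+u. W u s x \<partial>lpos) = (\<integral>\<^sup>+y. ennreal (Beta a b / Gamma a) *
      ennreal (?q s x y) \<partial>lpos)" .
  qed
  also have "\<dots> = (\<integral>\<^sup>+s. \<integral>\<^sup>+y. \<integral>\<^sup>+x. ennreal (Beta a b / Gamma a) *
      ennreal (?q s x y) \<partial>lpos \<partial>lpos \<partial>lpos)"
    by (intro nn_integral_cong lpos_pair.Fubini') measurable
  also have "\<dots> = (\<integral>\<^sup>+y. \<integral>\<^sup>+s. \<integral>\<^sup>+x. ennreal (Beta a b / Gamma a) *
      ennreal (?q s x y) \<partial>lpos \<partial>lpos \<partial>lpos)"
    by (rule lpos_pair.Fubini') measurable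
  also have "\<dots> = (\<integral>\<^sup>+y. ennreal (Beta a b / Gamma a) * ennreal (y powr (\<kappa> * \<alpha> - 1) * exp (- (1 + l powr \<alpha>) * y powr \<alpha>)) \<partial>lpos)"
  proof (rule nn_integral_lpos_cong)
    fix y :: real assume y: "0 < y"
    have "(\<integral>\<^sup>+s. \<integral>\<^sup>+x. ennreal (Beta a b / Gamma a) * ennreal (?q s x y) \<partial>lpos \<partial>lpos) =
      (\<integral>\<^sup>+s. \<integral>\<^sup>+x. ennreal (Beta a b / Gamma a * y powr (a - 1)) * (ennreal (f s * exp (- (y * s))) * ennreal (f x * exp (- (l * y * x)))) \<partial>lpos \<partial>lpos)"
    proof (intro nn_integral_cong)
      fix s x
      have "exp (- (s + l * x) * y) = exp (- (y * s)) * exp (- (l * y * x))"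
        by (simp add: exp_add[symmetric] algebra_simps)
      then show "ennreal (Beta a b / Gamma a) * ennreal (?q s x y) =
        ennreal (Beta a b / Gamma a * y powr (a - 1)) * (ennreal (f s * exp (- (y * s))) * ennreal (f x * exp (- (l * y * x))))"
        by (simp only: ennreal_mult''[symmetric] f_nonneg zero_le_mult_iff exp_ge_zero powr_ge_zero simp_thms) (simp add: mult_ac)
    qed
    also have "\<dots> = (\<integral>\<^sup>+s. ennreal (Beta a b / Gamma a * y powr (a - 1)) * (ennreal (f s * exp (- (y * s))) * ennreal (exp (- ((l * y) powr \<alpha>)))) \<partial>lpos)"
      using laplace[of "l * y"] l y by (simp add: nn_integral_cmult)
    also have "\<dots> = ennreal (Beta a b / Gamma a * y powr (a - 1)) * (ennreal (exp (- (y powr \<alpha>))) * ennreal (exp (- ((l * y) powr \<alpha>))))"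
      using y by (subst nn_integral_cmult, simp, subst nn_integral_multc) (auto simp: laplace)
    also have "\<dots> = ennreal (Beta a b / Gamma a * y powr (a - 1) * (exp (- (y powr \<alpha>)) * exp (- ((l * y) powr \<alpha>))))"
      by (simp only: ennreal_mult''[symmetric] exp_ge_zero zero_le_mult_iff simp_thms)
    also have "exp (- (y powr \<alpha>)) * exp (- ((l * y) powr \<alpha>)) = exp (- (1 + l powr \<alpha>) * y powr \<alpha>)"
      using l y by (simp add: exp_add[symmetric] powr_mult algebra_simps)
    also have "ennreal (Beta a b / Gamma a * y powr (a - 1) * exp (- (1 + l powr \<alpha>) * y powr \<alpha>)) =
       ennreal (Beta a b / Gamma a) * ennreal (y powr (\<kappa> * \<alpha> - 1) * exp (- (1 + l powr \<alpha>) * y powr \<alpha>))"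
      unfolding a_def mult.assoc by (rule ennreal_mult'') simp
    finally show "(\<integral>\<^sup>+s. \<integral>\<^sup>+x. ennreal (Beta a b / Gamma a) * ennreal (?q s x y) \<partial>lpos \<partial>lpos) =
      ennreal (Beta a b / Gamma a) * ennreal (y powr (\<kappa> * \<alpha> - 1) * exp (- (1 + l powr \<alpha>) * y powr \<alpha>))" .
  qed
  also have "\<dots> = ennreal (Beta a b / Gamma a) * ennreal (Gamma \<kappa> / (\<alpha> * (1 + l powr \<alpha>) powr \<kappa>))"
    using \<kappa> \<alpha>_pos by (subst nn_integral_cmult, simp, subst nn_integral_lpos_Gamma_powr) (auto intro: add_pos_nonneg)
  also have "\<dots> = ennreal (Beta a b / Gamma a * (Gamma \<kappa> / (\<alpha> * (1 + l powr \<alpha>) powr \<kappa>)))"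
    using \<kappa> \<alpha>_pos by (intro ennreal_mult''[symmetric]) auto
  also have "Beta a b / Gamma a * (Gamma \<kappa> / (\<alpha> * (1 + l powr \<alpha>) powr \<kappa>)) =
     Gamma (p - \<kappa> * \<alpha>) * Gamma \<kappa> / (\<alpha> * Gamma p) * (1 + l powr \<alpha>) powr (- \<kappa>)"
    using Gamma_real_pos[OF a] ab by (simp add: Beta_def powr_minus_divide b_def[symmetric])
  finally show ?thesis unfolding a_def b_def .
qed

text \<open>The image of the measure with density \<open>G\<^bsub>n,k\<^esub>(t) f(t) f(x)\<close> under \<open>(t, x) \<mapsto> x / t\<close>. The factor \<open>f(t)\<close>
  is cancelled against the denominator of \<open>G\<^bsub>n,k\<^esub>\<close>.\<close>
definition mix :: "nat \<Rightarrow> nat \<Rightarrow> real measure" where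
  "mix n k = distr
     (density (lpos \<Otimes>\<^sub>M lpos) (\<lambda>p. ennreal (\<alpha> ^ k / Gamma (real n - real k * \<alpha>)) *
        (ennreal (fst p powr (- (real k * \<alpha>))) * frac_avg (real n - real k * \<alpha>) (fst p) * ennreal (f (snd p)))))
     borel (\<lambda>p. snd p / fst p)"

lemma sets_mix [simp, measurable_cong]: "sets (mix n k) = sets borel"
  by (simp add: mix_def)

lemma nn_integral_mix:
  assumes [measurable]: "h \<in> borel_measurable borel"
  shows "(\<integral>\<^sup>+z. h z \<partial>mix n k) = ennreal (\<alpha> ^ k / Gamma (real n - real k * \<alpha>)) *
    (\<integral>\<^sup>+t. ennreal (t powr (- (real k * \<alpha>))) * frac_avg (real n - real k * \<alpha>) t *
       (\<integral>\<^sup>+x. ennreal (f x) * h (x / t) \<partial>lpos) \<partial>lpos)"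
proof -
  let ?E = "\<lambda>t. (\<integral>\<^sup>+x. ennreal (f x) * h (x / t) \<partial>lpos)"
  define H where "H t = ennreal (t powr (- (real k * \<alpha>))) * frac_avg (real n - real k * \<alpha>) t" for t
  have [measurable]: "H \<in> borel_measurable borel" unfolding H_def by measurable
  define c where "c = ennreal (\<alpha> ^ k / Gamma (real n - real k * \<alpha>))"
  have "(\<integral>\<^sup>+z. h z \<partial>mix n k) = (\<integral>\<^sup>+p. c * (H (fst p) * ennreal (f (snd p))) * h (snd p / fst p) \<partial>(lpos \<Otimes>\<^sub>M lpos))"
    unfolding mix_def H_def[symmetric] c_def[symmetric]
    by (subst nn_integral_distr, simp, simp, subst nn_integral_density) auto
  also have "\<dots> = (\<integral>\<^sup>+t. \<integral>\<^sup>+x. c * (H t * ennreal (f x)) * h (x / t) \<partial>lpos \<partial>lpos)"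
    by (subst lpos.nn_integral_fst[symmetric]) auto
  also have "\<dots> = (\<integral>\<^sup>+t. c * (H t * ?E t) \<partial>lpos)"
    by (simp add: nn_integral_cmult mult.assoc)
  also have "\<dots> = c * (\<integral>\<^sup>+t. H t * ?E t \<partial>lpos)"
    by (rule nn_integral_cmult) measurable
  finally show ?thesis unfolding H_def c_def .
qed

lemma nn_integral_f: "(\<integral>\<^sup>+x. ennreal (f x) \<partial>lpos) = 1"
  using laplace[of 0] by simp

text \<open>The boundedness of \<open>G\<^bsub>n,k\<^esub>\<close>, read as a comparison of \<open>mix n k\<close> with the law of \<open>X\<^sub>\<alpha>\<close>.\<close>
lemma nn_integral_mix_bound:
  assumes "1 \<le> k" "k \<le> n"
  shows "\<exists>C::real. \<forall>h\<in>borel_measurable borel. (\<integral>\<^sup>+z. h z \<partial>mix n k) \<le>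
    ennreal C * (\<integral>\<^sup>+t. ennreal (f t) * (\<integral>\<^sup>+x. ennreal (f x) * h (x / t) \<partial>lpos) \<partial>lpos)"
proof -
  let ?E = "\<lambda>h t. (\<integral>\<^sup>+x. ennreal (f x) * h (x / t) \<partial>lpos)"
  obtain C where C: "0 \<le> C"
    "AE t in lpos. ennreal (t powr (- (real k * \<alpha>))) * frac_avg (real n - real k * \<alpha>) t \<le> ennreal (C * f t)"
    using frac_avg_bound[OF assms] by blast
  have "(\<integral>\<^sup>+z. h z \<partial>mix n k) \<le> ennreal (\<alpha> ^ k / Gamma (real n - real k * \<alpha>) * C) *
     (\<integral>\<^sup>+t. ennreal (f t) * ?E h t \<partial>lpos)"
    if [measurable]: "h \<in> borel_measurable borel" for h
  proof -
    have "(\<integral>\<^sup>+t. ennreal (t powr (- (real k * \<alpha>))) * frac_avg (real n - real k * \<alpha>) t *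
       (?E h t) \<partial>lpos) \<le>
      (\<integral>\<^sup>+t. ennreal C * (ennreal (f t) * ?E h t) \<partial>lpos)"
    proof (rule nn_integral_mono_AE, use C(2) in eventually_elim)
      fix t assume "ennreal (t powr (- (real k * \<alpha>))) * frac_avg (real n - real k * \<alpha>) t \<le> ennreal (C * f t)"
      then have "ennreal (t powr (- (real k * \<alpha>))) * frac_avg (real n - real k * \<alpha>) t * X \<le> ennreal (C * f t) * X" for X
        by (rule mult_right_mono) simp
      then show "ennreal (t powr (- (real k * \<alpha>))) * frac_avg (real n - real k * \<alpha>) t * ?E h t \<le>
        ennreal C * (ennreal (f t) * ?E h t)"
        using C(1) by (simp add: ennreal_mult mult.assoc)
    qed
    also have "\<dots> = ennreal C * (\<integral>\<^sup>+t. ennreal (f t) * ?E h t \<partial>lpos)"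
      by (rule nn_integral_cmult) measurable
    finally have "ennreal (\<alpha> ^ k / Gamma (real n - real k * \<alpha>)) * (\<integral>\<^sup>+t. ennreal (t powr (- (real k * \<alpha>))) * frac_avg (real n - real k * \<alpha>) t *
       (?E h t) \<partial>lpos) \<le>
       ennreal (\<alpha> ^ k / Gamma (real n - real k * \<alpha>)) * (ennreal C * (\<integral>\<^sup>+t. ennreal (f t) * ?E h t \<partial>lpos))"
      by (rule mult_left_mono) simp
    then show ?thesis
      unfolding nn_integral_mix[OF that] ennreal_mult''[OF C(1)]
        mult.assoc[of "ennreal (\<alpha> ^ k / Gamma (real n - real k * \<alpha>))" "ennreal C"] .
  qed
  then show ?thesis by blast
qed

lemma finite_mix:
  assumes "1 \<le> k" "k \<le> n"
  shows "finite_measure (mix n k)"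
proof
  obtain C :: real where C: "\<And>h. h \<in> borel_measurable borel \<Longrightarrow> (\<integral>\<^sup>+z. h z \<partial>mix n k) \<le>
    ennreal C * (\<integral>\<^sup>+t. ennreal (f t) * (\<integral>\<^sup>+x. ennreal (f x) * h (x / t) \<partial>lpos) \<partial>lpos)"
    using nn_integral_mix_bound[OF assms] by blast
  have "emeasure (mix n k) (space (mix n k)) = (\<integral>\<^sup>+z. 1 \<partial>mix n k)" by simp
  also have "\<dots> \<le> ennreal C * (\<integral>\<^sup>+t. ennreal (f t) * (\<integral>\<^sup>+x. ennreal (f x) * 1 \<partial>lpos) \<partial>lpos)"
    using C[of "\<lambda>_. 1"] by simp
  also have "\<dots> < \<infinity>" by (simp add: nn_integral_f)
  finally show "emeasure (mix n k) (space (mix n k)) \<noteq> \<infinity>" by simp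
qed

lemma nn_integral_mix_nonpos: "(\<integral>\<^sup>+z. indicator {..0} z \<partial>mix n k) = 0"
proof -
  let ?E = "\<lambda>t. (\<integral>\<^sup>+x. ennreal (f x) * indicator {..0} (x / t) \<partial>lpos)"
  have "(\<integral>\<^sup>+t. ennreal (t powr (- (real k * \<alpha>))) * frac_avg (real n - real k * \<alpha>) t *
       (?E t) \<partial>lpos) = (\<integral>\<^sup>+t. 0 \<partial>lpos)"
  proof (rule nn_integral_lpos_cong)
    fix t :: real assume t: "0 < t"
    have "(?E t) = (\<integral>\<^sup>+x. 0 \<partial>lpos)"
      by (rule nn_integral_lpos_cong) (use t in \<open>simp add: indicator_def not_le\<close>)
    then show "ennreal (t powr (- (real k * \<alpha>))) * frac_avg (real n - real k * \<alpha>) t *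
       (?E t) = 0" by simp
  qed
  then show ?thesis by (subst nn_integral_mix) auto
qed

lemma n_minus_pos:
  assumes "1 \<le> k" "k \<le> n"
  shows "0 < real n - real k * \<alpha>"
proof -
  have "real k * \<alpha> < real k * 1" using assms(1) \<alpha>_less by (intro mult_strict_left_mono) auto
  then show ?thesis using assms(2) by simp
qed

lemma mix_stieltjes:
  assumes k: "1 \<le> k" "k \<le> n" and l: "0 \<le> l"
  shows "(\<integral>\<^sup>+z. ennreal ((1 + l * z) powr (- real n)) \<partial>mix n k) =
    ennreal (\<alpha> ^ (k - 1) * Gamma (real k) / Gamma (real n) * (1 + l powr \<alpha>) powr (- real k))"
proof -
  have b: "0 < real n - real k * \<alpha>" by (rule n_minus_pos[OF k])
  have "(\<integral>\<^sup>+z. ennreal ((1 + l * z) powr (- real n)) \<partial>mix n k) = ennreal (\<alpha> ^ k / Gamma (real n - real k * \<alpha>)) *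
    ennreal (Gamma (real n - real k * \<alpha>) * Gamma (real k) / (\<alpha> * Gamma (real n)) * (1 + l powr \<alpha>) powr (- real k))"
    using mixing_stieltjes[of "real k" "real n" l] k l b
    by (subst nn_integral_mix) (auto simp: ennreal_mult')
  also have "\<dots> = ennreal (\<alpha> ^ k / Gamma (real n - real k * \<alpha>) *
     (Gamma (real n - real k * \<alpha>) * Gamma (real k) / (\<alpha> * Gamma (real n)) * (1 + l powr \<alpha>) powr (- real k)))"
    using b \<alpha>_pos by (subst ennreal_mult') auto
  also have "\<alpha> ^ k / Gamma (real n - real k * \<alpha>) *
     (Gamma (real n - real k * \<alpha>) * Gamma (real k) / (\<alpha> * Gamma (real n)) * (1 + l powr \<alpha>) powr (- real k)) =
     \<alpha> ^ (k - 1) * Gamma (real k) / Gamma (real n) * (1 + l powr \<alpha>) powr (- real k)"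
    using Gamma_real_pos[OF b] \<alpha>_pos k(1) by (cases k) auto
  finally show ?thesis .
qed

text \<open>By uniqueness of the Stieltjes transform of order \<open>n\<close>, every law with transform
  \<open>(1 + l\<^bsup>\<alpha>\<^esup>)\<^bsup>-k\<^esup>\<close> is proportional to \<open>mix n k\<close>.\<close>
lemma mix_eqI_stieltjes:
  assumes k: "1 \<le> k" "k \<le> n" and \<nu>: "finite_measure \<nu>" and sets_\<nu> [simp, measurable_cong]: "sets \<nu> = sets borel"
    and pos: "AE z in \<nu>. 0 \<le> z"
    and st: "\<And>l. 0 < l \<Longrightarrow> (\<integral>\<^sup>+z. ennreal ((1 + l * z) powr (- real n)) \<partial>\<nu>) = ennreal ((1 + l powr \<alpha>) powr (- real k))"
    and h [measurable]: "h \<in> borel_measurable borel"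
  shows "(\<integral>\<^sup>+z. h z \<partial>mix n k) = ennreal (\<alpha> ^ (k - 1) * Gamma (real k) / Gamma (real n)) * (\<integral>\<^sup>+z. h z \<partial>\<nu>)"
proof -
  interpret \<nu>: finite_measure \<nu> by fact
  interpret mix: finite_measure "mix n k" by (rule finite_mix[OF k])
  define c where "c = \<alpha> ^ (k - 1) * Gamma (real k) / Gamma (real n)"
  have c: "0 \<le> c" using k \<alpha>_pos by (simp add: c_def)
  define N where "N = density \<nu> (\<lambda>_. ennreal c)"
  have sets_N [simp, measurable_cong]: "sets N = sets borel" by (simp add: N_def)
  have nn_N: "(\<integral>\<^sup>+z. \<phi> z \<partial>N) = ennreal c * (\<integral>\<^sup>+z. \<phi> z \<partial>\<nu>)" if [measurable]: "\<phi> \<in> borel_measurable borel" for \<phi>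
    unfolding N_def by (simp add: nn_integral_density nn_integral_cmult)
  have "finite_measure N"
  proof
    have "emeasure N (space N) = (\<integral>\<^sup>+z. 1 \<partial>N)" by simp
    also have "\<dots> = ennreal c * emeasure \<nu> (space \<nu>)" by (subst nn_N) auto
    finally show "emeasure N (space N) \<noteq> \<infinity>"
      by (simp add: \<nu>.emeasure_eq_measure ennreal_mult_eq_top_iff)
  qed
  then interpret N: finite_measure N .
  have "mix n k = N"
  proof (rule stieltjes_determines_measure[where p = "real n"])
    show "sigma_finite_measure (mix n k)" "sigma_finite_measure N" ..
    have "AE z in mix n k. z \<notin> {..0}"
      using nn_integral_mix_nonpos[of n k] by (subst (asm) nn_integral_0_iff_AE) (auto simp: indicator_def)
    then show "AE z in mix n k. 0 \<le> z" by (auto elim!: eventually_mono)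
    show "AE z in N. 0 \<le> z" unfolding N_def using pos by (subst AE_density) auto
    show "0 < real n" using k by simp
    fix l :: real assume l: "0 < l"
    have "(\<integral>\<^sup>+z. ennreal ((1 + l * z) powr (- real n)) \<partial>N) = ennreal c * ennreal ((1 + l powr \<alpha>) powr (- real k))"
      by (simp add: nn_N st[OF l])
    then show "(\<integral>\<^sup>+z. ennreal ((1 + l * z) powr (- real n)) \<partial>mix n k) = (\<integral>\<^sup>+z. ennreal ((1 + l * z) powr (- real n)) \<partial>N)"
      unfolding mix_stieltjes[OF k less_imp_le[OF l], folded c_def] ennreal_mult'[OF c] by simp
    show "(\<integral>\<^sup>+z. ennreal ((1 + l * z) powr (- real n)) \<partial>mix n k) < \<infinity>"
      using mix_stieltjes[OF k less_imp_le[OF l]] by simp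
  qed auto
  then show ?thesis using nn_N[OF h] by (simp add: c_def)
qed

text \<open>The Stieltjes transform of the law of \<open>X\<^sub>\<alpha>\<close>, which is \<open>mix 1 1\<close> because \<open>G\<^bsub>1,1\<^esub> = 1\<close>.\<close>
lemma ratio_stieltjes:
  assumes l: "0 \<le> l"
  shows "(\<integral>\<^sup>+t. ennreal (f t) * (\<integral>\<^sup>+x. ennreal (f x) * ennreal ((1 + l * (x / t)) powr (- 1)) \<partial>lpos) \<partial>lpos) =
    ennreal ((1 + l powr \<alpha>) powr (- 1))"
proof -
  let ?E = "\<lambda>t. (\<integral>\<^sup>+x. ennreal (f x) * ennreal ((1 + l * (x / t)) powr (- 1)) \<partial>lpos)"
  have "(\<integral>\<^sup>+t. ennreal (f t) * ?E t \<partial>lpos) =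
    (\<integral>\<^sup>+t. ennreal (\<alpha> / Gamma (1 - \<alpha>)) * (ennreal (t powr (- \<alpha>)) * frac_avg (1 - \<alpha>) t * ?E t) \<partial>lpos)"
  proof (rule nn_integral_cong_AE, use renewal_frac_avg in eventually_elim)
    fix t assume "ennreal (f t) = ennreal (\<alpha> / Gamma (1 - \<alpha>) * t powr (- \<alpha>)) * frac_avg (1 - \<alpha>) t"
    then have *: "ennreal (f t) = ennreal (\<alpha> / Gamma (1 - \<alpha>)) * ennreal (t powr (- \<alpha>)) * frac_avg (1 - \<alpha>) t"
      by (simp only: ennreal_mult'' powr_ge_zero)
    show "ennreal (f t) * ?E t =
      ennreal (\<alpha> / Gamma (1 - \<alpha>)) * (ennreal (t powr (- \<alpha>)) * frac_avg (1 - \<alpha>) t * ?E t)"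
      by (subst *) (simp only: mult.assoc)
  qed
  also have "\<dots> = (\<integral>\<^sup>+z. ennreal ((1 + l * z) powr (- 1)) \<partial>mix 1 1)"
    by (subst nn_integral_mix) (auto simp: nn_integral_cmult)
  also have "\<dots> = ennreal ((1 + l powr \<alpha>) powr (- 1))"
    using mix_stieltjes[of 1 1 l] l by simp
  finally show ?thesis .
qed

text \<open>After \<open>mixing_subst\<close> only the constants remain to be compared: those of \<open>G\<^bsub>n,k\<^esub>\<close>, of the tilted density
  and of the beta density.\<close>
lemma mix_tilted:
  assumes k: "1 \<le> k" "k \<le> n" and [measurable]: "h \<in> borel_measurable borel"
  shows "(\<integral>\<^sup>+z. h z \<partial>mix n k) = ennreal (\<alpha> ^ (k - 1) * Gamma (real k) / Gamma (real n)) *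
    (\<integral>\<^sup>+u. (\<integral>\<^sup>+t. ennreal (tilted_density \<alpha> (real k * \<alpha>) f t) * (\<integral>\<^sup>+x. ennreal (f x) * h (x / t * u) \<partial>lpos) \<partial>lpos)
       \<partial>beta_law (real k * \<alpha>) (real n - real k * \<alpha>))"
proof -
  define a b where "a = real k * \<alpha>" and "b = real n - real k * \<alpha>"
  have b: "0 < b" unfolding b_def by (rule n_minus_pos[OF k])
  have a: "0 < a" using k \<alpha>_pos by (simp add: a_def)
  have B: "0 < Beta a b" using a b by (simp add: Beta_def)
  let ?E = "\<lambda>t u. (\<integral>\<^sup>+x. ennreal (f x) * h (x / t * u) \<partial>lpos)"
  define K where "K = Gamma (a + 1) / Gamma (a / \<alpha> + 1)"
  have K: "0 < K" using a \<alpha>_pos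
    by (auto simp: K_def intro!: divide_pos_pos Gamma_real_pos add_pos_pos)
  define c where "c = \<alpha> ^ (k - 1) * Gamma (real k) / Gamma (real n)"
  have c: "0 \<le> c" using k \<alpha>_pos by (simp add: c_def)
  define W where "W u = ennreal (u powr (a - 1) * (1 - u) powr (b - 1)) * indicator {..<1} u" for u
  have [measurable]: "W \<in> borel_measurable borel" unfolding W_def by measurable
  define J where "J u = (\<integral>\<^sup>+t. ennreal (t powr (- a) * f t) * ?E t u \<partial>lpos)" for u
  have [measurable]: "J \<in> borel_measurable borel" unfolding J_def by measurable
  have tilt: "(\<integral>\<^sup>+t. ennreal (tilted_density \<alpha> a f t) * ?E t u \<partial>lpos) = ennreal K * J u" for u
  proof -
    have "(\<integral>\<^sup>+t. ennreal (tilted_density \<alpha> a f t) * ?E t u \<partial>lpos) =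
       (\<integral>\<^sup>+t. ennreal K * (ennreal (t powr (- a) * f t) * ?E t u) \<partial>lpos)"
      using K by (intro nn_integral_lpos_cong)
        (simp add: tilted_density_def K_def[symmetric] ennreal_mult'[symmetric] mult.assoc[symmetric])
    also have "\<dots> = ennreal K * J u"
      unfolding J_def by (rule nn_integral_cmult) measurable
    finally show ?thesis .
  qed
  have "(\<integral>\<^sup>+u. ennreal K * J u \<partial>beta_law a b) =
      (\<integral>\<^sup>+u. ennreal (K / Beta a b) * (W u * J u) \<partial>lpos)"
  proof -
    have "ennreal (u powr (a - 1) * (1 - u) powr (b - 1) / Beta a b) * indicator {..<1} u * (ennreal K * J u) =
        ennreal (K / Beta a b) * (W u * J u)" for u
    proof -
      have *: "ennreal (u powr (a - 1) * (1 - u) powr (b - 1) / Beta a b) * ennreal K =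
          ennreal (K / Beta a b) * ennreal (u powr (a - 1) * (1 - u) powr (b - 1))"
        using K B by (subst (1 2) ennreal_mult[symmetric]) auto
      have "ennreal (u powr (a - 1) * (1 - u) powr (b - 1) / Beta a b) * indicator {..<1} u * (ennreal K * J u) =
          (ennreal (u powr (a - 1) * (1 - u) powr (b - 1) / Beta a b) * ennreal K) * (indicator {..<1} u * J u)"
        by (simp only: mult_ac)
      then show ?thesis unfolding * W_def by (simp only: mult.assoc)
    qed
    then show ?thesis using b by (subst nn_integral_beta_law) auto
  qed
  also have "\<dots> = ennreal (K / Beta a b) * (\<integral>\<^sup>+u. W u * J u \<partial>lpos)"
    by (rule nn_integral_cmult) measurable
  finally have rhs: "(\<integral>\<^sup>+u. ennreal K * J u \<partial>beta_law a b) = ennreal (K / Beta a b) * (\<integral>\<^sup>+u. W u * J u \<partial>lpos)" .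
  have "(\<integral>\<^sup>+z. h z \<partial>mix n k) = ennreal (\<alpha> ^ k / Gamma b) * (\<integral>\<^sup>+u. W u *
      (\<integral>\<^sup>+s. ennreal (s powr (- a) * f s) * (\<integral>\<^sup>+x. ennreal (f x) * h (x / (s / u)) \<partial>lpos) \<partial>lpos) \<partial>lpos)"
    unfolding W_def
    by (subst nn_integral_mix, simp, subst mixing_subst) (simp_all add: a_def b_def)
  also have "\<dots> = ennreal (\<alpha> ^ k / Gamma b) * (\<integral>\<^sup>+u. W u * J u \<partial>lpos)"
    by (simp add: J_def)
  also have "\<alpha> ^ k / Gamma b = c * (K / Beta a b)"
  proof -
    have G1: "Gamma (x + 1) = x * Gamma x" if "0 < x" for x :: real
      using that by (intro Gamma_plus1) (auto dest: nonpos_Ints_nonpos)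
    have ga: "Gamma (a + 1) = a * Gamma a" by (rule G1[OF a])
    have gk: "Gamma (a / \<alpha> + 1) = real k * Gamma (real k)" using k \<alpha>_pos by (simp add: a_def G1)
    have pk: "\<alpha> ^ k = \<alpha> * \<alpha> ^ (k - 1)" using k by (cases k) auto
    have n: "a + b = real n" by (simp add: a_def b_def)
    have ne: "Gamma x \<noteq> 0" if "0 < x" for x :: real
      using Gamma_real_pos[OF that] by linarith
    have cancel: "\<alpha> * p / gb = p * gk / gn * (a' * ga / (k' * gk) / (ga * gb / gn))"
      if "gn \<noteq> 0" "gk \<noteq> 0" "ga \<noteq> 0" "gb \<noteq> 0" "k' \<noteq> 0" "a' = k' * \<alpha>" for p gn gk ga gb a' k' :: real
      using that by (simp add: field_simps)
    show ?thesis
      unfolding c_def K_def Beta_def ga gk pk n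
      by (rule cancel) (use k a b in \<open>auto intro!: ne simp: a_def\<close>)
  qed
  also have "ennreal (c * (K / Beta a b)) * (\<integral>\<^sup>+u. W u * J u \<partial>lpos) = ennreal c * (\<integral>\<^sup>+u. ennreal K * J u \<partial>beta_law a b)"
    unfolding rhs using c by (subst ennreal_mult') (auto simp: mult.assoc)
  finally show ?thesis unfolding tilt[symmetric] a_def b_def c_def .
qed

lemma integral_scaled_stable:
  fixes g :: "real \<Rightarrow> real"
  assumes [measurable]: "g \<in> borel_measurable borel" and g0: "\<And>x. 0 < x \<Longrightarrow> 0 \<le> g x" and t: "0 < t"
  shows "(\<integral>x. f x * g (x / t) \<partial>lpos) = enn2real (\<integral>\<^sup>+x. ennreal (f x) * ennreal (g (x / t)) \<partial>lpos)"
proof -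
  have "(\<integral>x. f x * g (x / t) \<partial>lpos) = enn2real (\<integral>\<^sup>+x. ennreal (f x * g (x / t)) \<partial>lpos)"
    using AE_lpos_pos by (intro integral_eq_nn_integral) (auto elim!: eventually_mono simp: g0 t)
  then show ?thesis by (simp add: ennreal_mult')
qed

text \<open>All integrals are first computed with values in \<open>[0, \<infinity>]\<close>. Finiteness of \<open>E g(X\<^sub>\<alpha>)\<close> and the bound on
  \<open>mix n k\<close> then allow the passage to Bochner integrals. At almost every \<open>t\<close> the quantities
  \<open>f t > 0\<close>, the fractional integral and \<open>E g(S'/t)\<close> are finite, so that no default value enters.\<close>
lemma PK_V_mix:
  fixes g \<gamma> :: "real \<Rightarrow> real" and L :: real
  assumes k: "1 \<le> k" "k \<le> n" and [measurable]: "g \<in> borel_measurable borel"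
    and g0: "\<And>x. 0 < x \<Longrightarrow> 0 \<le> g x" and L: "0 \<le> L"
    and \<gamma>: "\<And>t. 0 < t \<Longrightarrow> \<gamma> t = L * (\<integral>x. f x * g (x / t) \<partial>lpos) * f t"
    and fin: "(\<integral>\<^sup>+t. ennreal (f t) * (\<integral>\<^sup>+x. ennreal (f x) * ennreal (g (x / t)) \<partial>lpos) \<partial>lpos) < \<infinity>"
  shows "PK_V_converges \<alpha> f \<gamma> n k"
    and "PK_V \<alpha> f \<gamma> n k = L * enn2real (\<integral>\<^sup>+z. ennreal (g z) \<partial>mix n k)"
    and "(\<integral>\<^sup>+z. ennreal (g z) \<partial>mix n k) < \<infinity>"
proof -
  define a b where "a = real k * \<alpha>" and "b = real n - real k * \<alpha>"
  have b: "0 < b" unfolding b_def by (rule n_minus_pos[OF k])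
  have Gb: "0 < Gamma b" using b by simp
  define \<phi> where "\<phi> t = (\<integral>\<^sup>+x. ennreal (f x) * ennreal (g (x / t)) \<partial>lpos)" for t
  have [measurable]: "\<phi> \<in> borel_measurable borel" unfolding \<phi>_def by measurable
  have e_eq: "(\<integral>x. f x * g (x / t) \<partial>lpos) = enn2real (\<phi> t)" if "0 < t" for t
    unfolding \<phi>_def by (rule integral_scaled_stable[OF _ g0 that]) measurable
  define v where "v t = \<alpha> ^ k * t powr (- a) / (Gamma b * f t) * enn2real (frac_avg b t) * (L * enn2real (\<phi> t) * f t)" for t
  have [measurable]: "v \<in> borel_measurable borel" unfolding v_def by measurable
  have v_eq: "PK_G \<alpha> f n k t * \<gamma> t = v t" if t: "0 < t" for t
  proof -
    have "(LBINT u:{0<..<1}. f (t * u) * (1 - u) powr (b - 1)) =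
        enn2real (\<integral>\<^sup>+u. ennreal (indicator {0<..<1} u * (f (t * u) * (1 - u) powr (b - 1))) \<partial>lborel)"
      unfolding set_lebesgue_integral_def by (subst integral_eq_nn_integral) auto
    also have "(\<integral>\<^sup>+u. ennreal (indicator {0<..<1} u * (f (t * u) * (1 - u) powr (b - 1))) \<partial>lborel) = frac_avg b t"
      unfolding frac_avg_def by (subst nn_integral_lpos) (auto intro!: nn_integral_cong split: split_indicator)
    finally show ?thesis
      unfolding PK_G_def v_def \<gamma>[OF t] e_eq[OF t] by (simp add: a_def b_def)
  qed
  obtain C where C: "0 \<le> C" "AE t in lpos. ennreal (t powr (- a)) * frac_avg b t \<le> ennreal (C * f t)"
    unfolding a_def b_def using frac_avg_bound[OF k] by blast
  have "AE t in lpos. ennreal (f t) * \<phi> t \<noteq> \<infinity>"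
    using fin unfolding \<phi>_def[symmetric] by (intro nn_integral_noteq_infinite) auto
  then have v_nn: "AE t in lpos. 0 \<le> v t \<and> ennreal (v t) = ennreal (L * (\<alpha> ^ k / Gamma b)) * (ennreal (t powr (- a)) * frac_avg b t * \<phi> t)"
    using f_pos AE_lpos_pos C(2)
  proof eventually_elim
    fix t assume fin: "ennreal (f t) * \<phi> t \<noteq> \<infinity>" and ft: "0 < f t" and t: "0 < t"
      and le: "ennreal (t powr (- a)) * frac_avg b t \<le> ennreal (C * f t)"
    have "\<phi> t \<noteq> \<infinity>" using fin ft by (auto simp: ennreal_mult_eq_top_iff)
    then obtain r where r: "0 \<le> r" "\<phi> t = ennreal r" by (cases "\<phi> t") auto
    have "ennreal (t powr (- a)) * frac_avg b t \<noteq> \<infinity>" using le by (auto simp: top_unique)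
    then have "frac_avg b t \<noteq> \<infinity>" using t by (auto simp: ennreal_mult_eq_top_iff)
    then obtain i where i: "0 \<le> i" "frac_avg b t = ennreal i" by (cases "frac_avg b t") auto
    have "v t = L * (\<alpha> ^ k / Gamma b) * (t powr (- a) * i * r)"
      using ft r i by (simp add: v_def)
    moreover have "0 \<le> L * (\<alpha> ^ k / Gamma b)" "0 \<le> t powr (- a) * i"
      using L \<alpha>_pos Gb i by auto
    ultimately show "0 \<le> v t \<and> ennreal (v t) = ennreal (L * (\<alpha> ^ k / Gamma b)) * (ennreal (t powr (- a)) * frac_avg b t * \<phi> t)"
      using r i by (simp only: ennreal_mult' powr_ge_zero mult_nonneg_nonneg simp_thms)
  qed
  have mix_eq: "(\<integral>\<^sup>+z. ennreal (g z) \<partial>mix n k) = ennreal (\<alpha> ^ k / Gamma b) * (\<integral>\<^sup>+t. ennreal (t powr (- a)) * frac_avg b t * \<phi> t \<partial>lpos)"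
    unfolding \<phi>_def a_def b_def by (rule nn_integral_mix) measurable
  have "(\<integral>\<^sup>+t. ennreal (v t) \<partial>lpos) = (\<integral>\<^sup>+t. ennreal (L * (\<alpha> ^ k / Gamma b)) * (ennreal (t powr (- a)) * frac_avg b t * \<phi> t) \<partial>lpos)"
    by (rule nn_integral_cong_AE) (use v_nn in \<open>auto elim!: eventually_mono\<close>)
  also have "\<dots> = ennreal (L * (\<alpha> ^ k / Gamma b)) * (\<integral>\<^sup>+t. ennreal (t powr (- a)) * frac_avg b t * \<phi> t \<partial>lpos)"
    by (rule nn_integral_cmult) measurable
  also have "\<dots> = ennreal L * (\<integral>\<^sup>+z. ennreal (g z) \<partial>mix n k)"
    unfolding mix_eq using L by (simp only: ennreal_mult' mult.assoc)
  finally have nn_v: "(\<integral>\<^sup>+t. ennreal (v t) \<partial>lpos) = ennreal L * (\<integral>\<^sup>+z. ennreal (g z) \<partial>mix n k)" .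
  obtain C' :: real where "(\<integral>\<^sup>+z. ennreal (g z) \<partial>mix n k) \<le>
      ennreal C' * (\<integral>\<^sup>+t. ennreal (f t) * (\<integral>\<^sup>+x. ennreal (f x) * ennreal (g (x / t)) \<partial>lpos) \<partial>lpos)"
    using nn_integral_mix_bound[OF k] by fastforce
  also have "\<dots> < \<infinity>" using fin by (simp add: ennreal_mult_less_top)
  finally show fin_mix: "(\<integral>\<^sup>+z. ennreal (g z) \<partial>mix n k) < \<infinity>" .
  have v0: "AE t in lpos. 0 \<le> v t" using v_nn by (auto elim!: eventually_mono)
  have int_v: "integrable lpos v"
    using v0 fin_mix by (intro integrableI_nonneg) (auto simp: nn_v ennreal_mult_less_top)
  have "set_integrable lborel {0<..} (\<lambda>t. PK_G \<alpha> f n k t * \<gamma> t) \<longleftrightarrow> set_integrable lborel {0<..} v"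
    using v_eq by (intro set_integrable_cong) auto
  then show "PK_V_converges \<alpha> f \<gamma> n k"
    unfolding PK_V_converges_def using int_v by (simp add: set_integrable_lpos)
  have "PK_V \<alpha> f \<gamma> n k = (LBINT t:{0<..}. v t)"
    unfolding PK_V_def using v_eq by (intro set_lebesgue_integral_cong) auto
  also have "\<dots> = integral\<^sup>L lpos v" by (rule set_integral_lpos) measurable
  also have "\<dots> = enn2real (\<integral>\<^sup>+t. ennreal (v t) \<partial>lpos)"
    using v0 by (intro integral_eq_nn_integral) auto
  also have "\<dots> = L * enn2real (\<integral>\<^sup>+z. ennreal (g z) \<partial>mix n k)"
    unfolding nn_v using L by (simp add: enn2real_mult)
  finally show "PK_V \<alpha> f \<gamma> n k = L * enn2real (\<integral>\<^sup>+z. ennreal (g z) \<partial>mix n k)" .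
qed

end

section \<open>Products of independent variables\<close>

lemma (in prob_space) indep_rv_distr:
  assumes "indep_rv M N X K Y" and [measurable]: "X \<in> M \<rightarrow>\<^sub>M N" "Y \<in> M \<rightarrow>\<^sub>M K"
  shows "distr M N X \<Otimes>\<^sub>M distr M K Y = distr M (N \<Otimes>\<^sub>M K) (\<lambda>\<omega>. (X \<omega>, Y \<omega>))"
proof (rule pair_measure_eqI)
  show "sigma_finite_measure (distr M N X)" "sigma_finite_measure (distr M K Y)"
    by (auto intro!: prob_space_imp_sigma_finite prob_space_distr)
next
  fix A B assume "A \<in> sets (distr M N X)" "B \<in> sets (distr M K Y)"
  then have AB [measurable]: "A \<in> sets N" "B \<in> sets K" by auto
  have "emeasure (distr M N X) A * emeasure (distr M K Y) B =
     ennreal (prob (X -` A \<inter> space M) * prob (Y -` B \<inter> space M))"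
    by (simp add: emeasure_distr emeasure_eq_measure ennreal_mult)
  also have "prob (X -` A \<inter> space M) * prob (Y -` B \<inter> space M) = prob ((X -` A \<inter> space M) \<inter> (Y -` B \<inter> space M))"
    using assms(1) AB unfolding indep_rv_def by (intro indep_setD[symmetric]) auto
  also have "(X -` A \<inter> space M) \<inter> (Y -` B \<inter> space M) = (\<lambda>\<omega>. (X \<omega>, Y \<omega>)) -` (A \<times> B) \<inter> space M"
    by auto
  finally show "emeasure (distr M N X) A * emeasure (distr M K Y) B =
      emeasure (distr M (N \<Otimes>\<^sub>M K) (\<lambda>\<omega>. (X \<omega>, Y \<omega>))) (A \<times> B)"
    by (simp add: emeasure_distr emeasure_eq_measure)
qed simp

lemma (in prob_space) nn_integral_indep:
  assumes eq: "distr M N X \<Otimes>\<^sub>M distr M K Y = distr M (N \<Otimes>\<^sub>M K) (\<lambda>\<omega>. (X \<omega>, Y \<omega>))"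
    and [measurable]: "X \<in> M \<rightarrow>\<^sub>M N" "Y \<in> M \<rightarrow>\<^sub>M K" and h: "h \<in> borel_measurable (N \<Otimes>\<^sub>M K)"
  shows "(\<integral>\<^sup>+\<omega>. h (X \<omega>, Y \<omega>) \<partial>M) = (\<integral>\<^sup>+y. \<integral>\<^sup>+x. h (x, y) \<partial>distr M N X \<partial>distr M K Y)"
proof -
  interpret X: prob_space "distr M N X" by (rule prob_space_distr) measurable
  interpret Y: prob_space "distr M K Y" by (rule prob_space_distr) measurable
  interpret pair_sigma_finite "distr M N X" "distr M K Y" ..
  have "(\<integral>\<^sup>+\<omega>. h (X \<omega>, Y \<omega>) \<partial>M) = (\<integral>\<^sup>+p. h p \<partial>distr M (N \<Otimes>\<^sub>M K) (\<lambda>\<omega>. (X \<omega>, Y \<omega>)))"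
    using h by (subst nn_integral_distr) auto
  also have "\<dots> = (\<integral>\<^sup>+y. \<integral>\<^sup>+x. h (x, y) \<partial>distr M N X \<partial>distr M K Y)"
    using h unfolding eq[symmetric] by (intro nn_integral_snd[symmetric]) simp
  finally show ?thesis .
qed

lemma (in prob_space) nn_integral_indep':
  assumes eq: "distr M N X \<Otimes>\<^sub>M distr M K Y = distr M (N \<Otimes>\<^sub>M K) (\<lambda>\<omega>. (X \<omega>, Y \<omega>))"
    and [measurable]: "X \<in> M \<rightarrow>\<^sub>M N" "Y \<in> M \<rightarrow>\<^sub>M K" and h: "h \<in> borel_measurable (N \<Otimes>\<^sub>M K)"
  shows "(\<integral>\<^sup>+\<omega>. h (X \<omega>, Y \<omega>) \<partial>M) = (\<integral>\<^sup>+\<omega>. \<integral>\<^sup>+y. h (X \<omega>, y) \<partial>distr M K Y \<partial>M)"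
proof -
  interpret Y: prob_space "distr M K Y" by (rule prob_space_distr) measurable
  have [measurable]: "(\<lambda>x. \<integral>\<^sup>+y. h (x, y) \<partial>distr M K Y) \<in> borel_measurable N"
    using h by (intro Y.borel_measurable_nn_integral_fst) simp
  have "(\<integral>\<^sup>+\<omega>. h (X \<omega>, Y \<omega>) \<partial>M) = (\<integral>\<^sup>+p. h p \<partial>distr M (N \<Otimes>\<^sub>M K) (\<lambda>\<omega>. (X \<omega>, Y \<omega>)))"
    using h by (subst nn_integral_distr) auto
  also have "\<dots> = (\<integral>\<^sup>+x. \<integral>\<^sup>+y. h (x, y) \<partial>distr M K Y \<partial>distr M N X)"
    using h unfolding eq[symmetric] by (intro Y.nn_integral_fst[symmetric]) simp
  also have "\<dots> = (\<integral>\<^sup>+\<omega>. \<integral>\<^sup>+y. h (X \<omega>, y) \<partial>distr M K Y \<partial>M)"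
    by (rule nn_integral_distr) measurable
  finally show ?thesis .
qed

text \<open>Proportionality to a measure without mass on \<open>(-\<infinity>, 0]\<close> makes \<open>Z\<close> almost surely positive. Hence
  \<open>g Z \<ge> 0\<close>, and the real expectation is the integral with values in \<open>[0, \<infinity>]\<close>.\<close>
lemma (in prob_space) expectation_via_proportional_law:
  fixes g :: "real \<Rightarrow> real"
  assumes [measurable]: "Z \<in> borel_measurable M" "g \<in> borel_measurable borel"
    and g0: "\<And>x. 0 < x \<Longrightarrow> 0 \<le> g x" and c: "0 < c"
    and law: "\<And>h. h \<in> borel_measurable borel \<Longrightarrow> (\<integral>\<^sup>+z. h z \<partial>\<mu>) = ennreal c * (\<integral>\<^sup>+\<omega>. h (Z \<omega>) \<partial>M)"
    and pos: "(\<integral>\<^sup>+z. indicator {..0} z \<partial>\<mu>) = 0"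
    and fin: "(\<integral>\<^sup>+z. ennreal (g z) \<partial>\<mu>) < \<infinity>"
  shows "integrable M (\<lambda>\<omega>. g (Z \<omega>))"
    and "enn2real (\<integral>\<^sup>+z. ennreal (g z) \<partial>\<mu>) = c * (\<integral>\<omega>. g (Z \<omega>) \<partial>M)"
proof -
  have "ennreal c * (\<integral>\<^sup>+\<omega>. indicator {..0} (Z \<omega>) \<partial>M) = 0"
    using law[of "indicator {..0}"] pos by simp
  then have "(\<integral>\<^sup>+\<omega>. indicator {..0} (Z \<omega>) \<partial>M) = 0" using c by simp
  then have "AE \<omega> in M. indicator {..0} (Z \<omega>) = (0::ennreal)"
    by (subst (asm) nn_integral_0_iff_AE) auto
  then have "AE \<omega> in M. 0 < Z \<omega>"
    by eventually_elim (simp add: indicator_eq_0_iff)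
  then have g_nn: "AE \<omega> in M. 0 \<le> g (Z \<omega>)" using g0 by (auto elim!: eventually_mono)
  have eq: "(\<integral>\<^sup>+z. ennreal (g z) \<partial>\<mu>) = ennreal c * (\<integral>\<^sup>+\<omega>. ennreal (g (Z \<omega>)) \<partial>M)"
    by (rule law) measurable
  have "(\<integral>\<^sup>+\<omega>. ennreal (g (Z \<omega>)) \<partial>M) < \<infinity>"
    using fin c unfolding eq by (auto simp: ennreal_mult_less_top)
  then show "integrable M (\<lambda>\<omega>. g (Z \<omega>))"
    using g_nn by (intro integrableI_nonneg) auto
  have "(\<integral>\<omega>. g (Z \<omega>) \<partial>M) = enn2real (\<integral>\<^sup>+\<omega>. ennreal (g (Z \<omega>)) \<partial>M)"
    using g_nn by (intro integral_eq_nn_integral) auto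
  then show "enn2real (\<integral>\<^sup>+z. ennreal (g z) \<partial>\<mu>) = c * (\<integral>\<omega>. g (Z \<omega>) \<partial>M)"
    unfolding eq using c by (simp add: enn2real_mult)
qed

text \<open>An independent beta factor raises the order of the transform from \<open>a\<close> to \<open>a + b\<close> without changing its
  value. The nonnegative variable is written as \<open>F (X \<omega>)\<close> so that \<open>X\<close> may be a family of variables.\<close>
lemma (in prob_space) beta_factor_stieltjes:
  assumes eq: "distr M N X \<Otimes>\<^sub>M distr M borel B = distr M (N \<Otimes>\<^sub>M borel) (\<lambda>\<omega>. (X \<omega>, B \<omega>))"
    and [measurable]: "X \<in> M \<rightarrow>\<^sub>M N" "B \<in> borel_measurable M" "F \<in> borel_measurable N"
    and F0: "AE \<omega> in M. 0 \<le> F (X \<omega>)" and B: "distr M borel B = beta_law a b"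
    and ab: "0 < a" "0 \<le> b" and l: "0 \<le> (l::real)"
  shows "(\<integral>\<^sup>+\<omega>. ennreal ((1 + l * (F (X \<omega>) * B \<omega>)) powr (- (a + b))) \<partial>M) =
    (\<integral>\<^sup>+\<omega>. ennreal ((1 + l * F (X \<omega>)) powr (- a)) \<partial>M)"
proof -
  have "(\<integral>\<^sup>+\<omega>. (\<lambda>(x, u). ennreal ((1 + l * (F x * u)) powr (- (a + b)))) (X \<omega>, B \<omega>) \<partial>M) =
    (\<integral>\<^sup>+\<omega>. \<integral>\<^sup>+u. (\<lambda>(x, u). ennreal ((1 + l * (F x * u)) powr (- (a + b)))) (X \<omega>, u) \<partial>distr M borel B \<partial>M)"
    by (rule nn_integral_indep'[OF eq]) measurable
  also have "\<dots> = (\<integral>\<^sup>+\<omega>. ennreal ((1 + l * F (X \<omega>)) powr (- a)) \<partial>M)"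
  proof (rule nn_integral_cong_AE, use F0 in eventually_elim)
    fix \<omega> assume "0 \<le> F (X \<omega>)"
    then have "0 \<le> l * F (X \<omega>)" using l by simp
    from beta_law_stieltjes[OF ab this]
    show "(\<integral>\<^sup>+u. (\<lambda>(x, u). ennreal ((1 + l * (F x * u)) powr (- (a + b)))) (X \<omega>, u) \<partial>distr M borel B) =
        ennreal ((1 + l * F (X \<omega>)) powr (- a))"
      unfolding B by (simp add: mult.assoc)
  qed
  finally show ?thesis by simp
qed

lemma measurable_sum_product_PiM:
  fixes k :: nat
  defines "N \<equiv> PiM {1..k} (\<lambda>_. borel :: real measure)"
  shows "(\<lambda>p. \<Sum>j=1..k. fst p j * snd p j) \<in> borel_measurable (N \<Otimes>\<^sub>M N)"
proof (intro borel_measurable_sum borel_measurable_times)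
  fix j assume "j \<in> {1..k}"
  then have "(\<lambda>x. x j) \<in> borel_measurable N"
    unfolding N_def by (rule measurable_component_singleton)
  then show "(\<lambda>p. fst p j) \<in> borel_measurable (N \<Otimes>\<^sub>M N)" "(\<lambda>p. snd p j) \<in> borel_measurable (N \<Otimes>\<^sub>M N)"
    by (rule measurable_compose[OF measurable_fst] measurable_compose[OF measurable_snd])+
qed

lemmas (in prob_space) indep_var_distr =
  indep_var_distribution_eq[THEN iffD1, THEN conjunct2, THEN conjunct2]

text \<open>Conditionally on the \<open>X\<^sub>j\<close>, the Dirichlet average has a transform that is a product over \<open>j\<close>.\<close>
lemma (in prob_space) dirichlet_average_stieltjes:
  fixes X D :: "nat \<Rightarrow> 'a \<Rightarrow> real"
  assumes k: "1 \<le> k" and indep: "indep_vars (\<lambda>_. borel) X {1..k}"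
    and [measurable]: "\<And>j. j \<in> {1..k} \<Longrightarrow> D j \<in> borel_measurable M"
    and D: "distr M (PiM {1..k} (\<lambda>_. borel)) (\<lambda>\<omega>. \<lambda>j\<in>{1..k}. D j \<omega>) = dirichlet_law k (\<lambda>_. 1)"
    and XD: "indep_var (PiM {1..k} (\<lambda>_. borel)) (\<lambda>\<omega>. \<lambda>j\<in>{1..k}. X j \<omega>) (PiM {1..k} (\<lambda>_. borel)) (\<lambda>\<omega>. \<lambda>j\<in>{1..k}. D j \<omega>)"
    and X0: "\<And>j. j \<in> {1..k} \<Longrightarrow> AE \<omega> in M. 0 \<le> X j \<omega>" and l: "0 \<le> l"
  shows "(\<integral>\<^sup>+\<omega>. ennreal ((1 + l * (\<Sum>j=1..k. X j \<omega> * D j \<omega>)) powr (- real k)) \<partial>M) =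
    (\<Prod>j=1..k. \<integral>\<^sup>+\<omega>. ennreal ((1 + l * X j \<omega>) powr (- 1)) \<partial>M)"
proof -
  let ?N = "PiM {1..k} (\<lambda>_. borel :: real measure)"
  have X_meas [measurable]: "X j \<in> borel_measurable M" if "j \<in> {1..k}" for j
    using indep that by (auto simp: indep_vars_def)
  have Xr: "(\<lambda>\<omega>. \<lambda>j\<in>{1..k}. X j \<omega>) \<in> M \<rightarrow>\<^sub>M ?N" and Dr: "(\<lambda>\<omega>. \<lambda>j\<in>{1..k}. D j \<omega>) \<in> M \<rightarrow>\<^sub>M ?N"
    by (auto intro!: measurable_restrict)
  note eq = indep_var_distr[OF XD]
  define h where "h p = ennreal ((1 + l * (\<Sum>j=1..k. fst p j * snd p j)) powr (- real k))" for p :: "(nat \<Rightarrow> real) \<times> (nat \<Rightarrow> real)"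
  have h_meas: "h \<in> borel_measurable (?N \<Otimes>\<^sub>M ?N)"
    using measurable_sum_product_PiM[of k] unfolding h_def by measurable
  have "(\<integral>\<^sup>+\<omega>. ennreal ((1 + l * (\<Sum>j=1..k. X j \<omega> * D j \<omega>)) powr (- real k)) \<partial>M) =
      (\<integral>\<^sup>+\<omega>. h (\<lambda>j\<in>{1..k}. X j \<omega>, \<lambda>j\<in>{1..k}. D j \<omega>) \<partial>M)"
    by (simp add: h_def)
  also have "\<dots> = (\<integral>\<^sup>+\<omega>. \<integral>\<^sup>+d. h (\<lambda>j\<in>{1..k}. X j \<omega>, d) \<partial>dirichlet_law k (\<lambda>_. 1) \<partial>M)"
    unfolding D[symmetric] by (rule nn_integral_indep'[OF eq Xr Dr h_meas])
  also have "\<dots> = (\<integral>\<^sup>+\<omega>. (\<Prod>j=1..k. ennreal ((1 + l * X j \<omega>) powr (- 1))) \<partial>M)"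
  proof (rule nn_integral_cong_AE)
    have "AE \<omega> in M. \<forall>j\<in>{1..k}. 0 \<le> X j \<omega>"
      using X0 by (intro AE_finite_allI) auto
    then show "AE \<omega> in M. (\<integral>\<^sup>+d. h (\<lambda>j\<in>{1..k}. X j \<omega>, d) \<partial>dirichlet_law k (\<lambda>_. 1)) =
        (\<Prod>j=1..k. ennreal ((1 + l * X j \<omega>) powr (- 1)))"
    proof eventually_elim
      fix \<omega> assume X: "\<forall>j\<in>{1..k}. 0 \<le> X j \<omega>"
      have "(\<integral>\<^sup>+d. h (\<lambda>j\<in>{1..k}. X j \<omega>, d) \<partial>dirichlet_law k (\<lambda>_. 1)) =
         (\<integral>\<^sup>+d. ennreal ((1 + (\<Sum>j=1..k. (l * X j \<omega>) * d j)) powr (- real k)) \<partial>dirichlet_law k (\<lambda>_. 1))"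
        by (simp add: h_def sum_distrib_left mult.assoc)
      also have "\<dots> = (\<Prod>j=1..k. ennreal (1 / (1 + l * X j \<omega>)))"
        using X l by (intro dirichlet_stieltjes k) auto
      also have "\<dots> = (\<Prod>j=1..k. ennreal ((1 + l * X j \<omega>) powr (- 1)))"
        using X l by (intro prod.cong) (auto simp: powr_minus_divide)
      finally show "(\<integral>\<^sup>+d. h (\<lambda>j\<in>{1..k}. X j \<omega>, d) \<partial>dirichlet_law k (\<lambda>_. 1)) =
        (\<Prod>j=1..k. ennreal ((1 + l * X j \<omega>) powr (- 1)))" .
    qed
  qed
  also have "\<dots> = (\<Prod>j=1..k. \<integral>\<^sup>+\<omega>. ennreal ((1 + l * X j \<omega>) powr (- 1)) \<partial>M)"
    using indep_vars_compose2[OF indep, of "\<lambda>_ x. ennreal ((1 + l * x) powr (- 1))" "\<lambda>_. borel"]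
    by (intro indep_vars_nn_integral) auto
  finally show ?thesis .
qed

lemma (in prob_space) distr_eq_density_lpos:
  assumes "distributed M lborel S (\<lambda>t. ennreal (f t))" "AE \<omega> in M. 0 < S \<omega>"
  shows "distr M borel S = density lpos (\<lambda>t. ennreal (f t))"
proof -
  have [measurable]: "(\<lambda>t. ennreal (f t)) \<in> borel_measurable borel" and S [measurable]: "S \<in> borel_measurable M"
    and d: "distr M lborel S = density lborel (\<lambda>t. ennreal (f t))"
    using assms(1) by (auto simp: distributed_def)
  have d': "distr M borel S = density lborel (\<lambda>t. ennreal (f t))"
    unfolding d[symmetric] by (rule distr_cong) auto
  have "AE s in distr M borel S. 0 < s"
    using assms(2) by (subst AE_distr_iff) auto
  then have "AE s in lborel. 0 < ennreal (f s) \<longrightarrow> 0 < s"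
    unfolding d' by (subst (asm) AE_density) auto
  then have "AE s in lborel. ennreal (f s) = ennreal (indicator {0<..} s) * ennreal (f s)"
    by eventually_elim (auto simp: indicator_def zero_less_iff_neq_zero)
  then have "density lborel (\<lambda>t. ennreal (f t)) = density lborel (\<lambda>s. ennreal (indicator {0<..} s) * ennreal (f s))"
    by (intro density_cong) auto
  then show ?thesis
    unfolding d' lpos_def by (subst density_density_eq) auto
qed

lemma (in prob_space) stable_density_of_positive_stable:
  assumes \<alpha>: "0 < \<alpha>" "\<alpha> < 1" and S: "positive_stable M \<alpha> S" and f: "\<And>t. 0 \<le> f t"
    and d: "distributed M lborel S (\<lambda>t. ennreal (f t))"
  shows "stable_density \<alpha> f"
proof
  have [measurable]: "(\<lambda>t. ennreal (f t)) \<in> borel_measurable borel"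
    using d by (auto simp: distributed_def)
  have "(\<lambda>t. enn2real (ennreal (f t))) \<in> borel_measurable borel" by measurable
  then show [measurable]: "f \<in> borel_measurable borel" using f by simp
  have [measurable]: "S \<in> borel_measurable M" and pos: "AE \<omega> in M. 0 < S \<omega>"
    using S by (auto simp: positive_stable_def)
  fix l :: real assume l: "0 \<le> l"
  have "integrable M (\<lambda>\<omega>. exp (- l * S \<omega>))"
    by (rule integrable_const_bound[where B = 1]) (use pos l in \<open>auto elim!: eventually_mono\<close>)
  then have "(\<integral>\<^sup>+\<omega>. ennreal (exp (- l * S \<omega>)) \<partial>M) = ennreal (exp (- (l powr \<alpha>)))"
    using S l by (subst nn_integral_eq_integral) (auto simp: positive_stable_def)
  also have "(\<integral>\<^sup>+\<omega>. ennreal (exp (- l * S \<omega>)) \<partial>M) = (\<integral>\<^sup>+s. ennreal (exp (- l * s)) \<partial>distr M borel S)"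
    by (subst nn_integral_distr) auto
  also have "\<dots> = (\<integral>\<^sup>+s. ennreal (f s * exp (- (l * s))) \<partial>lpos)"
    unfolding distr_eq_density_lpos[OF d pos] by (subst nn_integral_density) (auto simp: ennreal_mult' f)
  finally show "(\<integral>\<^sup>+s. ennreal (f s * exp (- (l * s))) \<partial>lpos) = ennreal (exp (- (l powr \<alpha>)))" .
qed (use \<alpha> f in auto)

lemma (in prob_space) nn_integral_ratio:
  assumes [measurable]: "S \<in> borel_measurable M" "T \<in> borel_measurable M" and "indep_var borel S borel T"
    and S: "distr M borel S = density lpos (\<lambda>t. ennreal (f t))" and T: "distr M borel T = density lpos (\<lambda>t. ennreal (\<tau> t))"
    and [measurable]: "f \<in> borel_measurable borel" "\<tau> \<in> borel_measurable borel" "h \<in> borel_measurable borel"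
  shows "(\<integral>\<^sup>+\<omega>. h (S \<omega> / T \<omega>) \<partial>M) = (\<integral>\<^sup>+t. ennreal (\<tau> t) * (\<integral>\<^sup>+x. ennreal (f x) * h (x / t) \<partial>lpos) \<partial>lpos)"
proof -
  note eq = indep_var_distr[OF assms(3)]
  have "(\<integral>\<^sup>+\<omega>. (\<lambda>(x, t). h (x / t)) (S \<omega>, T \<omega>) \<partial>M) = (\<integral>\<^sup>+t. \<integral>\<^sup>+x. (\<lambda>(x, t). h (x / t)) (x, t) \<partial>distr M borel S \<partial>distr M borel T)"
    by (rule nn_integral_indep[OF eq]) measurable
  also have "\<dots> = (\<integral>\<^sup>+t. ennreal (\<tau> t) * (\<integral>\<^sup>+x. ennreal (f x) * h (x / t) \<partial>lpos) \<partial>lpos)"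
    unfolding S T by (simp add: nn_integral_density)
  finally show ?thesis by simp
qed

section \<open>The weights of the model\<close>

theorem proposition7p1:
  fixes M :: "'a measure" and S S' :: "'a \<Rightarrow> real"
    and f g \<gamma> :: "real \<Rightarrow> real" and \<alpha> L :: real and n :: nat
  assumes "prob_space M"
    and "0 < \<alpha>" and "\<alpha> < 1"
    and "positive_stable M \<alpha> S" and "positive_stable M \<alpha> S'"
    and "prob_space.indep_var M borel S borel S'"
    and "\<And>t. 0 \<le> f t"
    and "distributed M lborel S (\<lambda>t. ennreal (f t))"
    and "distributed M lborel S' (\<lambda>t. ennreal (f t))"
    and "g \<in> borel_measurable borel" and "\<And>x. 0 < x \<Longrightarrow> 0 \<le> g x"
    and "integrable M (\<lambda>\<omega>. g (S \<omega> / S' \<omega>))"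
    and "0 < (\<integral>\<omega>. g (S \<omega> / S' \<omega>) \<partial>M)"
    and "L = 1 / (\<integral>\<omega>. g (S \<omega> / S' \<omega>) \<partial>M)"
    and "\<And>t. 0 < t \<Longrightarrow> \<gamma> t = L * (\<integral>\<omega>. g (S' \<omega> / t) \<partial>M) * f t"
    and "1 \<le> n"
  shows
    "(\<forall>t>0. 0 \<le> \<gamma> t) \<and> (LBINT t:{0<..}. \<gamma> t) = 1 \<and>
     (\<forall>k\<in>{1..n}. PK_V_converges \<alpha> f \<gamma> n k) \<and>
     (\<forall>B. B \<in> borel_measurable M \<and> distr M borel B = beta_law 1 (real n - 1) \<and>
        prob_space.indep_var M borel (\<lambda>\<omega>. S \<omega> / S' \<omega>) borel B \<longrightarrow>
        integrable M (\<lambda>\<omega>. g (S \<omega> / S' \<omega> * B \<omega>)) \<and>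
        PK_V \<alpha> f \<gamma> n 1 = 1 / Gamma (real n) * L * (\<integral>\<omega>. g (S \<omega> / S' \<omega> * B \<omega>) \<partial>M)) \<and>
     (\<forall>k\<in>{1..n}. \<forall>T B.
        distributed M lborel T (\<lambda>t. ennreal (tilted_density \<alpha> (real k * \<alpha>) f t)) \<and>
        prob_space.indep_var M borel S borel T \<and>
        B \<in> borel_measurable M \<and>
        distr M borel B = beta_law (real k * \<alpha>) (real n - real k * \<alpha>) \<and>
        prob_space.indep_var M borel (\<lambda>\<omega>. S \<omega> / T \<omega>) borel B \<longrightarrow>
        integrable M (\<lambda>\<omega>. g (S \<omega> / T \<omega> * B \<omega>)) \<and>
        PK_V \<alpha> f \<gamma> n k =
          \<alpha> ^ (k - 1) * Gamma (real k) / Gamma (real n) * L *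
          (\<integral>\<omega>. g (S \<omega> / T \<omega> * B \<omega>) \<partial>M)) \<and>
     (\<forall>k\<in>{1..n}. \<forall>(X :: nat \<Rightarrow> 'a \<Rightarrow> real) (D :: nat \<Rightarrow> 'a \<Rightarrow> real) B.
        prob_space.indep_vars M (\<lambda>_. borel) X {1..k} \<and>
        (\<forall>j\<in>{1..k}. distr M borel (X j) = distr M borel (\<lambda>\<omega>. S \<omega> / S' \<omega>)) \<and>
        (\<forall>j\<in>{1..k}. D j \<in> borel_measurable M) \<and>
        distr M (PiM {1..k} (\<lambda>_. borel)) (\<lambda>\<omega>. \<lambda>j\<in>{1..k}. D j \<omega>) = dirichlet_law k (\<lambda>_. 1) \<and>
        prob_space.indep_var M
          (PiM {1..k} (\<lambda>_. borel)) (\<lambda>\<omega>. \<lambda>j\<in>{1..k}. X j \<omega>)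
          (PiM {1..k} (\<lambda>_. borel)) (\<lambda>\<omega>. \<lambda>j\<in>{1..k}. D j \<omega>) \<and>
        B \<in> borel_measurable M \<and>
        distr M borel B = beta_law (real k) (real n - real k) \<and>
        indep_rv M
          (PiM {1..k} (\<lambda>_. borel) \<Otimes>\<^sub>M PiM {1..k} (\<lambda>_. borel))
            (\<lambda>\<omega>. (\<lambda>j\<in>{1..k}. X j \<omega>, \<lambda>j\<in>{1..k}. D j \<omega>))
          borel B \<longrightarrow>
        integrable M (\<lambda>\<omega>. g (B \<omega> * (\<Sum>j=1..k. X j \<omega> * D j \<omega>))) \<and>
        PK_V \<alpha> f \<gamma> n k =
          \<alpha> ^ (k - 1) * Gamma (real k) / Gamma (real n) * L *
          (\<integral>\<omega>. g (B \<omega> * (\<Sum>j=1..k. X j \<omega> * D j \<omega>)) \<partial>M))"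
proof -
  let ?E = "\<lambda>t. (\<integral>\<^sup>+x. ennreal (f x) * ennreal (g (x / t)) \<partial>lpos)"
  let ?c = "\<lambda>k. \<alpha> ^ (k - 1) * Gamma (real k) / Gamma (real n)"
  let ?concl = "\<lambda>k Z. integrable M (\<lambda>\<omega>. g (Z \<omega>)) \<and> PK_V \<alpha> f \<gamma> n k = ?c k * L * (\<integral>\<omega>. g (Z \<omega>) \<partial>M)"
  let ?r = "\<lambda>k (Y :: nat \<Rightarrow> 'a \<Rightarrow> real) \<omega>. \<lambda>j\<in>{1..k}. Y j \<omega>"
  interpret prob_space M by fact
  interpret stable_density \<alpha> f
    by (rule stable_density_of_positive_stable) fact+
  note [measurable] = \<open>g \<in> borel_measurable borel\<close>
  have S [measurable]: "S \<in> borel_measurable M" and S_pos: "AE \<omega> in M. 0 < S \<omega>"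
    using \<open>positive_stable M \<alpha> S\<close> by (auto simp: positive_stable_def)
  have S' [measurable]: "S' \<in> borel_measurable M" and S'_pos: "AE \<omega> in M. 0 < S' \<omega>"
    using \<open>positive_stable M \<alpha> S'\<close> by (auto simp: positive_stable_def)
  have law_S: "distr M borel S = density lpos (\<lambda>t. ennreal (f t))"
    by (rule distr_eq_density_lpos) fact+
  have law_S': "distr M borel S' = density lpos (\<lambda>t. ennreal (f t))"
    by (rule distr_eq_density_lpos) fact+
  have ratio: "(\<integral>\<^sup>+\<omega>. h (S \<omega> / S' \<omega>) \<partial>M) = (\<integral>\<^sup>+t. ennreal (f t) * (\<integral>\<^sup>+x. ennreal (f x) * h (x / t) \<partial>lpos) \<partial>lpos)"
    if "h \<in> borel_measurable borel" for h
    by (rule nn_integral_ratio[OF S S' \<open>indep_var borel S borel S'\<close> law_S law_S' f_meas f_meas that])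
  define E where "E = (\<integral>\<omega>. g (S \<omega> / S' \<omega>) \<partial>M)"
  have E: "0 < E" "L = 1 / E" using assms by (simp_all add: E_def)
  then have L: "0 < L" by simp
  have SS': "AE \<omega> in M. 0 < S \<omega> / S' \<omega>" using S_pos S'_pos by eventually_elim simp
  \<comment> \<open>\<open>\<gamma>\<close> involves \<open>S' / S\<close>, but both variables have density f, so the roles of S and \<open>S'\<close> may be exchanged\<close>
  have J: "(\<integral>\<^sup>+t. ennreal (f t) * ?E t \<partial>lpos) = ennreal E"
  proof -
    have "(\<integral>\<^sup>+t. ennreal (f t) * ?E t \<partial>lpos) = (\<integral>\<^sup>+\<omega>. ennreal (g (S \<omega> / S' \<omega>)) \<partial>M)"
      by (rule ratio[symmetric]) measurable
    also have "\<dots> = ennreal E"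
      unfolding E_def using SS' \<open>\<And>x. 0 < x \<Longrightarrow> 0 \<le> g x\<close>
      by (intro nn_integral_eq_integral) (auto elim!: eventually_mono intro: assms)
    finally show ?thesis .
  qed
  have \<gamma>: "\<gamma> t = L * (\<integral>x. f x * g (x / t) \<partial>lpos) * f t" if t: "0 < t" for t
  proof -
    have "(\<integral>\<omega>. g (S' \<omega> / t) \<partial>M) = (\<integral>x. g (x / t) \<partial>distr M borel S')"
      by (subst integral_distr) auto
    also have "\<dots> = (\<integral>x. f x * g (x / t) \<partial>lpos)"
      unfolding law_S' by (subst integral_density) auto
    finally show ?thesis using assms(15)[OF t] by simp
  qed
  have fin: "(\<integral>\<^sup>+t. ennreal (f t) * ?E t \<partial>lpos) < \<infinity>"
    by (simp add: J)
  have PK: "PK_V_converges \<alpha> f \<gamma> n k"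
      "PK_V \<alpha> f \<gamma> n k = L * enn2real (\<integral>\<^sup>+z. ennreal (g z) \<partial>mix n k)"
      "(\<integral>\<^sup>+z. ennreal (g z) \<partial>mix n k) < \<infinity>" if "1 \<le> k" "k \<le> n" for k
    using PK_V_mix[OF that, of g L \<gamma>] \<gamma> fin L assms(10,11) by auto
  define e where "e t = (\<integral>x. f x * g (x / t) \<partial>lpos)" for t
  have [measurable]: "e \<in> borel_measurable borel" unfolding e_def by measurable
  define \<phi> where "\<phi> t = ?E t" for t
  have [measurable]: "\<phi> \<in> borel_measurable borel" unfolding \<phi>_def by measurable
  have e_eq: "e t = enn2real (\<phi> t)" if "0 < t" for t
    unfolding e_def \<phi>_def by (rule integral_scaled_stable[OF _ assms(11) that]) measurable
  then have e_nn: "0 \<le> e t" if "0 < t" for t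
    using that by simp
  have \<gamma>_nn: "\<forall>t>0. 0 \<le> \<gamma> t"
    using \<gamma> e_nn L by (auto simp: e_def)
  have \<gamma>_int: "(LBINT t:{0<..}. \<gamma> t) = 1"
  proof -
    have "(LBINT t:{0<..}. \<gamma> t) = (LBINT t:{0<..}. L * e t * f t)"
      using \<gamma> by (intro set_lebesgue_integral_cong) (auto simp: e_def)
    also have "\<dots> = (\<integral>t. L * e t * f t \<partial>lpos)" by (rule set_integral_lpos) measurable
    also have "\<dots> = L * (\<integral>t. f t * e t \<partial>lpos)" by (simp add: mult_ac)
    also have "(\<integral>t. f t * e t \<partial>lpos) = enn2real (\<integral>\<^sup>+t. ennreal (f t * e t) \<partial>lpos)"
      using AE_lpos_pos by (intro integral_eq_nn_integral) (auto elim!: eventually_mono simp: e_nn)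
    also have "(\<integral>\<^sup>+t. ennreal (f t * e t) \<partial>lpos) = (\<integral>\<^sup>+t. ennreal (f t) * \<phi> t \<partial>lpos)"
    proof (rule nn_integral_cong_AE)
      have "AE t in lpos. ennreal (f t) * \<phi> t \<noteq> \<infinity>"
        using fin unfolding \<phi>_def[symmetric] by (intro nn_integral_noteq_infinite) auto
      then show "AE t in lpos. ennreal (f t * e t) = ennreal (f t) * \<phi> t"
        using AE_lpos_pos
      proof eventually_elim
        case (elim t)
        then show ?case
          by (cases "f t = 0") (auto simp: e_eq ennreal_mult' ennreal_mult_eq_top_iff less_top)
      qed
    qed
    also have "\<dots> = ennreal E" unfolding \<phi>_def by (rule J)
    finally show ?thesis using E by simp
  qed
  have conv: "\<forall>k\<in>{1..n}. PK_V_converges \<alpha> f \<gamma> n k"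
    using PK(1) by auto
  have conclude: "?concl k Z"
    if k: "k \<in> {1..n}" and Z: "Z \<in> borel_measurable M"
      and law: "\<And>h. h \<in> borel_measurable borel \<Longrightarrow> (\<integral>\<^sup>+z. h z \<partial>mix n k) =
        ennreal (?c k) * (\<integral>\<^sup>+\<omega>. h (Z \<omega>) \<partial>M)"
    for k Z
  proof -
    have k': "1 \<le> k" "k \<le> n" using k by auto
    have c: "0 < ?c k"
      using k' \<alpha>_pos by simp
    have "integrable M (\<lambda>\<omega>. g (Z \<omega>))"
      using Z assms(10,11) c law nn_integral_mix_nonpos PK(3)[OF k']
      by (rule expectation_via_proportional_law(1))
    moreover have "enn2real (\<integral>\<^sup>+z. ennreal (g z) \<partial>mix n k) =
        ?c k * (\<integral>\<omega>. g (Z \<omega>) \<partial>M)"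
      using Z assms(10,11) c law nn_integral_mix_nonpos PK(3)[OF k']
      by (rule expectation_via_proportional_law(2))
    ultimately show ?thesis using PK(2)[OF k'] by simp
  qed
  have conclude_stieltjes: "?concl k Z"
    if k: "k \<in> {1..n}" and Z [measurable]: "Z \<in> borel_measurable M" and Z0: "AE \<omega> in M. 0 \<le> Z \<omega>"
      and st: "\<And>l. 0 < l \<Longrightarrow> (\<integral>\<^sup>+\<omega>. ennreal ((1 + l * Z \<omega>) powr (- real n)) \<partial>M) = ennreal ((1 + l powr \<alpha>) powr (- real k))"
    for k Z
  proof (rule conclude[OF k Z])
    fix h :: "real \<Rightarrow> ennreal" assume h [measurable]: "h \<in> borel_measurable borel"
    have "(\<integral>\<^sup>+z. h z \<partial>mix n k) = ennreal (?c k) * (\<integral>\<^sup>+z. h z \<partial>distr M borel Z)"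
    proof (rule mix_eqI_stieltjes)
      show "finite_measure (distr M borel Z)"
        using prob_space.finite_measure prob_space_distr[OF Z] by blast
      show "AE z in distr M borel Z. 0 \<le> z" using Z0 by (subst AE_distr_iff) auto
      show "(\<integral>\<^sup>+z. ennreal ((1 + l * z) powr (- real n)) \<partial>distr M borel Z) = ennreal ((1 + l powr \<alpha>) powr (- real k))"
        if "0 < l" for l
        using st[OF that] by (subst nn_integral_distr) auto
    qed (use k in auto)
    then show "(\<integral>\<^sup>+z. h z \<partial>mix n k) = ennreal (?c k) * (\<integral>\<^sup>+\<omega>. h (Z \<omega>) \<partial>M)"
      by (simp add: nn_integral_distr)
  qed
  have X_st: "(\<integral>\<^sup>+\<omega>. ennreal ((1 + l * (S \<omega> / S' \<omega>)) powr (- 1)) \<partial>M) = ennreal ((1 + l powr \<alpha>) powr (- 1))"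
    if "0 \<le> l" for l
    using ratio_stieltjes[OF that] by (subst ratio) auto
  have B_nn: "AE \<omega> in M. 0 \<le> B \<omega>" if [measurable]: "B \<in> borel_measurable M" and "distr M borel B = beta_law a b" for B a b
  proof -
    have "AE u in distr M borel B. 0 \<le> u" unfolding that(2) by (rule AE_beta_law_nonneg)
    then show ?thesis by (subst (asm) AE_distr_iff) auto
  qed
  \<comment> \<open>With \<open>n = k = 1\<close> the beta factor is 1, and \<open>X\<^sub>\<alpha>\<close> has the transform \<open>(1 + l\<^bsup>\<alpha>\<^esup>)\<^bsup>-1\<^esup>\<close> of order 1; the factor beta(1, n - 1) raises the order to n.\<close>
  have part1: "integrable M (\<lambda>\<omega>. g (S \<omega> / S' \<omega> * B \<omega>)) \<and>
      PK_V \<alpha> f \<gamma> n 1 = 1 / Gamma (real n) * L * (\<integral>\<omega>. g (S \<omega> / S' \<omega> * B \<omega>) \<partial>M)"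
    if B [measurable]: "B \<in> borel_measurable M" and B_law: "distr M borel B = beta_law 1 (real n - 1)"
      and indep: "indep_var borel (\<lambda>\<omega>. S \<omega> / S' \<omega>) borel B" for B
  proof -
    note eq = indep_var_distr[OF indep]
    have "?concl 1 (\<lambda>\<omega>. S \<omega> / S' \<omega> * B \<omega>)"
    proof (rule conclude_stieltjes)
      show "1 \<in> {1..n}" using \<open>1 \<le> n\<close> by simp
      show "AE \<omega> in M. 0 \<le> S \<omega> / S' \<omega> * B \<omega>"
        using SS' B_nn[OF B B_law] by eventually_elim (metis less_imp_le mult_nonneg_nonneg)
      fix l :: real assume l: "0 < l"
      have "(\<integral>\<^sup>+\<omega>. ennreal ((1 + l * (S \<omega> / S' \<omega> * B \<omega>)) powr (- (1 + (real n - 1)))) \<partial>M) =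
          (\<integral>\<^sup>+\<omega>. ennreal ((1 + l * (S \<omega> / S' \<omega>)) powr (- 1)) \<partial>M)"
      proof (rule beta_factor_stieltjes[OF eq, where F = "\<lambda>x. x"])
        show "AE \<omega> in M. 0 \<le> S \<omega> / S' \<omega>" using SS' by (rule eventually_mono) (rule less_imp_le)
        show "(0::real) \<le> real n - 1" using \<open>1 \<le> n\<close> by simp
      qed (use B_law l in simp_all)
      then show "(\<integral>\<^sup>+\<omega>. ennreal ((1 + l * (S \<omega> / S' \<omega> * B \<omega>)) powr (- real n)) \<partial>M) = ennreal ((1 + l powr \<alpha>) powr (- real 1))"
        using X_st l by simp
    qed measurable
    then show ?thesis by (simp add: Gamma_1)
  qed
  \<comment> \<open>Independence alone: the law of the product is an iterated integral, namely that of \<open>mix_tilted\<close>.\<close>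
  have part2: "?concl k (\<lambda>\<omega>. S \<omega> / T \<omega> * B \<omega>)"
    if k: "k \<in> {1..n}" and T: "distributed M lborel T (\<lambda>t. ennreal (tilted_density \<alpha> (real k * \<alpha>) f t))"
      and ST: "indep_var borel S borel T" and B [measurable]: "B \<in> borel_measurable M"
      and B_law: "distr M borel B = beta_law (real k * \<alpha>) (real n - real k * \<alpha>)"
      and indep: "indep_var borel (\<lambda>\<omega>. S \<omega> / T \<omega>) borel B" for k T B
  proof (rule conclude[OF k])
    let ?\<tau> = "tilted_density \<alpha> (real k * \<alpha>) f"
    have T_meas [measurable]: "T \<in> borel_measurable M" using T by (auto simp: distributed_def)
    show "(\<lambda>\<omega>. S \<omega> / T \<omega> * B \<omega>) \<in> borel_measurable M" by measurable
    have \<tau>_meas [measurable]: "?\<tau> \<in> borel_measurable borel"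
      unfolding tilted_density_def by measurable
    have T_pos: "AE \<omega> in M. 0 < T \<omega>"
    proof -
      have "AE t in lborel. 0 < ennreal (?\<tau> t) \<longrightarrow> 0 < t"
        by (auto simp: tilted_density_def)
      then have "AE t in density lborel (\<lambda>t. ennreal (?\<tau> t)). 0 < t"
        by (subst AE_density) auto
      then have "AE t in distr M lborel T. 0 < t"
        using T unfolding distributed_def by metis
      then show ?thesis by (rule AE_distrD[rotated]) simp
    qed
    have law_T: "distr M borel T = density lpos (\<lambda>t. ennreal (?\<tau> t))"
      by (rule distr_eq_density_lpos[OF T T_pos])
    note eq = indep_var_distr[OF indep]
    fix h :: "real \<Rightarrow> ennreal" assume h [measurable]: "h \<in> borel_measurable borel"
    have "(\<integral>\<^sup>+\<omega>. h (S \<omega> / T \<omega> * B \<omega>) \<partial>M) = (\<integral>\<^sup>+\<omega>. (\<lambda>(q, u). h (q * u)) (S \<omega> / T \<omega>, B \<omega>) \<partial>M)"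
      by simp
    also have "\<dots> = (\<integral>\<^sup>+u. \<integral>\<^sup>+q. (\<lambda>(q, u). h (q * u)) (q, u) \<partial>distr M borel (\<lambda>\<omega>. S \<omega> / T \<omega>) \<partial>distr M borel B)"
      by (rule nn_integral_indep[OF eq]) measurable
    also have "\<dots> = (\<integral>\<^sup>+u. \<integral>\<^sup>+\<omega>. h (S \<omega> / T \<omega> * u) \<partial>M \<partial>beta_law (real k * \<alpha>) (real n - real k * \<alpha>))"
      unfolding B_law by (simp add: nn_integral_distr)
    also have "\<dots> = (\<integral>\<^sup>+u. (\<integral>\<^sup>+t. ennreal (?\<tau> t) * (\<integral>\<^sup>+x. ennreal (f x) * h (x / t * u) \<partial>lpos) \<partial>lpos)
        \<partial>beta_law (real k * \<alpha>) (real n - real k * \<alpha>))"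
      using nn_integral_ratio[OF S T_meas ST law_S law_T f_meas \<tau>_meas, of "\<lambda>q. h (q * u)" for u] by simp
    finally show "(\<integral>\<^sup>+z. h z \<partial>mix n k) =
        ennreal (?c k) * (\<integral>\<^sup>+\<omega>. h (S \<omega> / T \<omega> * B \<omega>) \<partial>M)"
      using k by (simp add: mix_tilted)
  qed
  \<comment> \<open>The Dirichlet average has the transform \<open>(1 + l\<^bsup>\<alpha>\<^esup>)\<^bsup>-k\<^esup>\<close> of order k; the factor beta(k, n - k) raises the order to n.\<close>
  have part3: "?concl k (\<lambda>\<omega>. B \<omega> * (\<Sum>j=1..k. X j \<omega> * D j \<omega>))"
    if k: "k \<in> {1..n}" and X: "indep_vars (\<lambda>_. borel) X {1..k}"
      and X_law: "\<forall>j\<in>{1..k}. distr M borel (X j) = distr M borel (\<lambda>\<omega>. S \<omega> / S' \<omega>)"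
      and D: "\<forall>j\<in>{1..k}. D j \<in> borel_measurable M"
      and D_law: "distr M (PiM {1..k} (\<lambda>_. borel)) (?r k D) = dirichlet_law k (\<lambda>_. 1)"
      and XD: "indep_var (PiM {1..k} (\<lambda>_. borel)) (?r k X)
          (PiM {1..k} (\<lambda>_. borel)) (?r k D)"
      and B [measurable]: "B \<in> borel_measurable M" and B_law: "distr M borel B = beta_law (real k) (real n - real k)"
      and indep: "indep_rv M (PiM {1..k} (\<lambda>_. borel) \<Otimes>\<^sub>M PiM {1..k} (\<lambda>_. borel))
            (\<lambda>\<omega>. (\<lambda>j\<in>{1..k}. X j \<omega>, \<lambda>j\<in>{1..k}. D j \<omega>)) borel B"
    for k and X D :: "nat \<Rightarrow> 'a \<Rightarrow> real" and B
  proof (rule conclude_stieltjes[OF k])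
    have k': "1 \<le> k" "k \<le> n" using k by auto
    let ?N = "PiM {1..k} (\<lambda>_. borel :: real measure)"
    define W where "W \<omega> = (\<lambda>j\<in>{1..k}. X j \<omega>, \<lambda>j\<in>{1..k}. D j \<omega>)" for \<omega>
    define F where "F p = (\<Sum>j=1..k. fst p j * snd p j)" for p :: "(nat \<Rightarrow> real) \<times> (nat \<Rightarrow> real)"
    have X_meas [measurable]: "X j \<in> borel_measurable M" if "j \<in> {1..k}" for j
      using X that by (auto simp: indep_vars_def)
    have D_meas [measurable]: "D j \<in> borel_measurable M" if "j \<in> {1..k}" for j
      using D that by auto
    have Xr: "(?r k X) \<in> M \<rightarrow>\<^sub>M ?N" and Dr: "(?r k D) \<in> M \<rightarrow>\<^sub>M ?N"
      by (auto intro!: measurable_restrict)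
    have W_meas: "W \<in> M \<rightarrow>\<^sub>M ?N \<Otimes>\<^sub>M ?N"
      unfolding W_def by (rule measurable_Pair[OF Xr Dr])
    have F_meas: "F \<in> borel_measurable (?N \<Otimes>\<^sub>M ?N)"
      unfolding F_def by (rule measurable_sum_product_PiM)
    have FW: "F (W \<omega>) = (\<Sum>j=1..k. X j \<omega> * D j \<omega>)" for \<omega>
      by (simp add: F_def W_def)
    have FW_meas [measurable]: "(\<lambda>\<omega>. \<Sum>j=1..k. X j \<omega> * D j \<omega>) \<in> borel_measurable M"
      by measurable
    show "(\<lambda>\<omega>. B \<omega> * (\<Sum>j=1..k. X j \<omega> * D j \<omega>)) \<in> borel_measurable M" by measurable
    have eq: "distr M (?N \<Otimes>\<^sub>M ?N) W \<Otimes>\<^sub>M distr M borel B = distr M ((?N \<Otimes>\<^sub>M ?N) \<Otimes>\<^sub>M borel) (\<lambda>\<omega>. (W \<omega>, B \<omega>))"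
      using indep by (intro indep_rv_distr W_meas B) (simp add: W_def[abs_def])
    have X_nn: "AE \<omega> in M. 0 \<le> X j \<omega>" if j: "j \<in> {1..k}" for j
    proof -
      have "AE x in distr M borel (\<lambda>\<omega>. S \<omega> / S' \<omega>). 0 \<le> x"
        using SS' by (subst AE_distr_iff) (auto elim!: eventually_mono)
      then have "AE x in distr M borel (X j). 0 \<le> x"
        using X_law j by metis
      then show ?thesis by (rule AE_distrD[OF X_meas[OF j]])
    qed
    have "AE d in distr M ?N (?r k D). \<forall>j\<in>{1..k}. 0 \<le> d j"
      unfolding D_law by (rule AE_dirichlet_law_nonneg[OF k'(1)])
    from AE_distrD[OF Dr this] have D_nn: "AE \<omega> in M. \<forall>j\<in>{1..k}. 0 \<le> D j \<omega>"
      by (auto elim!: eventually_mono)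
    have "AE \<omega> in M. \<forall>j\<in>{1..k}. 0 \<le> X j \<omega>"
      using X_nn by (intro AE_finite_allI) auto
    then have F_nn: "AE \<omega> in M. 0 \<le> F (W \<omega>)"
      using D_nn unfolding FW by eventually_elim (auto intro!: sum_nonneg)
    show "AE \<omega> in M. 0 \<le> B \<omega> * (\<Sum>j=1..k. X j \<omega> * D j \<omega>)"
      using F_nn B_nn[OF B B_law] unfolding FW by eventually_elim simp
    fix l :: real assume l: "0 < l"
    have "(\<integral>\<^sup>+\<omega>. ennreal ((1 + l * (B \<omega> * (\<Sum>j=1..k. X j \<omega> * D j \<omega>))) powr (- real n)) \<partial>M) =
        (\<integral>\<^sup>+\<omega>. ennreal ((1 + l * (F (W \<omega>) * B \<omega>)) powr (- (real k + (real n - real k)))) \<partial>M)"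
      by (simp add: FW mult.commute)
    also have "\<dots> = (\<integral>\<^sup>+\<omega>. ennreal ((1 + l * F (W \<omega>)) powr (- real k)) \<partial>M)"
      using k' l by (intro beta_factor_stieltjes[OF eq W_meas B F_meas F_nn B_law]) auto
    also have "\<dots> = (\<Prod>j=1..k. \<integral>\<^sup>+\<omega>. ennreal ((1 + l * X j \<omega>) powr (- 1)) \<partial>M)"
      unfolding FW using l by (intro dirichlet_average_stieltjes k' X D_meas D_law XD X_nn) auto
    also have "\<dots> = (\<Prod>j=1..k. ennreal ((1 + l powr \<alpha>) powr (- 1)))"
    proof (rule prod.cong[OF refl])
      fix j assume j: "j \<in> {1..k}"
      have "(\<integral>\<^sup>+\<omega>. ennreal ((1 + l * X j \<omega>) powr (- 1)) \<partial>M) = (\<integral>\<^sup>+x. ennreal ((1 + l * x) powr (- 1)) \<partial>distr M borel (X j))"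
        using X_meas[OF j] by (subst nn_integral_distr) auto
      also have "\<dots> = (\<integral>\<^sup>+x. ennreal ((1 + l * x) powr (- 1)) \<partial>distr M borel (\<lambda>\<omega>. S \<omega> / S' \<omega>))"
        using X_law j by simp
      also have "\<dots> = ennreal ((1 + l powr \<alpha>) powr (- 1))"
        using X_st[of l] l by (subst nn_integral_distr) auto
      finally show "(\<integral>\<^sup>+\<omega>. ennreal ((1 + l * X j \<omega>) powr (- 1)) \<partial>M) = ennreal ((1 + l powr \<alpha>) powr (- 1))" .
    qed
    also have "\<dots> = ennreal ((1 + l powr \<alpha>) powr (- real k))"
    proof -
      have "((1 + l powr \<alpha>) powr (- 1)) ^ k = ((1 + l powr \<alpha>) powr (- 1)) powr real k"
        using powr_ge_zero[of l \<alpha>] by (intro powr_realpow[symmetric]) (auto simp del: powr_ge_zero)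
      also have "\<dots> = (1 + l powr \<alpha>) powr (- real k)"
        by (simp only: powr_powr) simp
      finally have "(1 + l powr \<alpha>) powr (- real k) = ((1 + l powr \<alpha>) powr (- 1)) ^ k" ..
      moreover have "(\<Prod>j=1..k. ennreal c) = ennreal (c ^ k)" if "0 \<le> c" for c
        using that by (simp add: ennreal_power)
      ultimately show ?thesis by (simp only: powr_ge_zero)
    qed
    finally show "(\<integral>\<^sup>+\<omega>. ennreal ((1 + l * (B \<omega> * (\<Sum>j=1..k. X j \<omega> * D j \<omega>))) powr (- real n)) \<partial>M) =
      ennreal ((1 + l powr \<alpha>) powr (- real k))" .
  qed
  show ?thesis
    apply (intro conjI)
    subgoal by (rule \<gamma>_nn)
    subgoal by (rule \<gamma>_int)
    subgoal by (rule conv)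
    subgoal using part1 by blast
    subgoal using part2 by blast
    subgoal using part3 by blast
    done
qed

end
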